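(* Let $\mathcal{A}\in Sp(2d,\mathbb{R})$. (i) If $W_{\mathcal{A}}$ is covariant, then for all $\varphi_1,\varphi_2\in\mathcal{S}(\mathbb{R}^d)\setminus\{0\}$ and all $a\in\mathcal{S}'(\mathbb{R}^{2d})$, $$A_a^{\varphi_1,\varphi_2}=\operatorname{Op}_{\mathcal{A}}\big(a*W_{\mathcal{A}}(\varphi_2,\varphi_1)\big)$$ as operators from $\mathcal{S}(\mathbb{R}^d)$ to $\mathcal{S}'(\mathbb{R}^d)$. (ii) Conversely, if this identity holds for all $a\in\mathcal{S}'(\mathbb{R}^{2d})$ and all $\varphi_1,\varphi_2\in\mathcal{S}(\mathbb{R}^d)$, then $W_{\mathcal{A}}$ is covariant.
   Context: Brackets $\langle f,g\rangle$ extend the $L^2$ inner product $\int f\overline{g}$ (conjugate-linear in the second entry) to $\mathcal{S}'\times\mathcal{S}$. For $z=(x,\xi)\in\mathbb{R}^{2d}$, $\pi(z)=M_\xi T_x$ with $T_xf(t)=f(t-x)$, $M_\xi f(t)=e^{2\pi i\xi\cdot t}f(t)$. The short-time Fourier transform is $V_gf(z)=\langle f,\pi(z)g\rangle$. Classical localization operator: for $\varphi_1,\varphi_2\in\mathcal{S}(\mathbb{R}^d)$, $a\in\mathcal{S}'(\mathbb{R}^{2d})$, $A_a^{\varphi_1,\varphi_2}:\mathcal{S}(\mathbb{R}^d)\to\mathcal{S}'(\mathbb{R}^d)$ is given by $A_a^{\varphi_1,\varphi_2}f=\int_{\mathbb{R}^{2d}}a(z)V_{\varphi_1}f(z)\,\pi(z)\varphi_2\,dz$,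 that is, $\langle A_a^{\varphi_1,\varphi_2}f,g\rangle=\langle a,\overline{V_{\varphi_1}f}\,V_{\varphi_2}g\rangle$ for $f,g\in\mathcal{S}(\mathbb{R}^d)$. Metaplectic operators: $Sp(2d,\mathbb{R})$ is the group of real $4d\times4d$ matrices $\mathcal{A}$ with $\mathcal{A}^TJ\mathcal{A}=J$, $J=\begin{pmatrix}0&I_{2d}\\-I_{2d}&0\end{pmatrix}$. For $x,\xi\in\mathbb{R}^{2d}$, $\tau\in\mathbb{R}$ let $\rho(x,\xi;\tau)=e^{2\pi i\tau}e^{-\pi i\xi\cdot x}M_\xi T_x$ acting on $L^2(\mathbb{R}^{2d})$. For $\mathcal{A}\in Sp(2d,\mathbb{R})$, $\hat{\mathcal{A}}$ denotes a metaplectic operator with projection $\mathcal{A}$: a unitary operator on $L^2(\mathbb{R}^{2d})$ with $\hat{\mathcal{A}}\rho(w;\tau)\hat{\mathcal{A}}^{-1}=\rho(\mathcal{A}w;\tau)$ for all $w\in\mathbb{R}^{4d}$, $\tau\in\mathbb{R}$. It is unique up to a unimodular constant (whose choice is immaterial here), and it restricts to an automorphism of $\mathcal{S}(\mathbb{R}^{2d})$ and extends to one of $\mathcal{S}'(\mathbb{R}^{2d})$. The metaplectic Wigner distribution is $W_{\mathcal{A}}(f,g)=\hat{\mathcal{A}}(f\otimes\overline{g})$, where $(f\otimes \overline g)(x,y)=f(x)\overline{g(y)}$, for $f,g\in L^2(\mathbb{R}^d)$. It maps $\mathcal{S}(\mathbb{R}^d)\times\mathcal{S}(\mathbb{R}^d)$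 to $\mathcal{S}(\mathbb{R}^{2d})$. $W_{\mathcal{A}}$ is called covariant if $W_{\mathcal{A}}(\pi(z)f,\pi(z)g)=T_zW_{\mathcal{A}}(f,g)$ for all $f,g\in L^2(\mathbb{R}^d)$, $z\in\mathbb{R}^{2d}$. For $\sigma\in\mathcal{S}'(\mathbb{R}^{2d})$, $\operatorname{Op}_{\mathcal{A}}(\sigma):\mathcal{S}(\mathbb{R}^d)\to\mathcal{S}'(\mathbb{R}^d)$ is defined by $\langle\operatorname{Op}_{\mathcal{A}}(\sigma)f,g\rangle=\langle\sigma,W_{\mathcal{A}}(g,f)\rangle$, $f,g\in\mathcal{S}(\mathbb{R}^d)$. *)

theory Defs
  imports "HOL-Analysis.Analysis"
begin

text \<open>Throughout, \<open>\<real>\<^sup>d\<close> is \<^typ>\<open>real ^ 'n\<close> and \<open>\<real>\<^sup>2\<^sup>d\<close> is \<^typ>\<open>real ^ ('n + 'n)\<close>: a point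
  \<open>z = (x, \<xi>)\<close> has \<open>x\<close> in the \<^const>\<open>Inl\<close> and \<open>\<xi>\<close> in the \<^const>\<open>Inr\<close> coordinates.\<close>

definition fst_part :: "real ^ ('m::finite + 'm) \<Rightarrow> real ^ 'm" where
  "fst_part z = (\<chi> i. z $ Inl i)"

definition snd_part :: "real ^ ('m::finite + 'm) \<Rightarrow> real ^ 'm" where
  "snd_part z = (\<chi> i. z $ Inr i)"

section \<open>Schwartz functions and tempered distributions\<close>

definition partial_deriv :: "'m::finite \<Rightarrow> (real ^ 'm \<Rightarrow> complex) \<Rightarrow> real ^ 'm \<Rightarrow> complex" where
  "partial_deriv i f x = frechet_derivative f (at x) (axis i 1)"

text \<open>A multi-index derivative \<open>\<partial>\<^sup>\<beta>\<close> is written as a list of coordinate directions.\<close>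

fun partial_derivs :: "'m::finite list \<Rightarrow> (real ^ 'm \<Rightarrow> complex) \<Rightarrow> real ^ 'm \<Rightarrow> complex" where
  "partial_derivs [] f = f"
| "partial_derivs (i # is) f = partial_deriv i (partial_derivs is f)"

definition schwartz :: "(real ^ 'm::finite \<Rightarrow> complex) set" where
  "schwartz = {f. \<forall>is. (\<forall>x. partial_derivs is f differentiable at x) \<and>
     (\<forall>k. bdd_above (range (\<lambda>x. norm x ^ k * cmod (partial_derivs is f x))))}"

definition schwartz_seminorm :: "nat \<Rightarrow> 'm::finite list \<Rightarrow> (real ^ 'm \<Rightarrow> complex) \<Rightarrow> real" where
  "schwartz_seminorm k is f = (SUP x. norm x ^ k * cmod (partial_derivs is f x))"

text \<open>Tempered distributions are linear functionals on \<^const>\<open>schwartz\<close>, continuous for the topology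
  given by the seminorms. They are represented by functions on all of
  \<^typ>\<open>real ^ 'm \<Rightarrow> complex\<close>; the values outside \<^const>\<open>schwartz\<close> carry no meaning.\<close>

definition tempered :: "((real ^ 'm::finite \<Rightarrow> complex) \<Rightarrow> complex) set" where
  "tempered = {u.
     (\<forall>\<phi>\<in>schwartz. \<forall>\<psi>\<in>schwartz. u (\<lambda>x. \<phi> x + \<psi> x) = u \<phi> + u \<psi>) \<and>
     (\<forall>c. \<forall>\<phi>\<in>schwartz. u (\<lambda>x. c * \<phi> x) = c * u \<phi>) \<and>
     (\<exists>C I. finite I \<and>
        (\<forall>\<phi>\<in>schwartz. cmod (u \<phi>) \<le> C * (\<Sum>(k, is)\<in>I. schwartz_seminorm k is \<phi>)))}"

text \<open>The bracket \<open>\<langle>u, \<phi>\<rangle>\<close> is conjugate-linear in \<open>\<phi>\<close>, so that it is \<open>\<integral> f \<phi>\<^sup>*\<close> (with \<open>\<^sup>*\<close> the complex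
  conjugate) when \<open>u\<close> is the distribution of a function \<open>f\<close>. Conversely, \<open>distr_of_bracket B\<close> is the
  distribution \<open>u\<close> with \<open>\<langle>u, \<phi>\<rangle> = B \<phi>\<close>.\<close>

definition bracket ::
  "((real ^ 'm::finite \<Rightarrow> complex) \<Rightarrow> complex) \<Rightarrow> (real ^ 'm \<Rightarrow> complex) \<Rightarrow> complex" where
  "bracket u \<phi> = u (\<lambda>x. cnj (\<phi> x))"

definition distr_of_bracket ::
  "((real ^ 'm::finite \<Rightarrow> complex) \<Rightarrow> complex) \<Rightarrow> (real ^ 'm \<Rightarrow> complex) \<Rightarrow> complex" where
  "distr_of_bracket B = (\<lambda>\<psi>. B (\<lambda>x. cnj (\<psi> x)))"

text \<open>Equality of operators from Schwartz functions to tempered distributions.\<close>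

definition operators_agree ::
  "((real ^ 'm::finite \<Rightarrow> complex) \<Rightarrow> (real ^ 'm \<Rightarrow> complex) \<Rightarrow> complex) \<Rightarrow>
   ((real ^ 'm \<Rightarrow> complex) \<Rightarrow> (real ^ 'm \<Rightarrow> complex) \<Rightarrow> complex) \<Rightarrow> bool" where
  "operators_agree P Q \<longleftrightarrow> (\<forall>f\<in>schwartz. \<forall>g\<in>schwartz. bracket (P f) g = bracket (Q f) g)"

definition convolution ::
  "(real ^ 'm::finite \<Rightarrow> complex) \<Rightarrow> (real ^ 'm \<Rightarrow> complex) \<Rightarrow> real ^ 'm \<Rightarrow> complex" where
  "convolution h \<phi> z = (LINT w|lborel. h (z - w) * \<phi> w)"

text \<open>The convolution \<open>a * h\<close> of a tempered distribution and a Schwartz function is given by duality: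
  \<open>\<langle>a * h, \<phi>\<rangle> = \<langle>a, h' * \<phi>\<rangle>\<close>, where \<open>h'\<close> is the conjugate of \<open>h\<close> reflected at the origin.\<close>

definition distr_convolution ::
  "((real ^ 'm::finite \<Rightarrow> complex) \<Rightarrow> complex) \<Rightarrow> (real ^ 'm \<Rightarrow> complex) \<Rightarrow>
   (real ^ 'm \<Rightarrow> complex) \<Rightarrow> complex" where
  "distr_convolution a h =
     distr_of_bracket (\<lambda>\<phi>. bracket a (convolution (\<lambda>z. cnj (h (- z))) \<phi>))"

section \<open>Square-integrable functions\<close>

text \<open>Elements of \<open>L\<^sup>2\<close> are represented by Borel functions, equality being \<open>ae_eq\<close>.\<close>

definition L2 :: "(real ^ 'm::finite \<Rightarrow> complex) set" where
  "L2 = {f \<in> borel_measurable lborel. integrable lborel (\<lambda>x. (cmod (f x))\<^sup>2)}"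

definition ae_eq :: "(real ^ 'm::finite \<Rightarrow> complex) \<Rightarrow> (real ^ 'm \<Rightarrow> complex) \<Rightarrow> bool" where
  "ae_eq f g \<longleftrightarrow> (AE x in lborel. f x = g x)"

definition L2_inner :: "(real ^ 'm::finite \<Rightarrow> complex) \<Rightarrow> (real ^ 'm \<Rightarrow> complex) \<Rightarrow> complex" where
  "L2_inner f g = (LINT x|lborel. f x * cnj (g x))"

definition unitary_L2 ::
  "((real ^ 'm::finite \<Rightarrow> complex) \<Rightarrow> (real ^ 'm \<Rightarrow> complex)) \<Rightarrow> bool" where
  "unitary_L2 U \<longleftrightarrow>
     (\<forall>f\<in>L2. U f \<in> L2) \<and>
     (\<forall>f\<in>L2. \<forall>g\<in>L2. ae_eq f g \<longrightarrow> ae_eq (U f) (U g)) \<and>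
     (\<forall>f\<in>L2. \<forall>g\<in>L2. ae_eq (U (\<lambda>x. f x + g x)) (\<lambda>x. U f x + U g x)) \<and>
     (\<forall>c. \<forall>f\<in>L2. ae_eq (U (\<lambda>x. c * f x)) (\<lambda>x. c * U f x)) \<and>
     (\<forall>f\<in>L2. \<forall>g\<in>L2. L2_inner (U f) (U g) = L2_inner f g) \<and>
     (\<forall>g\<in>L2. \<exists>f\<in>L2. ae_eq (U f) g)"

text \<open>The Schwartz function in the class of \<open>F\<close>; it is unique if it exists, because continuous
  functions that agree almost everywhere are equal.\<close>

definition schwartz_rep :: "(real ^ 'm::finite \<Rightarrow> complex) \<Rightarrow> real ^ 'm \<Rightarrow> complex" where
  "schwartz_rep F = (THE h. h \<in> schwartz \<and> ae_eq h F)"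

section \<open>Time-frequency shifts, the short-time Fourier transform, localization operators\<close>

definition translation ::
  "real ^ 'm::finite \<Rightarrow> (real ^ 'm \<Rightarrow> complex) \<Rightarrow> real ^ 'm \<Rightarrow> complex" where
  "translation x f = (\<lambda>t. f (t - x))"

definition modulation ::
  "real ^ 'm::finite \<Rightarrow> (real ^ 'm \<Rightarrow> complex) \<Rightarrow> real ^ 'm \<Rightarrow> complex" where
  "modulation \<xi> f = (\<lambda>t. cis (2 * pi * (\<xi> \<bullet> t)) * f t)"

definition tf_shift ::
  "real ^ ('m::finite + 'm) \<Rightarrow> (real ^ 'm \<Rightarrow> complex) \<Rightarrow> real ^ 'm \<Rightarrow> complex" where
  "tf_shift z f = modulation (snd_part z) (translation (fst_part z) f)"

text \<open>\<open>stft g f\<close> is \<open>V\<^sub>g f\<close>, needed only for functions \<open>f\<close>.\<close>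

definition stft ::
  "(real ^ 'm::finite \<Rightarrow> complex) \<Rightarrow> (real ^ 'm \<Rightarrow> complex) \<Rightarrow> real ^ ('m + 'm) \<Rightarrow> complex" where
  "stft g f z = L2_inner f (tf_shift z g)"

definition localization_op ::
  "(real ^ 'm::finite \<Rightarrow> complex) \<Rightarrow> (real ^ 'm \<Rightarrow> complex) \<Rightarrow>
   ((real ^ ('m + 'm) \<Rightarrow> complex) \<Rightarrow> complex) \<Rightarrow>
   (real ^ 'm \<Rightarrow> complex) \<Rightarrow> (real ^ 'm \<Rightarrow> complex) \<Rightarrow> complex" where
  "localization_op \<phi>1 \<phi>2 a f =
     distr_of_bracket (\<lambda>g. bracket a (\<lambda>z. cnj (stft \<phi>1 f z) * stft \<phi>2 g z))"

section \<open>Metaplectic operators\<close>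

definition symplectic_J :: "real ^ ('m::finite + 'm) ^ ('m + 'm)" where
  "symplectic_J = (\<chi> i j. case (i, j) of
       (Inl k, Inr l) \<Rightarrow> if k = l then 1 else 0
     | (Inr k, Inl l) \<Rightarrow> if k = l then - 1 else 0
     | _ \<Rightarrow> 0)"

definition Sp :: "(real ^ ('m::finite + 'm) ^ ('m + 'm)) set" where
  "Sp = {A. transpose A ** symplectic_J ** A = symplectic_J}"

definition rho ::
  "real ^ ('m::finite + 'm) \<Rightarrow> real \<Rightarrow> (real ^ 'm \<Rightarrow> complex) \<Rightarrow> real ^ 'm \<Rightarrow> complex" where
  "rho w \<tau> f = (\<lambda>t. cis (2 * pi * \<tau>) * cis (- pi * (snd_part w \<bullet> fst_part w)) * tf_shift w f t)"

text \<open>\<open>U\<close> is a metaplectic operator with projection \<open>A\<close>. The relation \<open>U \<rho>(w; \<tau>) U\<^sup>-\<^sup>1 = \<rho>(A w; \<tau>)\<close> is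
  written as \<open>U \<rho>(w; \<tau>) = \<rho>(A w; \<tau>) U\<close>.\<close>

definition metaplectic ::
  "real ^ ('m::finite + 'm) ^ ('m + 'm) \<Rightarrow>
   ((real ^ 'm \<Rightarrow> complex) \<Rightarrow> (real ^ 'm \<Rightarrow> complex)) \<Rightarrow> bool" where
  "metaplectic A U \<longleftrightarrow> unitary_L2 U \<and>
     (\<forall>w \<tau>. \<forall>f\<in>L2. ae_eq (U (rho w \<tau> f)) (rho (A *v w) \<tau> (U f)))"

section \<open>Metaplectic Wigner distributions and quantization\<close>

definition tensor_cnj ::
  "(real ^ 'n::finite \<Rightarrow> complex) \<Rightarrow> (real ^ 'n \<Rightarrow> complex) \<Rightarrow> real ^ ('n + 'n) \<Rightarrow> complex" where
  "tensor_cnj f g = (\<lambda>z. f (fst_part z) * cnj (g (snd_part z)))"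

text \<open>The argument \<open>U\<close> is the chosen metaplectic operator with projection \<open>A\<close>. The result is
  meaningful up to \<^const>\<open>ae_eq\<close>; for Schwartz \<open>f\<close> and \<open>g\<close>, the Schwartz representative is
  \<open>metaplectic_wigner_schwartz\<close>.\<close>

definition metaplectic_wigner ::
  "((real ^ ('n::finite + 'n) \<Rightarrow> complex) \<Rightarrow> (real ^ ('n + 'n) \<Rightarrow> complex)) \<Rightarrow>
   (real ^ 'n \<Rightarrow> complex) \<Rightarrow> (real ^ 'n \<Rightarrow> complex) \<Rightarrow> real ^ ('n + 'n) \<Rightarrow> complex" where
  "metaplectic_wigner U f g = U (tensor_cnj f g)"

definition metaplectic_wigner_schwartz ::
  "((real ^ ('n::finite + 'n) \<Rightarrow> complex) \<Rightarrow> (real ^ ('n + 'n) \<Rightarrow> complex)) \<Rightarrow>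
   (real ^ 'n \<Rightarrow> complex) \<Rightarrow> (real ^ 'n \<Rightarrow> complex) \<Rightarrow> real ^ ('n + 'n) \<Rightarrow> complex" where
  "metaplectic_wigner_schwartz U f g = schwartz_rep (metaplectic_wigner U f g)"

definition covariant ::
  "((real ^ ('n::finite + 'n) \<Rightarrow> complex) \<Rightarrow> (real ^ ('n + 'n) \<Rightarrow> complex)) \<Rightarrow> bool" where
  "covariant U \<longleftrightarrow> (\<forall>f\<in>L2. \<forall>g\<in>L2. \<forall>z.
     ae_eq (metaplectic_wigner U (tf_shift z f) (tf_shift z g))
           (translation z (metaplectic_wigner U f g)))"

definition metaplectic_Op ::
  "((real ^ ('n::finite + 'n) \<Rightarrow> complex) \<Rightarrow> (real ^ ('n + 'n) \<Rightarrow> complex)) \<Rightarrow>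
   ((real ^ ('n + 'n) \<Rightarrow> complex) \<Rightarrow> complex) \<Rightarrow>
   (real ^ 'n \<Rightarrow> complex) \<Rightarrow> (real ^ 'n \<Rightarrow> complex) \<Rightarrow> complex" where
  "metaplectic_Op U \<sigma> f =
     distr_of_bracket (\<lambda>g. bracket \<sigma> (metaplectic_wigner_schwartz U g f))"

end

theory Submission
  imports Defs "HOL-Probability.Sinc_Integral"
begin

text \<open>Both operators in the theorem are given by pairing \<open>a\<close> with a function on phase space, and the
  theorem compares these two functions of \<open>z\<close>. For the localization operator it is
  \<open>\<langle>g, \<pi>(z) \<phi>2\<rangle> \<langle>f, \<pi>(z) \<phi>1\<rangle>\<^sup>*\<close>, the inner product of \<open>g \<otimes> f\<^sup>*\<close> with \<open>\<pi>(z) \<phi>2 \<otimes> (\<pi>(z) \<phi>1)\<^sup>*\<close>, which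
  unitarity of the metaplectic operator turns into \<open>\<langle>W(g, f), W(\<pi>(z) \<phi>2, \<pi>(z) \<phi>1)\<rangle>\<close>
  (\<open>stft_product_eq_inner_wigner\<close>). For the quantization of the convolution it is
  \<open>\<langle>W(g, f), T\<^sub>z W(\<phi>2, \<phi>1)\<rangle>\<close>. Covariance makes them equal. Conversely, the point masses \<open>a\<close> show that the
  two functions agree at every point; for \<open>f = g = \<pi>(z) G\<close> and \<open>\<phi>1 = \<phi>2 = G\<close> with the Gaussian \<open>G\<close>, this is
  the case of equality in the Cauchy-Schwarz inequality, and so \<open>W(\<pi>(z) G, \<pi>(z) G) = T\<^sub>z W(G, G)\<close>.
  Since \<open>\<pi>(z) f \<otimes> (\<pi>(z) g)\<^sup>*\<close> is a Heisenberg shift of \<open>f \<otimes> g\<^sup>*\<close>, the intertwining relation yields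
  \<open>W(\<pi>(z) f, \<pi>(z) g) = \<rho>(w) W(f, g)\<close> with \<open>w\<close> depending only on \<open>z\<close> and the symplectic matrix. The
  single nonzero function \<open>W(G, G)\<close> forces \<open>\<rho>(w) = T\<^sub>z\<close> (\<open>translation_eq_rho_imp\<close>), and covariance follows
  for all \<open>f\<close> and \<open>g\<close>.

  Most of the work goes into the fact that a metaplectic operator \<open>U\<close> maps Schwartz functions to
  Schwartz functions (\<open>metaplectic_preserves_schwartz\<close>), without which the pointwise
  representatives of \<open>W(f, g)\<close> do not exist. The only information on \<open>U\<close> is
  unitarity and the intertwining relation, and it is exploited through the orthogonality relations
  \<open>\<integral> \<langle>F, \<pi>(w) F\<rangle> \<langle>\<pi>(w) \<psi>, g\<rangle> dw = C \<langle>\<psi>, F\<rangle> \<langle>F, g\<rangle>\<close> (\<open>stft_orthogonality\<close>) for a Schwartz function \<open>F\<close>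
  and arbitrary square-integrable \<open>\<psi>\<close> and \<open>g\<close>. Choosing \<open>\<psi>\<close> such that \<open>\<phi> = U \<psi>\<close> is a Schwartz function,
  and applying \<open>U\<close> inside the inner products, expresses \<open>C \<langle>\<phi>, U F\<rangle> U F\<close> as the superposition
  \<open>\<integral> b(w) \<pi>(A w) \<phi> dw\<close>, where \<open>|b(w)| = |\<langle>F, \<pi>(w) F\<rangle>|\<close> decreases rapidly. Such superpositions are Schwartz
  functions (\<open>superposition_schwartz\<close>): differentiation only produces polynomial factors in \<open>w\<close> and
  derivatives of \<open>\<phi>\<close>. Unless \<open>U F\<close> vanishes, some \<open>\<phi>\<close> has \<open>\<langle>\<phi>, U F\<rangle> \<noteq> 0\<close>, because the Schwartz functions are dense
  in \<open>L\<^sup>2\<close> (\<open>schwartz_orthogonal_imp_zero\<close>).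

  The orthogonality relations rest on Fourier inversion for Schwartz functions, which is proved up to
  the constant factor \<open>C\<close>; positivity of \<open>\<integral> |\<langle>G, \<pi>(w) G\<rangle>|\<^sup>2 dw\<close> shows afterwards that \<open>C \<noteq> 0\<close>.\<close>

section \<open>Rapid decrease\<close>

definition rapidly_decreasing :: "('a::real_normed_vector \<Rightarrow> complex) \<Rightarrow> bool" where
  "rapidly_decreasing f \<longleftrightarrow> (\<forall>k. \<exists>B. \<forall>x. norm x ^ k * cmod (f x) \<le> B)"

lemma rapidly_decreasing_bound:
  assumes "rapidly_decreasing f"
  obtains B where "0 \<le> B" "\<And>x. norm x ^ k * cmod (f x) \<le> B"
proof -
  obtain B where B: "\<And>x. norm x ^ k * cmod (f x) \<le> B"
    using assms unfolding rapidly_decreasing_def by blast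
  have "0 \<le> norm (0 :: 'a) ^ k * cmod (f 0)" by simp
  also have "\<dots> \<le> B" by (rule B)
  finally have "0 \<le> B" .
  with B show thesis using that by blast
qed

lemma rapidly_decreasing_bounded:
  assumes "rapidly_decreasing f"
  obtains B where "0 \<le> B" "\<And>x. cmod (f x) \<le> B"
  using rapidly_decreasing_bound[OF assms, of 0] by auto

lemma power_add_le:
  fixes a b :: real assumes "0 \<le> a" "0 \<le> b"
  shows "(a + b) ^ k \<le> 2 ^ k * (a ^ k + b ^ k)"
proof -
  have "(a + b) ^ k \<le> (2 * max a b) ^ k" using assms by (intro power_mono) auto
  also have "\<dots> = 2 ^ k * max a b ^ k" by (simp add: power_mult_distrib)
  also have "max a b ^ k \<le> a ^ k + b ^ k" using assms by (auto simp: max_def)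
  finally show ?thesis by (simp add: mult_left_mono)
qed

lemma rapidly_decreasing_dominated:
  assumes f: "rapidly_decreasing f"
    and g: "\<And>x. cmod (g x) \<le> C * (1 + norm x) ^ m * cmod (f x)"
  shows "rapidly_decreasing g"
  unfolding rapidly_decreasing_def
proof
  fix k
  obtain B0 B1 where B: "\<And>x. norm x ^ k * cmod (f x) \<le> B0" "\<And>x. norm x ^ (k + m) * cmod (f x) \<le> B1"
    using f unfolding rapidly_decreasing_def by metis
  have "norm x ^ k * cmod (g x) \<le> \<bar>C\<bar> * 2 ^ m * (B0 + B1)" for x
  proof -
    have "cmod (g x) \<le> C * (1 + norm x) ^ m * cmod (f x)" by (rule g)
    also have "\<dots> \<le> \<bar>C\<bar> * (2 ^ m * (1 + norm x ^ m)) * cmod (f x)"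
      using power_add_le[of 1 "norm x" m] by (intro mult_right_mono mult_mono) auto
    finally have "norm x ^ k * cmod (g x) \<le> norm x ^ k * (\<bar>C\<bar> * (2 ^ m * (1 + norm x ^ m)) * cmod (f x))"
      by (intro mult_left_mono) auto
    also have "\<dots> = \<bar>C\<bar> * 2 ^ m * (norm x ^ k * cmod (f x) + norm x ^ (k + m) * cmod (f x))"
      by (simp add: algebra_simps power_add)
    also have "\<dots> \<le> \<bar>C\<bar> * 2 ^ m * (B0 + B1)"
      by (intro mult_left_mono add_mono B) auto
    finally show ?thesis .
  qed
  then show "\<exists>B. \<forall>x. norm x ^ k * cmod (g x) \<le> B" by blast
qed

lemma rapidly_decreasing_add:
  assumes "rapidly_decreasing f" "rapidly_decreasing g"
  shows "rapidly_decreasing (\<lambda>x. f x + g x)"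
  unfolding rapidly_decreasing_def
proof
  fix k
  obtain B0 B1 where B: "\<And>x. norm x ^ k * cmod (f x) \<le> B0" "\<And>x. norm x ^ k * cmod (g x) \<le> B1"
    using assms unfolding rapidly_decreasing_def by metis
  have "norm x ^ k * cmod (f x + g x) \<le> B0 + B1" for x
  proof -
    have "norm x ^ k * cmod (f x + g x) \<le> norm x ^ k * cmod (f x) + norm x ^ k * cmod (g x)"
      by (metis distrib_left mult_left_mono norm_ge_zero norm_triangle_ineq zero_le_power)
    with B[of x] show ?thesis by linarith
  qed
  then show "\<exists>B. \<forall>x. norm x ^ k * cmod (f x + g x) \<le> B" by blast
qed

section \<open>Closure properties of the Schwartz space\<close>

lemma partial_deriv_eqI:
  "(f has_derivative D) (at x) \<Longrightarrow> partial_deriv i f x = D (axis i 1)"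
  unfolding partial_deriv_def using frechet_derivative_at by metis

lemma has_derivative_partial_derivs:
  fixes f :: "real ^ 'm::finite \<Rightarrow> complex"
  assumes "f differentiable at x"
  shows "(f has_derivative (\<lambda>v. \<Sum>i\<in>UNIV. of_real (v $ i) * partial_deriv i f x)) (at x)"
proof -
  let ?D = "frechet_derivative f (at x)"
  have D: "(f has_derivative ?D) (at x)" using assms by (simp add: frechet_derivative_works)
  have "?D v = (\<Sum>i\<in>UNIV. of_real (v $ i) * partial_deriv i f x)" for v
  proof -
    have lin: "linear ?D" using D has_derivative_linear by blast
    have "?D v = ?D (\<Sum>i\<in>UNIV. (v $ i) *\<^sub>R axis i 1)"
      by (metis basis_expansion scalar_mult_eq_scaleR)
    also have "\<dots> = (\<Sum>i\<in>UNIV. (v $ i) *\<^sub>R ?D (axis i 1))"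
      using lin by (simp add: linear_sum linear_cmul)
    finally show ?thesis by (simp add: partial_deriv_def scaleR_conv_of_real)
  qed
  then have "?D = (\<lambda>v. \<Sum>i\<in>UNIV. of_real (v $ i) * partial_deriv i f x)" by blast
  with D show ?thesis by metis
qed

text \<open>Membership in \<^const>\<open>schwartz\<close> is a condition on all iterated derivatives at once. Cutting it off
  at order \<open>n\<close> gives a predicate for which closure properties follow by induction on \<open>n\<close>, because
  Leibniz-type rules express a first derivative by functions that the induction hypothesis covers.\<close>

primrec schwartz_order :: "nat \<Rightarrow> (real ^ 'm::finite \<Rightarrow> complex) \<Rightarrow> bool" where
  "schwartz_order 0 f \<longleftrightarrow> (\<forall>x. f differentiable at x) \<and> rapidly_decreasing f"
| "schwartz_order (Suc n) f \<longleftrightarrow> (\<forall>x. f differentiable at x) \<and> rapidly_decreasing f \<and>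
     (\<forall>i. schwartz_order n (partial_deriv i f))"

lemma schwartz_order_differentiable: "schwartz_order n f \<Longrightarrow> f differentiable at x"
  by (cases n) auto

lemma schwartz_order_rapid: "schwartz_order n f \<Longrightarrow> rapidly_decreasing f"
  by (cases n) auto

lemma schwartz_order_SucD: "schwartz_order (Suc n) f \<Longrightarrow> schwartz_order n f"
  by (induction n arbitrary: f) auto

lemma partial_derivs_snoc: "partial_derivs (is @ [i]) f = partial_derivs is (partial_deriv i f)"
  by (induction "is") auto

lemma schwartz_partial_deriv:
  assumes "f \<in> schwartz" shows "partial_deriv i f \<in> schwartz"
  using assms unfolding schwartz_def by (simp flip: partial_derivs_snoc)

lemma schwartz_differentiable: "f \<in> schwartz \<Longrightarrow> f differentiable at x"
  unfolding schwartz_def by (auto dest: spec[of _ "[]"])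

lemma schwartz_rapidly_decreasing: 
  assumes "f \<in> schwartz" shows "rapidly_decreasing f"
proof -
  have "bdd_above (range (\<lambda>x. norm x ^ k * cmod (f x)))" for k
    using assms unfolding schwartz_def by (auto dest: spec[of _ "[]"])
  then show ?thesis unfolding rapidly_decreasing_def bdd_above_def by blast
qed

lemma schwartz_iff: "f \<in> schwartz \<longleftrightarrow> (\<forall>n. schwartz_order n f)"
proof
  assume "f \<in> schwartz"
  then have "schwartz_order n f" for n
    by (induction n arbitrary: f)
       (auto simp: schwartz_partial_deriv schwartz_differentiable schwartz_rapidly_decreasing)
  then show "\<forall>n. schwartz_order n f" by blast
next
  assume f: "\<forall>n. schwartz_order n f"
  have *: "\<forall>n. schwartz_order n (partial_derivs is f)" for "is"
    using f by (induction "is") (simp, metis partial_derivs.simps(2) schwartz_order.simps(2))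
  show "f \<in> schwartz"
    unfolding schwartz_def
  proof (intro CollectI allI conjI)
    fix "is" x k
    show "partial_derivs is f differentiable at x" using * schwartz_order_differentiable by blast
    show "bdd_above (range (\<lambda>x. norm x ^ k * cmod (partial_derivs is f x)))"
      using *[of "is"] schwartz_order_rapid[of 0] unfolding rapidly_decreasing_def bdd_above_def by blast
  qed
qed

lemma schwartz_order_add:
  "schwartz_order n f \<Longrightarrow> schwartz_order n g \<Longrightarrow> schwartz_order n (\<lambda>x. f x + g x)"
proof (induction n arbitrary: f g rule: nat.induct[case_names zero suc])
  case zero
  then show ?case by (auto intro: rapidly_decreasing_add)
next
  case (suc n)
  have d: "f differentiable at x" "g differentiable at x" for x using suc.prems by auto
  have "partial_deriv i (\<lambda>x. f x + g x) = (\<lambda>x. partial_deriv i f x + partial_deriv i g x)" for i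
    using partial_deriv_eqI[OF has_derivative_add[OF d(1)[unfolded frechet_derivative_works] d(2)[unfolded frechet_derivative_works]]]
    by (auto simp: partial_deriv_def)
  with suc show ?case by (auto intro: rapidly_decreasing_add)
qed


lemma has_derivative_cis_inner:
  "((\<lambda>t. cis (2 * pi * (\<xi> \<bullet> t))) has_derivative
     (\<lambda>v. cis (2 * pi * (\<xi> \<bullet> t)) * (2 * pi * \<i> * (\<xi> \<bullet> v)))) (at t)"
proof -
  have "((\<lambda>t. 2 * pi * (\<xi> \<bullet> t)) has_derivative (\<lambda>v. 2 * pi * (\<xi> \<bullet> v))) (at t)"
    by (auto intro!: derivative_eq_intros)
  from has_derivative_cis[OF this] show ?thesis
    by (simp add: scaleR_conv_of_real mult_ac)
qed

lemma schwartz_order_scale: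
  "schwartz_order n f \<Longrightarrow> schwartz_order n (\<lambda>x. c * f x)"
proof (induction n arbitrary: f)
  case 0
  then show ?case 
    by (auto intro!: rapidly_decreasing_dominated[of f _ "cmod c" 0] simp: norm_mult)
next
  case (Suc n)
  have d: "f differentiable at x" for x using Suc.prems by auto
  have "partial_deriv i (\<lambda>x. c * f x) = (\<lambda>x. c * partial_deriv i f x)" for i
    using partial_deriv_eqI[OF has_derivative_mult_right[OF d[unfolded frechet_derivative_works]]]
    by (auto simp: partial_deriv_def)
  with Suc show ?case
    by (auto intro!: rapidly_decreasing_dominated[of f _ "cmod c" 0] simp: norm_mult)
qed

lemma schwartz_order_cnj:
  "schwartz_order n f \<Longrightarrow> schwartz_order n (\<lambda>x. cnj (f x))"
proof (induction n arbitrary: f)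
  case 0
  then show ?case 
    by (auto simp: rapidly_decreasing_def intro: differentiable_compose[of cnj] bounded_linear_imp_differentiable bounded_linear_cnj)
next
  case (Suc n)
  have d: "f differentiable at x" for x using Suc.prems by auto
  have "partial_deriv i (\<lambda>x. cnj (f x)) = (\<lambda>x. cnj (partial_deriv i f x))" for i
    using partial_deriv_eqI[OF bounded_linear.has_derivative[OF bounded_linear_cnj d[unfolded frechet_derivative_works]]]
    by (auto simp: partial_deriv_def)
  with Suc show ?case
    by (auto simp: rapidly_decreasing_def intro: differentiable_compose[of cnj] bounded_linear_imp_differentiable bounded_linear_cnj)
qed

lemma rapidly_decreasing_mult:
  assumes "rapidly_decreasing f" "rapidly_decreasing g"
  shows "rapidly_decreasing (\<lambda>x. f x * g x)"
proof -
  obtain B where "\<And>x. cmod (g x) \<le> B" using rapidly_decreasing_bounded[OF assms(2)] by blast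
  then have "cmod (f x * g x) \<le> B * (1 + norm x) ^ 0 * cmod (f x)" for x
    using mult_right_mono[of "cmod (g x)" B "cmod (f x)"] by (simp add: norm_mult mult.commute)
  then show ?thesis by (rule rapidly_decreasing_dominated[OF assms(1)])
qed

lemma schwartz_order_mult:
  "schwartz_order n f \<Longrightarrow> schwartz_order n g \<Longrightarrow> schwartz_order n (\<lambda>x. f x * g x)"
proof (induction n arbitrary: f g)
  case 0
  then show ?case by (auto intro: rapidly_decreasing_mult)
next
  case (Suc n)
  have d: "f differentiable at x" "g differentiable at x" for x using Suc.prems by auto
  have "partial_deriv i (\<lambda>x. f x * g x) = (\<lambda>x. f x * partial_deriv i g x + partial_deriv i f x * g x)" for i
    using partial_deriv_eqI[OF has_derivative_mult[OF d[unfolded frechet_derivative_works]]]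
    by (auto simp: partial_deriv_def)
  moreover have "schwartz_order n f" "schwartz_order n g"
    using Suc.prems schwartz_order_SucD by blast+
  ultimately show ?case using Suc
    by (auto intro!: rapidly_decreasing_mult schwartz_order_add)
qed

lemma rapidly_decreasing_translate:
  assumes "rapidly_decreasing f"
  shows "rapidly_decreasing (\<lambda>x. f (x - a))"
  unfolding rapidly_decreasing_def
proof
  fix k
  obtain B0 B1 where B: "\<And>x. norm x ^ k * cmod (f x) \<le> B0" "\<And>x. cmod (f x) \<le> B1"
    using assms rapidly_decreasing_bounded unfolding rapidly_decreasing_def by metis
  have "norm x ^ k * cmod (f (x - a)) \<le> 2 ^ k * (B0 + norm a ^ k * B1)" for x
  proof -
    have "norm x ^ k \<le> (norm (x - a) + norm a) ^ k"
      by (intro power_mono) (auto simp: norm_triangle_sub add.commute)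
    also have "\<dots> \<le> 2 ^ k * (norm (x - a) ^ k + norm a ^ k)" by (intro power_add_le) auto
    finally have "norm x ^ k * cmod (f (x - a)) \<le> 2 ^ k * (norm (x - a) ^ k + norm a ^ k) * cmod (f (x - a))"
      by (intro mult_right_mono) auto
    also have "\<dots> = 2 ^ k * (norm (x - a) ^ k * cmod (f (x - a)) + norm a ^ k * cmod (f (x - a)))"
      by (simp add: algebra_simps)
    also have "\<dots> \<le> 2 ^ k * (B0 + norm a ^ k * B1)"
      by (intro mult_left_mono add_mono B) auto
    finally show ?thesis .
  qed
  then show "\<exists>B. \<forall>x. norm x ^ k * cmod (f (x - a)) \<le> B" by blast
qed

lemma has_derivative_translate:
  assumes "(f has_derivative D) (at (x - a))"
  shows "((\<lambda>x. f (x - a)) has_derivative D) (at x)"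
proof -
  have "((\<lambda>x. x - a) has_derivative (\<lambda>v. v)) (at x)" by (auto intro!: derivative_eq_intros)
  from has_derivative_compose[OF this assms] show ?thesis by simp
qed

lemma schwartz_order_translate:
  "schwartz_order n f \<Longrightarrow> schwartz_order n (\<lambda>x. f (x - a))"
proof (induction n arbitrary: f)
  case 0
  then show ?case 
    by (auto intro: rapidly_decreasing_translate simp: differentiable_def) (metis has_derivative_translate)
next
  case (Suc n)
  have d: "f differentiable at x" for x using Suc.prems by auto
  note D = has_derivative_translate[OF d[unfolded frechet_derivative_works]]
  have "partial_deriv i (\<lambda>x. f (x - a)) = (\<lambda>x. partial_deriv i f (x - a))" for i
    using partial_deriv_eqI[OF D]
    by (auto simp: partial_deriv_def)
  with Suc D show ?case
    by (auto intro: rapidly_decreasing_translate simp: differentiable_def)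
qed

lemma schwartz_order_coordinate:
  "schwartz_order n f \<Longrightarrow> schwartz_order n (\<lambda>x. of_real (x $ j) * f x)"
proof (induction n arbitrary: f)
  have rd: "rapidly_decreasing (\<lambda>x. of_real (x $ j) * f x)" if "rapidly_decreasing f" for f :: "real ^ 'a \<Rightarrow> complex"
    using that
  proof (rule rapidly_decreasing_dominated)
    show "cmod (of_real (x $ j) * f x) \<le> 1 * (1 + norm x) ^ 1 * cmod (f x)" for x
      using component_le_norm_cart[of x j] by (auto simp: norm_mult intro!: mult_right_mono)
  qed
  have Dj: "((\<lambda>x. of_real (x $ j)) has_derivative (\<lambda>v. of_real (v $ j))) (at x)" for x :: "real ^ 'a"
    by (auto intro!: bounded_linear_imp_has_derivative bounded_linear_compose[OF bounded_linear_of_real])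
  {
    case 0
    then have d: "f differentiable at x" for x by auto
    note D = has_derivative_mult[OF Dj d[unfolded frechet_derivative_works]]
    with 0 rd show ?case by (auto simp: differentiable_def)
  next
    case (Suc n)
    have d: "f differentiable at x" for x using Suc.prems by auto
    note D = has_derivative_mult[OF Dj d[unfolded frechet_derivative_works]]
    have "partial_deriv i (\<lambda>x. of_real (x $ j) * f x) =
        (\<lambda>x. of_real (x $ j) * partial_deriv i f x + (if i = j then 1 else 0) * f x)" for i
      using partial_deriv_eqI[OF D] by (auto simp: partial_deriv_def axis_def)
    moreover have "schwartz_order n f" using Suc.prems schwartz_order_SucD by blast
    ultimately show ?case using Suc D rd
      by (auto simp: differentiable_def intro!: schwartz_order_add schwartz_order_scale)
  }
qed

lemma schwartz_order_modulate:
  "schwartz_order n f \<Longrightarrow> schwartz_order n (\<lambda>x. cis (2 * pi * (\<xi> \<bullet> x)) * f x)"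
proof (induction n arbitrary: f)
  have rd: "rapidly_decreasing (\<lambda>x. cis (2 * pi * (\<xi> \<bullet> x)) * f x)" if "rapidly_decreasing f" for f :: "real ^ 'a \<Rightarrow> complex"
    using that by (simp add: rapidly_decreasing_def norm_mult)
  {
    case 0
    then have d: "f differentiable at x" for x by auto
    note D = has_derivative_mult[OF has_derivative_cis_inner[of \<xi>] d[unfolded frechet_derivative_works]]
    with 0 rd show ?case by (auto simp: differentiable_def)
  next
    case (Suc n)
    have d: "f differentiable at x" for x using Suc.prems by auto
    note D = has_derivative_mult[OF has_derivative_cis_inner[of \<xi>] d[unfolded frechet_derivative_works]]
    have "partial_deriv i (\<lambda>x. cis (2 * pi * (\<xi> \<bullet> x)) * f x) =
        (\<lambda>x. cis (2 * pi * (\<xi> \<bullet> x)) * partial_deriv i f x +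
           (2 * pi * \<i> * (\<xi> $ i)) * (cis (2 * pi * (\<xi> \<bullet> x)) * f x))" for i
      using partial_deriv_eqI[OF D] by (auto simp: partial_deriv_def inner_axis algebra_simps)
    moreover have "schwartz_order n f" using Suc.prems schwartz_order_SucD by blast
    ultimately show ?case using Suc D rd
      by (auto simp: differentiable_def intro!: schwartz_order_add schwartz_order_scale)
  }
qed

lemma schwartz_scale: "f \<in> schwartz \<Longrightarrow> (\<lambda>x. c * f x) \<in> schwartz"
  by (simp add: schwartz_iff schwartz_order_scale)

lemma schwartz_cnj: "f \<in> schwartz \<Longrightarrow> (\<lambda>x. cnj (f x)) \<in> schwartz"
  by (simp add: schwartz_iff schwartz_order_cnj)

lemma schwartz_mult: "f \<in> schwartz \<Longrightarrow> g \<in> schwartz \<Longrightarrow> (\<lambda>x. f x * g x) \<in> schwartz"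
  by (simp add: schwartz_iff schwartz_order_mult)

lemma schwartz_coordinate: "f \<in> schwartz \<Longrightarrow> (\<lambda>x. of_real (x $ j) * f x) \<in> schwartz"
  by (simp add: schwartz_iff schwartz_order_coordinate)

lemma schwartz_translate: "f \<in> schwartz \<Longrightarrow> (\<lambda>x. f (x - a)) \<in> schwartz"
  by (simp add: schwartz_iff schwartz_order_translate)

lemma schwartz_modulate: "f \<in> schwartz \<Longrightarrow> (\<lambda>x. cis (2 * pi * (\<xi> \<bullet> x)) * f x) \<in> schwartz"
  by (simp add: schwartz_iff schwartz_order_modulate)

lemma schwartz_tf_shift: "f \<in> schwartz \<Longrightarrow> tf_shift z f \<in> schwartz"
  unfolding tf_shift_def modulation_def translation_def
  by (intro schwartz_modulate schwartz_translate)

subsection \<open>Tensor products\<close>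

lemma bounded_linear_fst_part: "bounded_linear fst_part"
  by (intro linear_conv_bounded_linear[THEN iffD1] linearI) (auto simp: fst_part_def vec_eq_iff)

lemma bounded_linear_snd_part: "bounded_linear snd_part"
  by (intro linear_conv_bounded_linear[THEN iffD1] linearI) (auto simp: snd_part_def vec_eq_iff)

lemma sum_UNIV_Plus:
  fixes f :: "'a::finite + 'b::finite \<Rightarrow> 'c::comm_monoid_add"
  shows "(\<Sum>i\<in>UNIV. f i) = (\<Sum>i\<in>UNIV. f (Inl i)) + (\<Sum>i\<in>UNIV. f (Inr i))"
proof -
  have "sum f UNIV = sum f (Inl ` UNIV) + sum f (Inr ` UNIV)"
    unfolding UNIV_sum by (rule sum.union_disjoint) auto
  then show ?thesis by (simp add: sum.reindex o_def)
qed

lemma norm_parts: "(norm z)\<^sup>2 = (norm (fst_part z))\<^sup>2 + (norm (snd_part z))\<^sup>2"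
  unfolding power2_norm_eq_inner by (simp add: inner_vec_def sum_UNIV_Plus fst_part_def snd_part_def)

lemma norm_fst_part_le: "norm (fst_part z) \<le> norm z"
  using norm_parts[of z] by - (rule power2_le_imp_le, auto)

lemma norm_snd_part_le: "norm (snd_part z) \<le> norm z"
  using norm_parts[of z] by - (rule power2_le_imp_le, auto)

lemma norm_le_parts: "norm z \<le> norm (fst_part z) + norm (snd_part z)"
  using norm_parts[of z] by - (rule power2_le_imp_le, auto simp: power2_sum)

lemma rapidly_decreasing_tensor_cnj:
  assumes "rapidly_decreasing f" "rapidly_decreasing g"
  shows "rapidly_decreasing (tensor_cnj f g)"
  unfolding rapidly_decreasing_def
proof
  fix k
  obtain Bf where Bf: "\<And>x. cmod (f x) \<le> Bf" "0 \<le> Bf" using rapidly_decreasing_bounded[OF assms(1)] by blast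
  obtain Bg where Bg: "\<And>x. cmod (g x) \<le> Bg" "0 \<le> Bg" using rapidly_decreasing_bounded[OF assms(2)] by blast
  obtain Cf where Cf: "\<And>x. norm x ^ k * cmod (f x) \<le> Cf" "0 \<le> Cf" using rapidly_decreasing_bound[OF assms(1)] by blast
  obtain Cg where Cg: "\<And>x. norm x ^ k * cmod (g x) \<le> Cg" "0 \<le> Cg" using rapidly_decreasing_bound[OF assms(2)] by blast
  have "norm z ^ k * cmod (tensor_cnj f g z) \<le> 2 ^ k * (Cf * Bg + Bf * Cg)" for z
  proof -
    let ?a = "fst_part z" and ?b = "snd_part z"
    have "norm z ^ k \<le> (norm ?a + norm ?b) ^ k" by (intro power_mono norm_le_parts) auto
    also have "\<dots> \<le> 2 ^ k * (norm ?a ^ k + norm ?b ^ k)" by (intro power_add_le) auto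
    finally have "norm z ^ k * cmod (tensor_cnj f g z)
        \<le> 2 ^ k * (norm ?a ^ k + norm ?b ^ k) * (cmod (f ?a) * cmod (g ?b))"
      unfolding tensor_cnj_def norm_mult complex_mod_cnj by (intro mult_right_mono) auto
    also have "\<dots> = 2 ^ k * ((norm ?a ^ k * cmod (f ?a)) * cmod (g ?b) + cmod (f ?a) * (norm ?b ^ k * cmod (g ?b)))"
      by (simp add: algebra_simps)
    also have "\<dots> \<le> 2 ^ k * (Cf * Bg + Bf * Cg)"
      by (intro mult_left_mono add_mono mult_mono Bf Bg Cf Cg) auto
    finally show ?thesis .
  qed
  then show "\<exists>B. \<forall>x. norm x ^ k * cmod (tensor_cnj f g x) \<le> B" by blast
qed

lemma has_derivative_tensor_cnj:
  assumes "(f has_derivative D) (at (fst_part z))" "(g has_derivative E) (at (snd_part z))"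
  shows "(tensor_cnj f g has_derivative
    (\<lambda>v. f (fst_part z) * cnj (E (snd_part v)) + D (fst_part v) * cnj (g (snd_part z)))) (at z)"
  unfolding tensor_cnj_def
  by (intro has_derivative_mult bounded_linear.has_derivative[OF bounded_linear_cnj]
      has_derivative_compose[OF bounded_linear_imp_has_derivative[OF bounded_linear_fst_part] assms(1)]
      has_derivative_compose[OF bounded_linear_imp_has_derivative[OF bounded_linear_snd_part] assms(2)])

lemma schwartz_tensor_cnj:
  assumes "f \<in> schwartz" "g \<in> schwartz"
  shows "tensor_cnj f g \<in> schwartz"
proof -
  have "schwartz_order n (tensor_cnj f g)" for n
    using assms
  proof (induction n arbitrary: f g)
    case (0 f g)
    note D = has_derivative_tensor_cnj[OF schwartz_differentiable[OF 0(1), unfolded frechet_derivative_works]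
       schwartz_differentiable[OF 0(2), unfolded frechet_derivative_works]]
    have "rapidly_decreasing (tensor_cnj f g)"
      using 0 by (intro rapidly_decreasing_tensor_cnj schwartz_rapidly_decreasing)
    moreover have "\<forall>x. tensor_cnj f g differentiable at x" using D by (meson differentiableI)
    ultimately show ?case by simp
  next
    case (Suc n f g)
    note D = has_derivative_tensor_cnj[OF schwartz_differentiable[OF Suc.prems(1), unfolded frechet_derivative_works]
       schwartz_differentiable[OF Suc.prems(2), unfolded frechet_derivative_works]]
    have *: "fst_part (axis (Inl i) 1) = axis i (1::real)" "snd_part (axis (Inr i) 1) = axis i (1::real)"
       "fst_part (axis (Inr i) 1) = (0::real^'a)" "snd_part (axis (Inl i) 1) = (0::real^'a)" for i :: 'a
      by (auto simp: fst_part_def snd_part_def axis_def vec_eq_iff)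
    have z: "frechet_derivative h (at x) 0 = 0" if "h \<in> schwartz" for h :: "real ^ 'a \<Rightarrow> complex" and x
      using schwartz_differentiable[OF that] linear_0 linear_frechet_derivative by blast
    have "partial_deriv (Inl i) (tensor_cnj f g) z = tensor_cnj (partial_deriv i f) g z" for i z
      unfolding partial_deriv_eqI[OF D] by (simp add: * z Suc.prems tensor_cnj_def partial_deriv_def)
    then have 1: "partial_deriv (Inl i) (tensor_cnj f g) = tensor_cnj (partial_deriv i f) g" for i by blast
    have "partial_deriv (Inr i) (tensor_cnj f g) z = tensor_cnj f (partial_deriv i g) z" for i z
      unfolding partial_deriv_eqI[OF D] by (simp add: * z Suc.prems tensor_cnj_def partial_deriv_def)
    then have 2: "partial_deriv (Inr i) (tensor_cnj f g) = tensor_cnj f (partial_deriv i g)" for i by blast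
    have "schwartz_order n (partial_deriv i (tensor_cnj f g))" for i
      using Suc by (cases i) (simp_all add: 1 2 schwartz_partial_deriv)
    moreover have "rapidly_decreasing (tensor_cnj f g)"
      using Suc.prems by (intro rapidly_decreasing_tensor_cnj schwartz_rapidly_decreasing)
    moreover have "\<forall>x. tensor_cnj f g differentiable at x" using D by (meson differentiableI)
    ultimately show ?case by simp
  qed
  then show ?thesis by (simp add: schwartz_iff)
qed

section \<open>Integration\<close>

subsection \<open>Rapidly decreasing functions are integrable\<close>

text \<open>A product of one-dimensional integrable weights. A constant multiple of it dominates any given
  rapidly decreasing function, since the reciprocal weight is at most a power of \<open>1 + |x|\<close>.\<close>

lemma integrable_prod_inverse_1_plus_square:
  "integrable lborel (\<lambda>x::'a::euclidean_space. \<Prod>b\<in>Basis. inverse (1 + (x \<bullet> b)\<^sup>2))"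
proof (rule integrableI_bounded)
  let ?I = "\<integral>\<^sup>+x. ennreal (inverse (1 + x\<^sup>2)) \<partial>lborel"
  have "integrable lborel (\<lambda>x::real. inverse (1 + x\<^sup>2))"
    using integrable_inverse_1_plus_square by (simp add: set_integrable_def)
  then have I: "?I < \<infinity>" by (subst (asm) integrable_iff_bounded) simp
  have "(\<integral>\<^sup>+x. ennreal (norm (\<Prod>b\<in>Basis. inverse (1 + ((x::'a) \<bullet> b)\<^sup>2))) \<partial>lborel) =
      (\<integral>\<^sup>+x. (\<Prod>b\<in>Basis. ennreal (inverse (1 + ((x::'a) \<bullet> b)\<^sup>2))) \<partial>lborel)"
    by (intro nn_integral_cong) (simp add: prod_ennreal prod_nonneg)
  also have "\<dots> = (\<Prod>b\<in>(Basis::'a set). ?I)"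
    by (rule nn_integral_lborel_prod) auto
  also have "\<dots> < \<infinity>" using I by (simp add: power_less_top_ennreal)
  finally show "(\<integral>\<^sup>+x. ennreal (norm (\<Prod>b\<in>Basis. inverse (1 + ((x::'a) \<bullet> b)\<^sup>2))) \<partial>lborel) < \<infinity>" .
qed measurable

lemma rapidly_decreasing_weighted_bound:
  assumes "rapidly_decreasing f"
  obtains B where "\<And>x. (1 + norm x) ^ m * cmod (f x) \<le> B"
proof -
  have c: "cmod (of_real ((1 + norm x) ^ m) * f x) = (1 + norm x) ^ m * cmod (f x)" for x
    unfolding norm_mult norm_of_real by (subst abs_of_nonneg) auto
  have "rapidly_decreasing (\<lambda>x. of_real ((1 + norm x) ^ m) * f x)"
    by (rule rapidly_decreasing_dominated[OF assms, of _ 1 m]) (simp only: c mult_1 order_refl)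
  from rapidly_decreasing_bounded[OF this] obtain B
    where "\<And>x. cmod (of_real ((1 + norm x) ^ m) * f x) \<le> B" by blast
  then show thesis by (intro that[of B]) (simp only: c)
qed

lemma rapidly_decreasing_integrable:
  fixes f :: "'a::euclidean_space \<Rightarrow> complex"
  assumes f: "rapidly_decreasing f" and m: "f \<in> borel_measurable borel"
  shows "integrable lborel f"
proof -
  let ?w = "\<lambda>x::'a. \<Prod>b\<in>Basis. inverse (1 + (x \<bullet> b)\<^sup>2)"
  let ?m = "2 * DIM('a)"
  obtain B where B: "\<And>x. (1 + norm x) ^ ?m * cmod (f x) \<le> B"
    using rapidly_decreasing_weighted_bound[OF f] by blast
  have "cmod (f x) \<le> B * ?w x" for x
  proof -
    let ?p = "\<Prod>b\<in>(Basis::'a set). 1 + (x \<bullet> b)\<^sup>2"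
    have p: "?p > 0" by (intro prod_pos) (simp add: add_pos_nonneg)
    have "?p \<le> (\<Prod>b\<in>(Basis::'a set). (1 + norm x)\<^sup>2)"
    proof (intro prod_mono conjI)
      fix b :: 'a assume "b \<in> Basis"
      then have "(x \<bullet> b)\<^sup>2 \<le> (norm x)\<^sup>2" using Basis_le_norm[of b x] by (metis abs_norm_cancel abs_le_square_iff)
      then show "1 + (x \<bullet> b)\<^sup>2 \<le> (1 + norm x)\<^sup>2"
        using norm_ge_zero[of x] by (simp add: power2_sum del: norm_ge_zero)
    qed auto
    also have "\<dots> = (1 + norm x) ^ ?m" by (simp add: power_mult)
    finally have "?p * cmod (f x) \<le> B" using B[of x] by (meson mult_right_mono norm_ge_zero order_trans)
    then have "cmod (f x) \<le> B / ?p" using p by (simp add: field_simps)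
    then show ?thesis using prod_inversef[of "\<lambda>b. 1 + (x \<bullet> b)\<^sup>2" Basis] by (simp add: divide_inverse o_def)
  qed
  then have le: "norm (f x) \<le> norm (B * ?w x)" for x by (rule order_trans) simp
  show ?thesis
    by (rule Bochner_Integration.integrable_bound[of _ "\<lambda>x. B * ?w x"])
       (use le m integrable_prod_inverse_1_plus_square in auto)
qed

lemma schwartz_continuous: "f \<in> schwartz \<Longrightarrow> continuous_on UNIV f"
  by (simp add: differentiable_imp_continuous_on differentiable_on_def schwartz_differentiable)

lemma schwartz_measurable: "f \<in> schwartz \<Longrightarrow> f \<in> borel_measurable borel"
  by (intro borel_measurable_continuous_onI schwartz_continuous)

lemma schwartz_integrable: "f \<in> schwartz \<Longrightarrow> integrable lborel f"
  by (intro rapidly_decreasing_integrable schwartz_rapidly_decreasing schwartz_measurable)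

lemma schwartz_bounded:
  assumes "f \<in> schwartz" obtains B where "0 \<le> B" "\<And>x. cmod (f x) \<le> B"
  using rapidly_decreasing_bounded schwartz_rapidly_decreasing assms by blast

subsection \<open>Affine changes of variables\<close>

lemma lborel_distr_isometric_affine:
  fixes a :: "'a::euclidean_space"
  assumes "\<bar>c\<bar> = 1"
  shows "distr lborel borel (\<lambda>x. a + c *\<^sub>R x) = lborel"
  using lborel_affine[of c a] assms by (auto simp: density_1)

lemma
  fixes f :: "'a::euclidean_space \<Rightarrow> 'b::{banach, second_countable_topology}"
  assumes f: "f \<in> borel_measurable borel"
  shows lborel_integral_translate: "(LINT x|lborel. f (x - a)) = integral\<^sup>L lborel f"
    and lborel_integral_reflect: "(LINT x|lborel. f (a - x)) = integral\<^sup>L lborel f"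
    and lborel_integrable_translate: "integrable lborel (\<lambda>x. f (x - a)) \<longleftrightarrow> integrable lborel f"
    and lborel_integrable_reflect: "integrable lborel (\<lambda>x. f (a - x)) \<longleftrightarrow> integrable lborel f"
proof -
  have 1: "integral\<^sup>L lborel f = (LINT x|lborel. f (b + c *\<^sub>R x))" if "\<bar>c\<bar> = 1" for b and c :: real
    by (subst lborel_distr_isometric_affine[OF that, of b, symmetric]) (use f in \<open>simp add: integral_distr\<close>)
  have 2: "integrable lborel f \<longleftrightarrow> integrable lborel (\<lambda>x. f (b + c *\<^sub>R x))" if "\<bar>c\<bar> = 1" for b and c :: real
    by (subst lborel_distr_isometric_affine[OF that, of b, symmetric]) (use f in \<open>simp add: integrable_distr_eq\<close>)
  show "(LINT x|lborel. f (x - a)) = integral\<^sup>L lborel f" using 1[of 1 "-a"] by (simp add: algebra_simps)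
  show "(LINT x|lborel. f (a - x)) = integral\<^sup>L lborel f" using 1[of "-1" a] by simp
  show "integrable lborel (\<lambda>x. f (x - a)) \<longleftrightarrow> integrable lborel f" using 2[of 1 "-a"] by (simp add: algebra_simps)
  show "integrable lborel (\<lambda>x. f (a - x)) \<longleftrightarrow> integrable lborel f" using 2[of "-1" a] by simp
qed

lemma lborel_integral_scale:
  fixes f :: "'a::euclidean_space \<Rightarrow> complex"
  assumes "c \<noteq> 0" and f: "f \<in> borel_measurable borel"
  shows "integral\<^sup>L lborel f = \<bar>c\<bar> ^ DIM('a) *\<^sub>R (LINT x|lborel. f (c *\<^sub>R x))"
  by (subst lborel_affine[OF assms(1), of 0])
     (use f in \<open>simp add: integral_density integral_distr\<close>)

lemma AE_lborel_translate:
  fixes a :: "'a::euclidean_space"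
  assumes "AE x in lborel. P x" shows "AE x in lborel. P (x - a)"
proof -
  have "AE x in distr lborel borel (\<lambda>x. - a + 1 *\<^sub>R x). P x"
    by (subst lborel_distr_isometric_affine) (use assms in auto)
  then have "AE x in lborel. P (- a + 1 *\<^sub>R x)" by (rule AE_distrD[rotated]) auto
  then show ?thesis by simp
qed

subsection \<open>Splitting the coordinates\<close>

definition join_parts :: "(real ^ 'm::finite) \<times> (real ^ 'm) \<Rightarrow> real ^ ('m + 'm)" where
  "join_parts p = (\<chi> i. case i of Inl k \<Rightarrow> fst p $ k | Inr k \<Rightarrow> snd p $ k)"

lemma fst_part_join [simp]: "fst_part (join_parts p) = fst p"
  and snd_part_join [simp]: "snd_part (join_parts p) = snd p"
  and join_parts_parts [simp]: "join_parts (fst_part z, snd_part z) = z"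
  by (auto simp: fst_part_def snd_part_def join_parts_def vec_eq_iff split: sum.splits)

lemma bounded_linear_join_parts: "bounded_linear join_parts"
  by (intro linear_conv_bounded_linear[THEN iffD1] linearI)
     (auto simp: join_parts_def vec_eq_iff split: sum.splits)

lemma measurable_join_parts [measurable]: "join_parts \<in> borel_measurable (borel \<Otimes>\<^sub>M borel)"
  unfolding borel_prod
  by (intro borel_measurable_continuous_onI linear_continuous_on bounded_linear_join_parts)

lemma measurable_fst_part [measurable]: "fst_part \<in> borel_measurable borel"
  and measurable_snd_part [measurable]: "snd_part \<in> borel_measurable borel"
  by (intro borel_measurable_continuous_onI linear_continuous_on bounded_linear_fst_part bounded_linear_snd_part)+

lemma prod_Basis_cart:
  shows "(\<Prod>b\<in>Basis. v \<bullet> b) = (\<Prod>i\<in>UNIV. (v::real^'m::finite) $ i)"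
proof -
  have "(Basis :: (real^'m) set) = range (\<lambda>i. axis i 1)" unfolding Basis_vec_def by auto
  then have "(\<Prod>b\<in>Basis. v \<bullet> b) = (\<Prod>b\<in>range (\<lambda>i. axis i 1). v \<bullet> b)" by (rule arg_cong)
  also have "\<dots> = (\<Prod>i\<in>UNIV. v $ i)"
    by (subst prod.reindex) (auto simp: inj_on_def axis_eq_axis inner_axis)
  finally show ?thesis .
qed

lemma prod_UNIV_Plus:
  fixes f :: "'a::finite + 'b::finite \<Rightarrow> 'c::comm_monoid_mult"
  shows "(\<Prod>i\<in>UNIV. f i) = (\<Prod>i\<in>UNIV. f (Inl i)) * (\<Prod>i\<in>UNIV. f (Inr i))"
proof -
  have "prod f UNIV = prod f (Inl ` UNIV) * prod f (Inr ` UNIV)"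
    unfolding UNIV_sum by (rule prod.union_disjoint) auto
  then show ?thesis by (simp add: prod.reindex o_def)
qed

text \<open>Fubini on \<open>\<real>\<^sup>2\<^sup>d\<close> with the coordinates split as \<open>(x, \<xi>)\<close>: the two measures agree on boxes, whose
  preimages are products of boxes.\<close>

lemma distr_join_parts: "distr (lborel \<Otimes>\<^sub>M lborel) borel join_parts = lborel"
proof (rule lborel_eqI[symmetric])
  fix l u :: "real ^ ('m::finite + 'm)"
  assume lu: "\<And>b. b \<in> Basis \<Longrightarrow> l \<bullet> b \<le> u \<bullet> b"
  have lu': "l $ i \<le> u $ i" for i using lu[of "axis i 1"] by (simp add: inner_axis axis_in_Basis_iff)
  have eq: "join_parts -` box l u = box (fst_part l) (fst_part u) \<times> box (snd_part l) (snd_part u)"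
    by (auto simp: mem_box_cart join_parts_def fst_part_def snd_part_def split: sum.splits)
  have le: "fst_part l \<bullet> b \<le> fst_part u \<bullet> b" "snd_part l \<bullet> b \<le> snd_part u \<bullet> b" if "b \<in> Basis" for b :: "real^'m"
    using that lu' by (auto simp: Basis_vec_def inner_axis fst_part_def snd_part_def)
  have "emeasure (distr (lborel \<Otimes>\<^sub>M lborel) borel join_parts) (box l u)
      = emeasure (lborel \<Otimes>\<^sub>M lborel) (box (fst_part l) (fst_part u) \<times> box (snd_part l) (snd_part u))"
    by (subst emeasure_distr) (auto simp: eq space_pair_measure)
  also have "\<dots> = emeasure lborel (box (fst_part l) (fst_part u)) * emeasure lborel (box (snd_part l) (snd_part u))"
    by (intro lborel.emeasure_pair_measure_Times) auto
  also have "\<dots> = (\<Prod>b\<in>Basis. (fst_part u - fst_part l) \<bullet> b) * (\<Prod>b\<in>Basis. (snd_part u - snd_part l) \<bullet> b)"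
    using le by (simp add: emeasure_lborel_box_eq box_eq_empty inner_diff_left prod_nonneg ennreal_mult)
  also have "\<dots> = (\<Prod>b\<in>Basis. (u - l) \<bullet> b)"
    unfolding prod_Basis_cart prod_UNIV_Plus by (simp add: fst_part_def snd_part_def)
  finally show "emeasure (distr (lborel \<Otimes>\<^sub>M lborel) borel join_parts) (box l u) = ennreal (\<Prod>b\<in>Basis. (u - l) \<bullet> b)" .
qed simp

lemma
  fixes f :: "real ^ ('m::finite + 'm) \<Rightarrow> 'b::{banach, second_countable_topology}"
  assumes f: "f \<in> borel_measurable borel"
  shows integral_join_parts: "integral\<^sup>L lborel f = (LINT p|(lborel \<Otimes>\<^sub>M lborel). f (join_parts p))"
    and integrable_join_parts: "integrable lborel f \<longleftrightarrow> integrable (lborel \<Otimes>\<^sub>M lborel) (\<lambda>p. f (join_parts p))"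
  using f by (auto simp: integral_distr integrable_distr_eq simp flip: distr_join_parts)

lemma integrable_lborel_product:
  fixes f :: "'a::euclidean_space \<Rightarrow> complex" and g :: "'b::euclidean_space \<Rightarrow> complex"
  assumes [simp]: "integrable lborel f" "integrable lborel g"
  shows "integrable (lborel \<Otimes>\<^sub>M lborel) (\<lambda>(x, y). f x * g y)"
proof (rule lborel_pair.Fubini_integrable)
  have [measurable]: "f \<in> borel_measurable borel" "g \<in> borel_measurable borel"
    using assms[THEN borel_measurable_integrable] by auto
  show "(\<lambda>(x, y). f x * g y) \<in> borel_measurable (lborel \<Otimes>\<^sub>M lborel)" by measurable
qed (auto simp: norm_mult)

subsection \<open>Differentiation under the integral sign\<close>

text \<open>Dominated convergence applies to the difference quotients, because the mean value inequality
  bounds them by the dominating function of the derivatives.\<close>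

lemma has_derivative_integral_dominated:
  fixes k :: "'w \<Rightarrow> 'a::euclidean_space \<Rightarrow> complex"
  assumes D: "\<And>w t. (k w has_derivative k' w t) (at t)"
    and B: "\<And>w t v. cmod (k' w t v) \<le> m w * norm v"
    and m: "integrable M m"
    and k: "\<And>t. integrable M (\<lambda>w. k w t)"
    and k': "\<And>v. (\<lambda>w. k' w t v) \<in> borel_measurable M"
  shows "((\<lambda>s. LINT w|M. k w s) has_derivative (\<lambda>v. LINT w|M. k' w t v)) (at t)"
proof -
  have k'_int: "integrable M (\<lambda>w. k' w t v)" for v
    by (rule Bochner_Integration.integrable_bound[of _ "\<lambda>w. m w * norm v"])
       (use m k' B in \<open>auto intro!: AE_I2 intro: order_trans[OF _ abs_ge_self]\<close>)
  have lin: "linear (k' w t)" for w using D has_derivative_linear by blast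
  have bl: "bounded_linear (\<lambda>v. LINT w|M. k' w t v)"
  proof (intro linear_conv_bounded_linear[THEN iffD1] linearI)
    show "(LINT w|M. k' w t (u + v)) = (LINT w|M. k' w t u) + (LINT w|M. k' w t v)" for u v
      using k'_int by (simp add: linear_add[OF lin])
    show "(LINT w|M. k' w t (r *\<^sub>R v)) = r *\<^sub>R (LINT w|M. k' w t v)" for r v
      by (simp add: linear_cmul[OF lin])
  qed
  have mv: "cmod (k w (t + h) - k w t) \<le> m w * norm h" for w h
  proof -
    have "cmod (k w (t + h) - k w t) \<le> m w * norm (t + h - t)"
      using D B by (intro differentiable_bound[of UNIV]) (auto intro: onorm_le)
    then show ?thesis by simp
  qed
  have "(\<lambda>h. norm ((LINT w|M. k w (t + h)) - (LINT w|M. k w t) - (LINT w|M. k' w t h)) / norm h) \<midarrow>0\<rightarrow> 0"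
    unfolding tendsto_at_iff_sequentially
  proof (intro allI impI)
    fix X :: "nat \<Rightarrow> 'a" assume "\<forall>i. X i \<in> UNIV - {0}" and X: "X \<longlonglongrightarrow> 0"
    then have nz: "X i \<noteq> 0" for i by auto
    let ?q = "\<lambda>i w. (k w (t + X i) - k w t - k' w t (X i)) /\<^sub>R norm (X i)"
    have "(\<lambda>i. LINT w|M. ?q i w) \<longlonglongrightarrow> (LINT w|M. 0)"
    proof (rule integral_dominated_convergence)
      show "integrable M (\<lambda>w. 2 * m w)" using m by simp
      show "AE w in M. (\<lambda>i. ?q i w) \<longlonglongrightarrow> 0"
      proof (intro AE_I2)
        fix w
        have "(\<lambda>h. norm (k w (t + h) - k w t - k' w t h) / norm h) \<midarrow>0\<rightarrow> 0"
          using D[of w t] by (simp add: has_derivative_at)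
        then have "(\<lambda>i. norm (k w (t + X i) - k w t - k' w t (X i)) / norm (X i)) \<longlonglongrightarrow> 0"
          using X nz by (simp add: tendsto_at_iff_sequentially o_def)
        then show "(\<lambda>i. ?q i w) \<longlonglongrightarrow> 0"
          by (subst tendsto_norm_zero_iff[symmetric]) (simp add: divide_inverse mult.commute)
      qed
      show "AE w in M. norm (?q i w) \<le> 2 * m w" for i
      proof (intro AE_I2)
        fix w
        have "norm (k w (t + X i) - k w t - k' w t (X i)) \<le> m w * norm (X i) + m w * norm (X i)"
          using mv[of w "X i"] B[of w t "X i"]
            norm_triangle_ineq4[of "k w (t + X i) - k w t" "k' w t (X i)"] by linarith
        then show "norm (?q i w) \<le> 2 * m w" using nz[of i]
          unfolding norm_scaleR by (simp add: divide_simps mult_ac)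
      qed
    qed (use k k' in \<open>auto intro: borel_measurable_integrable\<close>)
    moreover have "(LINT w|M. ?q i w) =
        ((LINT w|M. k w (t + X i)) - (LINT w|M. k w t) - (LINT w|M. k' w t (X i))) /\<^sub>R norm (X i)" for i
      using k k'_int by simp
    ultimately have "(\<lambda>i. ((LINT w|M. k w (t + X i)) - (LINT w|M. k w t) - (LINT w|M. k' w t (X i))) /\<^sub>R norm (X i)) \<longlonglongrightarrow> 0"
      by (simp only: integral_zero)
    from tendsto_norm[OF this]
    show "((\<lambda>h. norm ((LINT w|M. k w (t + h)) - (LINT w|M. k w t) - (LINT w|M. k' w t h)) / norm h) \<circ> X) \<longlonglongrightarrow> 0"
      by (simp add: o_def divide_inverse mult.commute)
  qed
  with bl show ?thesis by (simp add: has_derivative_at)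
qed

text \<open>The average of \<open>\<partial>\<^sub>i u (t + s e\<^sub>i)\<close> over \<open>s \<in> [0, 1]\<close> is \<open>u (t + e\<^sub>i) - u t\<close>. Its integral
  over \<open>t\<close> vanishes by translation invariance, and by Fubini it is the integral of \<open>\<partial>\<^sub>i u\<close>.\<close>

lemma integral_partial_deriv_eq_0:
  assumes u: "u \<in> schwartz"
  shows "(LINT t|lborel. partial_deriv i u t) = 0"
proof -
  let ?e = "axis i (1::real)" and ?D = "partial_deriv i u"
  have D: "?D \<in> schwartz" by (intro schwartz_partial_deriv u)
  note [measurable] = schwartz_measurable[OF u] schwartz_measurable[OF D]
  have ftc: "(LINT s|lborel. indicator {0..1} s *\<^sub>R ?D (t + s *\<^sub>R ?e)) = u (t + ?e) - u t" for t
  proof -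
    have "((\<lambda>s. u (t + s *\<^sub>R ?e)) has_vector_derivative ?D (t + s *\<^sub>R ?e)) (at s within {0..1})" for s
    proof -
      have "((\<lambda>s. t + s *\<^sub>R ?e) has_derivative (\<lambda>r. r *\<^sub>R ?e)) (at s within {0..1})"
        by (auto intro!: derivative_eq_intros)
      from has_derivative_compose[OF this has_derivative_partial_derivs[OF schwartz_differentiable[OF u]]]
      have "((\<lambda>s. u (t + s *\<^sub>R ?e)) has_derivative
         (\<lambda>r. \<Sum>j\<in>UNIV. complex_of_real ((r *\<^sub>R ?e) $ j) * partial_deriv j u (t + s *\<^sub>R ?e))) (at s within {0..1})" .
      also have "(\<lambda>r. \<Sum>j\<in>UNIV. complex_of_real ((r *\<^sub>R ?e) $ j) * partial_deriv j u (t + s *\<^sub>R ?e)) =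
         (\<lambda>r. r *\<^sub>R ?D (t + s *\<^sub>R ?e))"
      proof
        fix r
        have "(\<Sum>j\<in>UNIV. complex_of_real ((r *\<^sub>R ?e) $ j) * partial_deriv j u (t + s *\<^sub>R ?e)) =
          (\<Sum>j\<in>UNIV. if j = i then complex_of_real r * partial_deriv j u (t + s *\<^sub>R ?e) else 0)"
          by (intro sum.cong) (auto simp: axis_def)
        then show "(\<Sum>j\<in>UNIV. complex_of_real ((r *\<^sub>R ?e) $ j) * partial_deriv j u (t + s *\<^sub>R ?e)) = r *\<^sub>R ?D (t + s *\<^sub>R ?e)"
          by (simp add: scaleR_conv_of_real)
      qed
      finally show ?thesis unfolding has_vector_derivative_def .
    qed
    moreover have "continuous_on {0..1} (\<lambda>s. ?D (t + s *\<^sub>R ?e))"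
      by (intro continuous_on_compose2[OF schwartz_continuous[OF D]] continuous_intros) auto
    ultimately show ?thesis
      using integral_FTC_Icc[of 0 1 "\<lambda>s. u (t + s *\<^sub>R ?e)" "\<lambda>s. ?D (t + s *\<^sub>R ?e)"] by simp
  qed
  have tr: "(LINT t|lborel. f (t + a)) = integral\<^sup>L lborel f" "integrable lborel (\<lambda>t. f (t + a)) \<longleftrightarrow> integrable lborel f"
    if "f \<in> borel_measurable borel" for f :: "real^'a \<Rightarrow> 'b::{banach,second_countable_topology}" and a
    using lborel_integral_translate[OF that, of "-a"] lborel_integrable_translate[OF that, of "-a"] by simp_all
  have int: "integrable (lborel \<Otimes>\<^sub>M lborel) (\<lambda>(s, t). indicator {0..1::real} s *\<^sub>R ?D (t + s *\<^sub>R ?e))"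
  proof (rule lborel_pair.Fubini_integrable)
    have "(LINT t|lborel. norm (?D (t + s *\<^sub>R ?e))) = (LINT t|lborel. norm (?D t))" for s
      by (rule tr(1)) measurable
    then show "integrable lborel (\<lambda>s. LINT t|lborel. norm (case (s, t) of (s, t) \<Rightarrow> indicator {0..1::real} s *\<^sub>R ?D (t + s *\<^sub>R ?e)))"
      by simp
    show "AE s in lborel. integrable lborel (\<lambda>t. case (s, t) of (s, t) \<Rightarrow> indicator {0..1::real} s *\<^sub>R ?D (t + s *\<^sub>R ?e))"
      using tr(2)[of ?D] schwartz_integrable[OF D] by simp
  qed measurable
  have "0 = (LINT t|lborel. u (t + ?e)) - (LINT t|lborel. u t)"
    by (simp add: tr(1))
  also have "\<dots> = (LINT t|lborel. LINT s|lborel. indicator {0..1} s *\<^sub>R ?D (t + s *\<^sub>R ?e))"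
    unfolding ftc by (rule Bochner_Integration.integral_diff[symmetric]) (simp_all add: tr(2) schwartz_integrable u)
  also have "\<dots> = (LINT s|lborel. LINT t|lborel. indicator {0..1} s *\<^sub>R ?D (t + s *\<^sub>R ?e))"
    by (rule lborel_pair.Fubini_integral[OF int])
  also have "\<dots> = (LINT s|lborel. indicator {0..1::real} s *\<^sub>R integral\<^sup>L lborel ?D)"
    by (simp add: tr(1))
  also have "\<dots> = integral\<^sup>L lborel ?D" by simp
  finally show ?thesis by simp
qed

section \<open>Square-integrable functions and density of the Schwartz space\<close>

lemma borel_measurable_cnj [measurable (raw)]:
  "f \<in> borel_measurable M \<Longrightarrow> (\<lambda>x. cnj (f x)) \<in> borel_measurable M"
  by (rule measurable_compose[of f M borel cnj borel])
     (auto intro!: borel_measurable_continuous_onI continuous_intros)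

lemma borel_measurable_cis [measurable (raw)]:
  "f \<in> borel_measurable M \<Longrightarrow> (\<lambda>x. cis (f x)) \<in> borel_measurable M"
  by (rule measurable_compose[of f M borel cis borel])
     (auto intro!: borel_measurable_continuous_onI continuous_intros)

lemma L2_measurable: "f \<in> L2 \<Longrightarrow> f \<in> borel_measurable borel"
  by (simp add: L2_def)

lemma mult_le_sum_power2:
  fixes a b :: real assumes "0 \<le> a" "0 \<le> b" shows "a * b \<le> a\<^sup>2 + b\<^sup>2"
  using sum_squares_bound[of a b] mult_nonneg_nonneg[OF assms] by linarith

lemma L2_integrable_mult:
  assumes "f \<in> L2" "g \<in> L2"
  shows "integrable lborel (\<lambda>x. f x * g x)"
proof (rule Bochner_Integration.integrable_bound)
  show "integrable lborel (\<lambda>x. (cmod (f x))\<^sup>2 + (cmod (g x))\<^sup>2)" using assms by (simp add: L2_def)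
  show "(\<lambda>x. f x * g x) \<in> borel_measurable lborel" using assms by (auto simp: L2_def)
  show "AE x in lborel. norm (f x * g x) \<le> norm ((cmod (f x))\<^sup>2 + (cmod (g x))\<^sup>2)"
    using mult_le_sum_power2 by (auto simp: norm_mult)
qed

lemma L2_cnj: "f \<in> L2 \<Longrightarrow> (\<lambda>x. cnj (f x)) \<in> L2"
  by (auto simp: L2_def)

lemma L2_integrable_inner: "f \<in> L2 \<Longrightarrow> g \<in> L2 \<Longrightarrow> integrable lborel (\<lambda>x. f x * cnj (g x))"
  by (intro L2_integrable_mult L2_cnj)

lemma schwartz_L2: "f \<in> schwartz \<Longrightarrow> f \<in> L2"
proof -
  assume f: "f \<in> schwartz"
  have "integrable lborel (\<lambda>x. norm (f x * f x))"
    by (intro integrable_norm schwartz_integrable schwartz_mult f)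
  then show ?thesis using schwartz_measurable[OF f] by (simp add: L2_def norm_mult power2_eq_square)
qed

lemma L2_scale: "f \<in> L2 \<Longrightarrow> (\<lambda>x. c * f x) \<in> L2"
  by (auto simp: L2_def norm_mult power_mult_distrib)

lemma L2_add:
  assumes f: "f \<in> L2" and g: "g \<in> L2" shows "(\<lambda>x. f x + g x) \<in> L2"
  unfolding L2_def
proof (intro CollectI conjI)
  note [measurable] = L2_measurable[OF f] L2_measurable[OF g]
  show "(\<lambda>x. f x + g x) \<in> borel_measurable lborel" by simp
  show "integrable lborel (\<lambda>x. (cmod (f x + g x))\<^sup>2)"
  proof (rule Bochner_Integration.integrable_bound)
    show "integrable lborel (\<lambda>x. 2 * ((cmod (f x))\<^sup>2 + (cmod (g x))\<^sup>2))" using assms by (simp add: L2_def)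
    have "(cmod (a + b))\<^sup>2 \<le> 2 * ((cmod a)\<^sup>2 + (cmod b)\<^sup>2)" for a b
    proof -
      have "(cmod (a + b))\<^sup>2 \<le> (cmod a + cmod b)\<^sup>2" by (intro power_mono norm_triangle_ineq) auto
      also have "\<dots> \<le> 2 * ((cmod a)\<^sup>2 + (cmod b)\<^sup>2)"
        using sum_squares_bound[of "cmod a" "cmod b"] by (simp add: power2_sum)
      finally show ?thesis .
    qed
    then show "AE x in lborel. norm ((cmod (f x + g x))\<^sup>2) \<le> norm (2 * ((cmod (f x))\<^sup>2 + (cmod (g x))\<^sup>2))"
      by auto
  qed simp
qed

lemma L2_translation:
  assumes "f \<in> L2" shows "translation a f \<in> L2"
proof -
  note [measurable] = L2_measurable[OF assms]
  have "integrable lborel (\<lambda>x. (cmod (f (x - a)))\<^sup>2)"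
    by (subst lborel_integrable_translate[of "\<lambda>x. (cmod (f x))\<^sup>2"]) (use assms in \<open>simp_all add: L2_def\<close>)
  then show ?thesis by (simp add: L2_def translation_def)
qed

lemma L2_tf_shift:
  assumes "f \<in> L2" shows "tf_shift z f \<in> L2"
proof -
  have *: "translation (fst_part z) f \<in> L2" by (rule L2_translation[OF assms])
  note [measurable] = L2_measurable[OF this]
  have "modulation (snd_part z) (translation (fst_part z) f) \<in> borel_measurable borel"
    unfolding modulation_def by measurable
  then show ?thesis using * by (simp add: L2_def tf_shift_def modulation_def norm_mult)
qed

lemma L2_inner_self: "L2_inner f f = of_real (LINT x|lborel. (cmod (f x))\<^sup>2)"
  by (simp add: L2_inner_def complex_norm_square[symmetric] integral_complex_of_real del: of_real_power)

lemma L2_inner_self_eq_0: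
  assumes "f \<in> L2" "L2_inner f f = 0" shows "ae_eq f (\<lambda>_. 0)"
proof -
  have "(LINT x|lborel. (cmod (f x))\<^sup>2) = 0" using assms(2) unfolding L2_inner_self by simp
  then have "AE x in lborel. (cmod (f x))\<^sup>2 = 0"
    by (subst (asm) integral_nonneg_eq_0_iff_AE) (use assms(1) in \<open>auto simp: L2_def\<close>)
  then show ?thesis by (simp add: ae_eq_def)
qed

lemma L2_inner_commute: "L2_inner g f = cnj (L2_inner f g)"
  unfolding L2_inner_def by (subst Bochner_Integration.integral_cnj[symmetric]) (simp add: mult.commute)

lemma L2_inner_add_left:
  "f \<in> L2 \<Longrightarrow> g \<in> L2 \<Longrightarrow> h \<in> L2 \<Longrightarrow> L2_inner (\<lambda>x. f x + g x) h = L2_inner f h + L2_inner g h"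
  by (simp add: L2_inner_def distrib_right L2_integrable_inner)

lemma L2_inner_scale_left: "L2_inner (\<lambda>x. c * f x) h = c * L2_inner f h"
  by (simp add: L2_inner_def mult.assoc)

lemma ae_eq_refl: "ae_eq f f" by (simp add: ae_eq_def)

lemma ae_eq_sym: "ae_eq f g \<Longrightarrow> ae_eq g f"
  unfolding ae_eq_def by (auto elim: eventually_mono)

lemma ae_eq_trans [trans]: "ae_eq f g \<Longrightarrow> ae_eq g h \<Longrightarrow> ae_eq f h"
  unfolding ae_eq_def by (rule eventually_mp[of "\<lambda>x. f x = g x \<and> g x = h x"]) (auto intro: eventually_conj)

lemma ae_eq_translation: "ae_eq f g \<Longrightarrow> ae_eq (translation a f) (translation a g)"
  unfolding ae_eq_def translation_def by (rule AE_lborel_translate)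

lemma L2_inner_cong:
  assumes "f \<in> L2" "f' \<in> L2" "g \<in> L2" "g' \<in> L2" "ae_eq f f'" "ae_eq g g'"
  shows "L2_inner f g = L2_inner f' g'"
proof -
  have [measurable]: "f \<in> borel_measurable borel" "f' \<in> borel_measurable borel"
    "g \<in> borel_measurable borel" "g' \<in> borel_measurable borel" using assms L2_measurable by blast+
  show ?thesis unfolding L2_inner_def
    by (rule integral_cong_AE) (use assms(5,6) in \<open>auto simp: ae_eq_def\<close>)
qed

text \<open>The test function is the difference of the two functions.\<close>

lemma L2_eqI:
  assumes f: "f \<in> L2" and g: "g \<in> L2" and eq: "\<And>k. k \<in> L2 \<Longrightarrow> L2_inner f k = L2_inner g k"
  shows "ae_eq f g"
proof -
  let ?d = "\<lambda>x. f x + (- 1) * g x"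
  have d: "?d \<in> L2" by (intro L2_add L2_scale f g)
  have "L2_inner ?d ?d = L2_inner f ?d + (- 1) * L2_inner g ?d"
    by (subst L2_inner_add_left) (auto simp only: f g d L2_scale L2_inner_scale_left)
  also have "\<dots> = 0" using eq[OF d] by simp
  finally have "ae_eq ?d (\<lambda>_. 0)" by (rule L2_inner_self_eq_0[OF d])
  then show ?thesis by (auto simp: ae_eq_def elim: eventually_mono)
qed

lemma continuous_ae_eq_imp_eq:
  assumes "continuous_on UNIV f" "continuous_on UNIV g" "ae_eq f g"
  shows "f = g"
proof (rule ccontr)
  assume "f \<noteq> g"
  let ?S = "{x. f x \<noteq> g x}"
  have "open ?S" using assms by (intro open_Collect_neq)
  moreover have "?S \<noteq> {}" using \<open>f \<noteq> g\<close> by auto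
  moreover have "negligible ?S"
  proof -
    have "?S \<in> null_sets lborel"
      by (subst AE_iff_null_sets) (use \<open>open ?S\<close> assms(3) in \<open>auto simp: ae_eq_def\<close>)
    then show ?thesis unfolding negligible_iff_null_sets by (rule null_sets_completionI)
  qed
  ultimately show False using open_not_negligible by blast
qed

subsection \<open>Gaussian-type Schwartz functions\<close>

lemma real_polynomial_function_growth:
  assumes "real_polynomial_function p"
  shows "\<exists>C m. 0 \<le> C \<and> (\<forall>x. \<bar>p x\<bar> \<le> C * (1 + norm x) ^ m)"
  using assms
proof induction
  case (linear f)
  then obtain K where K: "\<And>x. norm (f x) \<le> norm x * K" "0 < K" using bounded_linear.pos_bounded by blast
  have "\<bar>f x\<bar> \<le> K * (1 + norm x) ^ 1" for x using K(1)[of x] K(2) by (simp add: algebra_simps)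
  then show ?case using K(2) by (intro exI[of _ K] exI[of _ 1]) auto
next
  case (const c)
  then show ?case by (intro exI[of _ "\<bar>c\<bar>"] exI[of _ 0]) auto
next
  case (add f g)
  then obtain C m D n where *: "0 \<le> C" "0 \<le> D" "\<And>x. \<bar>f x\<bar> \<le> C * (1 + norm x) ^ m" "\<And>x. \<bar>g x\<bar> \<le> D * (1 + norm x) ^ n"
    by metis
  have "\<bar>f x + g x\<bar> \<le> (C + D) * (1 + norm x) ^ (m + n)" for x
  proof -
    have "C * (1 + norm x) ^ m \<le> C * (1 + norm x) ^ (m + n)" "D * (1 + norm x) ^ n \<le> D * (1 + norm x) ^ (m + n)"
      using *(1,2) by (auto intro!: mult_left_mono power_increasing)
    then show ?thesis using *(3,4)[of x] by (simp add: distrib_right)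
  qed
  then show ?case using *(1,2) by (intro exI[of _ "C + D"] exI[of _ "m + n"]) auto
next
  case (mult f g)
  then obtain C m D n where *: "0 \<le> C" "0 \<le> D" "\<And>x. \<bar>f x\<bar> \<le> C * (1 + norm x) ^ m" "\<And>x. \<bar>g x\<bar> \<le> D * (1 + norm x) ^ n"
    by metis
  have "\<bar>f x * g x\<bar> \<le> (C * D) * (1 + norm x) ^ (m + n)" for x
    using mult_mono[OF *(3)[of x] *(4)[of x]] *(1) by (simp add: abs_mult power_add mult_ac)
  then show ?case using *(1,2) by (intro exI[of _ "C * D"] exI[of _ "m + n"]) auto
qed

lemma real_polynomial_function_derivative:
  assumes "real_polynomial_function p"
  shows "\<exists>D. (\<forall>x. (p has_derivative D x) (at x)) \<and> (\<forall>v. real_polynomial_function (\<lambda>x. D x v))"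
  using assms
proof induction
  case (linear f)
  then show ?case by (intro exI[of _ "\<lambda>x. f"]) (auto intro: bounded_linear_imp_has_derivative)
next
  case (const c)
  then show ?case by (intro exI[of _ "\<lambda>x v. 0"]) auto
next
  case (add f g)
  then obtain D E where "\<forall>x. (f has_derivative D x) (at x)" "\<forall>v. real_polynomial_function (\<lambda>x. D x v)"
    "\<forall>x. (g has_derivative E x) (at x)" "\<forall>v. real_polynomial_function (\<lambda>x. E x v)" by metis
  then show ?case by (intro exI[of _ "\<lambda>x v. D x v + E x v"]) (auto intro: has_derivative_add)
next
  case (mult f g)
  then obtain D E where "\<forall>x. (f has_derivative D x) (at x)" "\<forall>v. real_polynomial_function (\<lambda>x. D x v)"
    "\<forall>x. (g has_derivative E x) (at x)" "\<forall>v. real_polynomial_function (\<lambda>x. E x v)" by metis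
  then show ?case using mult(1,2)
    by (intro exI[of _ "\<lambda>x v. f x * E x v + D x v * g x"]) (auto intro!: has_derivative_mult real_polynomial_function.intros(3,4))
qed

text \<open>The bound comes from \<open>1 + y \<le> exp y\<close> at \<open>y = |x|\<^sup>2 / (k + 1)\<close>, raised to the power \<open>k + 1\<close>.\<close>

lemma rapidly_decreasing_gaussian:
  "rapidly_decreasing (\<lambda>x. of_real (exp (- (norm x)\<^sup>2)))"
  unfolding rapidly_decreasing_def
proof (intro allI exI)
  fix k :: nat and x :: 'a
  let ?y = "(norm x)\<^sup>2" and ?k = "real (Suc k)"
  have "?y / ?k \<le> exp (?y / ?k)" using exp_ge_add_one_self[of "?y / ?k"] by linarith
  then have "(?y / ?k) ^ Suc k \<le> exp (?y / ?k) ^ Suc k" by (intro power_mono) auto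
  also have "\<dots> = exp ?y" by (subst exp_of_nat_mult[symmetric]) simp
  finally have 1: "?y ^ Suc k \<le> ?k ^ Suc k * exp ?y" by (simp only: power_divide pos_divide_le_eq zero_less_power of_nat_0_less_iff zero_less_Suc mult.commute)
  have "norm x ^ k \<le> 1 + ?y ^ Suc k"
  proof (cases "norm x \<le> 1")
    case True
    then have "norm x ^ k \<le> 1" by (intro power_le_one) auto
    moreover have "0 \<le> ?y ^ Suc k" by simp
    ultimately show ?thesis by linarith
  next
    case False
    then have "norm x ^ k \<le> norm x ^ (2 * Suc k)" by (intro power_increasing) auto
    then show ?thesis unfolding power_mult by linarith
  qed
  also have "\<dots> \<le> exp ?y + ?k ^ Suc k * exp ?y" using 1 by (intro add_mono) auto
  finally have "norm x ^ k * exp (- ?y) \<le> (exp ?y + ?k ^ Suc k * exp ?y) * exp (- ?y)" by (intro mult_right_mono) auto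
  also have "\<dots> = 1 + ?k ^ Suc k" by (simp add: exp_minus field_simps)
  finally show "norm x ^ k * cmod (of_real (exp (- ?y))) \<le> 1 + ?k ^ Suc k" by simp
qed

text \<open>The functions \<open>P exp (- R)\<close>, with \<open>R\<close> fixed and \<open>P\<close> any polynomial, are closed under partial
  derivatives. The Gaussian is the case \<open>R = |x|\<^sup>2\<close>; other choices of \<open>R\<close> approximate
  indicator functions of boxes below.\<close>

lemma schwartz_polynomial_exp:
  fixes P R :: "real ^ 'm::finite \<Rightarrow> real"
  assumes P: "real_polynomial_function P" and R: "real_polynomial_function R"
    and le: "\<And>x. (norm x)\<^sup>2 \<le> R x"
  shows "(\<lambda>x. of_real (P x * exp (- R x))) \<in> schwartz"
proof -
  obtain DR where DR: "\<And>x. (R has_derivative DR x) (at x)" "\<And>v. real_polynomial_function (\<lambda>x. DR x v)"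
    using real_polynomial_function_derivative[OF R] by blast
  have rd: "rapidly_decreasing (\<lambda>x. of_real (P x * exp (- R x)))" if P: "real_polynomial_function P" for P
  proof -
    obtain C m where C: "\<And>x. \<bar>P x\<bar> \<le> C * (1 + norm x) ^ m" "0 \<le> C" using real_polynomial_function_growth[OF P] by blast
    show ?thesis
    proof (rule rapidly_decreasing_dominated[OF rapidly_decreasing_gaussian])
      fix x
      have "\<bar>P x\<bar> * exp (- R x) \<le> (C * (1 + norm x) ^ m) * exp (- (norm x)\<^sup>2)"
        using C le[of x] by (intro mult_mono) auto
      then show "cmod (of_real (P x * exp (- R x))) \<le> C * (1 + norm x) ^ m * cmod (of_real (exp (- (norm x)\<^sup>2)))"
        by (simp add: norm_mult)
    qed
  qed
  have D: "((\<lambda>x. complex_of_real (P x * exp (- R x))) has_derivative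
      (\<lambda>v. of_real ((DP x v - P x * DR x v) * exp (- R x)))) (at x)"
    if "\<And>x. (P has_derivative DP x) (at x)" for P DP x
  proof -
    have "((\<lambda>x. P x * exp (- R x)) has_derivative (\<lambda>v. (DP x v - P x * DR x v) * exp (- R x))) (at x)"
      using that[of x] DR(1)[of x] by (auto intro!: derivative_eq_intros simp: algebra_simps)
    from bounded_linear.has_derivative[OF bounded_linear_of_real this] show ?thesis .
  qed
  have "schwartz_order n (\<lambda>x. of_real (P x * exp (- R x)))" for n
    using P
  proof (induction n arbitrary: P)
    case (0 P)
    then obtain DP where DP: "\<And>x. (P has_derivative DP x) (at x)" using real_polynomial_function_derivative by blast
    from D[OF DP] show ?case using rd[OF 0] by (auto simp: differentiable_def simp del: of_real_mult)
  next
    case (Suc n P)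
    then obtain DP where DP: "\<And>x. (P has_derivative DP x) (at x)" "\<And>v. real_polynomial_function (\<lambda>x. DP x v)"
      using real_polynomial_function_derivative by blast
    have "partial_deriv i (\<lambda>x. complex_of_real (P x * exp (- R x))) =
        (\<lambda>x. of_real ((DP x (axis i 1) - P x * DR x (axis i 1)) * exp (- R x)))" for i
      using partial_deriv_eqI[OF D[OF DP(1)]] by blast
    moreover have "real_polynomial_function (\<lambda>x. DP x v - P x * DR x v)" for v
      using DP(2) DR(2) Suc.prems by (intro real_polynomial_function_diff real_polynomial_function.intros(4)) auto
    ultimately have "schwartz_order n (partial_deriv i (\<lambda>x. complex_of_real (P x * exp (- R x))))" for i
      using Suc.IH by (simp del: of_real_mult)
    then show ?case using D[OF DP(1)] rd[OF Suc.prems] by (auto simp: differentiable_def simp del: of_real_mult)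
  qed
  then show ?thesis by (simp add: schwartz_iff)
qed

lemma real_polynomial_function_norm_power2: "real_polynomial_function (\<lambda>x::real^'m::finite. (norm x)\<^sup>2)"
  unfolding power2_norm_eq_inner inner_vec_def
  unfolding inner_real_def
  by (intro real_polynomial_function_sum real_polynomial_function.intros(4) real_polynomial_function.intros(1)
      bounded_linear_vec_nth) auto

definition gaussian :: "real ^ 'm::finite \<Rightarrow> complex" where
  "gaussian x = of_real (exp (- (norm x)\<^sup>2))"

lemma gaussian_schwartz: "gaussian \<in> schwartz"
  using schwartz_polynomial_exp[of "\<lambda>_. 1" "\<lambda>x::real^'m. (norm x)\<^sup>2"] real_polynomial_function_norm_power2
  by (auto simp: gaussian_def[abs_def])

lemma gaussian_nonzero: "gaussian x \<noteq> 0"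
  by (simp add: gaussian_def)


subsection \<open>Density\<close>

text \<open>The functions \<open>exp (- |x|\<^sup>2 - \<Sum>\<^sub>j y\<^sub>j\<^sup>2\<^sup>n)\<close>, with \<open>y\<^sub>j\<close> the coordinates that map the box
  onto \<open>(- 1, 1)\<close>, converge to the Gaussian restricted to the box. Dominated convergence thus turns
  orthogonality to all Schwartz functions into vanishing integrals over boxes.\<close>

lemma box_integral_eq_0:
  fixes h :: "real ^ 'm::finite \<Rightarrow> complex"
  assumes h: "h \<in> L2" and orth: "\<And>\<phi>. \<phi> \<in> schwartz \<Longrightarrow> L2_inner \<phi> h = 0"
  shows "(LINT x:box l u|lborel. gaussian x * cnj (h x)) = 0"
proof (cases "\<forall>j. l $ j < u $ j")
  case False
  then obtain j where "u $ j \<le> l $ j" by (auto simp: not_less)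
  then have "x \<notin> box l u" for x by (auto simp: mem_box_cart intro!: exI[of _ j])
  then have "box l u = {}" by blast
  then show ?thesis by (simp add: set_lebesgue_integral_def)
next
  case True
  note [measurable] = L2_measurable[OF h]
  note gL2 = schwartz_L2[OF gaussian_schwartz]
  have [measurable]: "gaussian \<in> borel_measurable borel" by (rule L2_measurable[OF gL2])
  define y where "y x j = (2 * x $ j - (l $ j + u $ j)) / (u $ j - l $ j)" for x :: "real ^ 'm" and j
  have y_abs: "\<bar>y x j\<bar> = \<bar>2 * x $ j - (l $ j + u $ j)\<bar> / (u $ j - l $ j)" for x j
    using True[rule_format, of j] by (simp add: y_def)
  define p where "p n x = (\<Sum>j\<in>UNIV. y x j ^ (2 * n))" for n :: nat and x :: "real ^ 'm"
  have p_nonneg: "0 \<le> p n x" for n x unfolding p_def by (intro sum_nonneg) (simp add: power_mult)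
  have poly: "real_polynomial_function (\<lambda>x. p n x)" for n
    unfolding p_def y_def
    by (intro real_polynomial_function_sum real_polynomial_function_power real_polynomial_function_divide
         real_polynomial_function_diff real_polynomial_function.intros(4) real_polynomial_function.intros(2)
         real_polynomial_function.intros(1) bounded_linear_vec_nth) auto
  have [measurable]: "(\<lambda>x. p n x) \<in> borel_measurable borel" for n
    unfolding p_def y_def by measurable
  let ?f = "\<lambda>n x. of_real (1 * exp (- ((norm x)\<^sup>2 + p n x))) * cnj (h x)"
  have f_eq: "?f n x = of_real (exp (- p n x)) * (gaussian x * cnj (h x))" for n x
    by (simp add: gaussian_def exp_diff exp_minus divide_inverse mult_ac)
  have "(LINT x|lborel. ?f n x) = 0" for n
  proof -
    have "(\<lambda>x. of_real (1 * exp (- ((norm x)\<^sup>2 + p n x)))) \<in> schwartz"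
      by (intro schwartz_polynomial_exp real_polynomial_function.intros real_polynomial_function_norm_power2 poly)
         (use p_nonneg in auto)
    from orth[OF this] show ?thesis by (simp add: L2_inner_def)
  qed
  moreover have "(\<lambda>n. LINT x|lborel. ?f n x) \<longlonglongrightarrow> (LINT x:box l u|lborel. gaussian x * cnj (h x))"
    unfolding set_lebesgue_integral_def f_eq
  proof (rule integral_dominated_convergence)
    show "integrable lborel (\<lambda>x. norm (gaussian x * cnj (h x)))"
      by (intro integrable_norm L2_integrable_inner gL2 h)
    show "AE x in lborel. norm (of_real (exp (- p n x)) * (gaussian x * cnj (h x))) \<le> norm (gaussian x * cnj (h x))" for n
    proof (intro AE_I2)
      fix x
      have "exp (- p n x) \<le> 1" using p_nonneg[of n x] by simp
      then show "norm (of_real (exp (- p n x)) * (gaussian x * cnj (h x))) \<le> norm (gaussian x * cnj (h x))"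
        unfolding norm_mult[of "of_real _"] by (simp add: mult_left_le_one_le)
    qed
    have "AE x in lborel. \<forall>j. x $ j \<noteq> l $ j \<and> x $ j \<noteq> u $ j"
    proof (subst AE_all_countable, intro allI)
      fix j :: 'm
      have "axis j 1 \<in> (Basis :: (real ^ 'm) set)" by (simp add: axis_in_Basis_iff)
      from AE_lborel_inner_neq[OF this, of "l $ j"] AE_lborel_inner_neq[OF this, of "u $ j"]
      show "AE x in lborel. x $ j \<noteq> l $ j \<and> x $ j \<noteq> u $ j" by (simp add: inner_axis)
    qed
    then show "AE x in lborel. (\<lambda>n. of_real (exp (- p n x)) * (gaussian x * cnj (h x)))
        \<longlonglongrightarrow> indicator (box l u) x *\<^sub>R (gaussian x * cnj (h x))"
    proof eventually_elim
      case (elim x)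
      have "(\<lambda>n. exp (- p n x)) \<longlonglongrightarrow> indicator (box l u) x"
      proof (cases "x \<in> box l u")
        case in_box: True
        have "(\<lambda>n. y x j ^ (2 * n)) \<longlonglongrightarrow> 0" for j
        proof -
          have "l $ j < x $ j" "x $ j < u $ j" using in_box by (auto simp: mem_box_cart)
          then have "\<bar>2 * x $ j - (l $ j + u $ j)\<bar> < u $ j - l $ j" by arith
          then have "\<bar>y x j\<bar> < 1" unfolding y_abs using True[rule_format, of j] by (simp add: pos_divide_less_eq)
          then have "\<bar>(y x j)\<^sup>2\<bar> < 1" by (simp add: abs_square_less_1)
          then show ?thesis unfolding power_mult by (rule LIMSEQ_abs_realpow_zero2)
        qed
        then have "(\<lambda>n. p n x) \<longlonglongrightarrow> (\<Sum>j\<in>(UNIV::'m set). 0)" unfolding p_def by (intro tendsto_sum)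
        then have "(\<lambda>n. exp (- p n x)) \<longlonglongrightarrow> exp (- 0)" by (intro tendsto_intros) simp
        then show ?thesis using in_box by simp
      next
        case not_box: False
        then obtain j where j: "x $ j < l $ j \<or> u $ j < x $ j"
          using elim by (auto simp: mem_box_cart not_less) (metis order_le_neq_trans)+
        have "u $ j - l $ j < \<bar>2 * x $ j - (l $ j + u $ j)\<bar>" using j True[rule_format, of j] by arith
        then have "1 < \<bar>y x j\<bar>" unfolding y_abs using True[rule_format, of j] by (simp add: pos_less_divide_eq)
        then have "1 < (y x j)\<^sup>2" by (metis one_less_power power2_abs zero_less_numeral)
        have lim: "(\<lambda>n. inverse ((y x j)\<^sup>2) ^ n) \<longlonglongrightarrow> 0"
          using \<open>1 < (y x j)\<^sup>2\<close> by (intro LIMSEQ_realpow_zero) (auto intro: inverse_less_1_iff[THEN iffD2])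
        have "exp (- p n x) \<le> inverse ((y x j)\<^sup>2) ^ n" for n
        proof -
          have "(y x j)\<^sup>2 ^ n \<le> p n x"
            unfolding p_def power_mult[symmetric] by (rule member_le_sum) (auto simp: power_mult)
          also have "\<dots> \<le> exp (p n x)" using exp_ge_add_one_self[of "p n x"] by linarith
          finally have "(y x j)\<^sup>2 ^ n \<le> exp (p n x)" .
          moreover have "0 < (y x j)\<^sup>2 ^ n" using \<open>1 < (y x j)\<^sup>2\<close> by - (rule zero_less_power, linarith)
          ultimately show ?thesis unfolding exp_minus power_inverse by (rule le_imp_inverse_le)
        qed
        then have "(\<lambda>n. exp (- p n x)) \<longlonglongrightarrow> 0"
          by (intro tendsto_sandwich[OF _ _ tendsto_const lim]) auto
        then show ?thesis using not_box by simp
      qed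
      from tendsto_mult[OF tendsto_of_real[OF this] tendsto_const]
      show ?case by (simp add: scaleR_conv_of_real)
    qed
  qed measurable
  ultimately show ?thesis by (simp add: LIMSEQ_const_iff)
qed

text \<open>Boxes form an intersection-stable generator of the Borel sets, so the integral of
  \<open>gaussian \<cdot> h\<^sup>*\<close> vanishes on every Borel set.\<close>

lemma schwartz_orthogonal_imp_zero:
  fixes h :: "real ^ 'm::finite \<Rightarrow> complex"
  assumes h: "h \<in> L2" and orth: "\<And>\<phi>. \<phi> \<in> schwartz \<Longrightarrow> L2_inner \<phi> h = 0"
  shows "ae_eq h (\<lambda>_. 0)"
proof -
  let ?q = "\<lambda>x. gaussian x * cnj (h x)"
  have int: "integrable lborel ?q"
    by (intro L2_integrable_inner h schwartz_L2 gaussian_schwartz)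
  have sint: "set_integrable lborel A ?q" if "A \<in> sets borel" for A
    using int that unfolding set_integrable_def by (intro integrable_mult_indicator) auto
  have "AE x in lborel. ?q x = 0"
  proof (rule sigma_finite_measure.density_zero[OF sigma_finite_lborel])
    fix A :: "(real ^ 'm) set" assume "A \<in> sets lborel"
    then have A: "A \<in> sigma_sets UNIV (range (\<lambda>(a, b). box a b))" by (simp add: borel_eq_box)
    have "Int_stable (range (\<lambda>(a, b). box a b :: (real ^ 'm) set))"
      by (auto simp: Int_stable_def box_Int_box)
    moreover have "range (\<lambda>(a, b). box a b) \<subseteq> Pow (UNIV :: (real ^ 'm) set)" by simp
    moreover note A
    ultimately show "(LINT x:A|lborel. ?q x) = 0"
    proof (induction rule: sigma_sets_induct_disjoint)
      case (basic A)
      then show ?case using box_integral_eq_0[OF h orth] by auto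
    next
      case empty
      then show ?case by (simp add: set_lebesgue_integral_def)
    next
      case (compl A)
      then have A: "A \<in> sets borel" by (simp add: borel_eq_box)
      have "(LINT x:A \<union> (UNIV - A)|lborel. ?q x) = (LINT x:A|lborel. ?q x) + (LINT x:UNIV - A|lborel. ?q x)"
        by (rule set_integral_Un) (auto intro!: sint A)
      moreover have "(LINT x:UNIV|lborel. ?q x) = 0"
        using orth[OF gaussian_schwartz] by (simp add: set_lebesgue_integral_def L2_inner_def)
      ultimately show ?case using compl by (simp add: Un_Diff_cancel)
    next
      case (union F)
      then have F: "F i \<in> sets borel" for i by (auto simp: borel_eq_box)
      have "(LINT x:(\<Union>i. F i)|lborel. ?q x) = (\<Sum>i. LINT x:F i|lborel. ?q x)"
        by (rule lebesgue_integral_countable_add) (use F union(1) in \<open>auto intro!: sint simp: disjoint_family_on_def\<close>)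
      then show ?case using union by simp
    qed
  qed (rule int)
  then show ?thesis unfolding ae_eq_def by eventually_elim (simp add: gaussian_nonzero)
qed

section \<open>Fourier inversion up to a constant\<close>

lemma partial_deriv_translation:
  assumes "p \<in> schwartz"
  shows "partial_deriv j (translation a p) = translation a (partial_deriv j p)"
  using partial_deriv_eqI[OF has_derivative_translate[OF schwartz_differentiable[OF assms, unfolded frechet_derivative_works]]]
  by (auto simp: partial_deriv_def translation_def)

lemma partial_deriv_modulation:
  assumes "p \<in> schwartz"
  shows "partial_deriv j (modulation \<xi> p) t = modulation \<xi> (partial_deriv j p) t + 2 * pi * \<i> * (\<xi> $ j) * modulation \<xi> p t"
  unfolding modulation_def
  using partial_deriv_eqI[OF has_derivative_mult[OF has_derivative_cis_inner[of \<xi>]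
      schwartz_differentiable[OF assms, unfolded frechet_derivative_works]]]
  by (auto simp: partial_deriv_def inner_axis algebra_simps)

lemma schwartz_modulation: "p \<in> schwartz \<Longrightarrow> modulation \<xi> p \<in> schwartz"
  unfolding modulation_def by (rule schwartz_modulate)

lemma schwartz_translation: "p \<in> schwartz \<Longrightarrow> translation a p \<in> schwartz"
  unfolding translation_def by (rule schwartz_translate)

lemma partial_deriv_tf_shift:
  assumes "p \<in> schwartz"
  shows "partial_deriv j (tf_shift z p) t = tf_shift z (partial_deriv j p) t + 2 * pi * \<i> * (snd_part z $ j) * tf_shift z p t"
  unfolding tf_shift_def
  by (simp add: partial_deriv_modulation[OF schwartz_translation[OF assms]] partial_deriv_translation[OF assms])

text \<open>Rapid decrease of Fourier-type integrals is obtained for a whole class at once: multiplying by a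
  coordinate stays in the class, because it amounts to differentiating, or multiplying by a
  coordinate, one of the Schwartz functions that enter the integral.\<close>

lemma rapidly_decreasing_by_coordinates:
  fixes X :: "(real ^ 'k::finite \<Rightarrow> complex) set"
  assumes bounded: "\<And>f. f \<in> X \<Longrightarrow> \<exists>B. \<forall>x. cmod (f x) \<le> B"
    and step: "\<And>f j. f \<in> X \<Longrightarrow> \<exists>g\<in>X. \<exists>h\<in>X. \<forall>x. \<bar>x $ j\<bar> * cmod (f x) \<le> cmod (g x) + cmod (h x)"
    and f: "f \<in> X"
  shows "rapidly_decreasing f"
proof -
  have "\<exists>B. \<forall>x. norm x ^ k * cmod (f x) \<le> B" for k
    using f
  proof (induction k arbitrary: f)
    case 0
    then show ?case using bounded by simp
  next
    case (Suc k)
    have "\<exists>B. \<forall>x. \<bar>x $ j\<bar> * (norm x ^ k * cmod (f x)) \<le> B" for j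
    proof -
      obtain g h where gh: "g \<in> X" "h \<in> X" "\<And>x. \<bar>x $ j\<bar> * cmod (f x) \<le> cmod (g x) + cmod (h x)"
        using step[OF Suc.prems] by metis
      obtain B C where BC: "\<And>x. norm x ^ k * cmod (g x) \<le> B" "\<And>x. norm x ^ k * cmod (h x) \<le> C"
        using Suc.IH gh(1,2) by metis
      have "\<bar>x $ j\<bar> * (norm x ^ k * cmod (f x)) \<le> B + C" for x
      proof -
        have "norm x ^ k * (\<bar>x $ j\<bar> * cmod (f x)) \<le> norm x ^ k * (cmod (g x) + cmod (h x))"
          by (intro mult_left_mono gh(3)) auto
        with BC[of x] show ?thesis by (simp add: algebra_simps)
      qed
      then show ?thesis by blast
    qed
    then obtain B where B: "\<And>j x. \<bar>x $ j\<bar> * (norm x ^ k * cmod (f x)) \<le> B j" by metis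
    have "norm x ^ Suc k * cmod (f x) \<le> (\<Sum>j\<in>UNIV. B j)" for x
    proof -
      have "norm x * (norm x ^ k * cmod (f x)) \<le> (\<Sum>j\<in>UNIV. \<bar>x $ j\<bar>) * (norm x ^ k * cmod (f x))"
        by (intro mult_right_mono norm_le_l1_cart) auto
      also have "\<dots> \<le> (\<Sum>j\<in>UNIV. B j)" unfolding sum_distrib_right by (intro sum_mono B)
      finally show ?thesis by (simp add: mult.assoc)
    qed
    then show ?case by blast
  qed
  then show ?thesis by (simp add: rapidly_decreasing_def)
qed

definition fourier :: "(real ^ 'm::finite \<Rightarrow> complex) \<Rightarrow> real ^ 'm \<Rightarrow> complex" where
  "fourier p \<xi> = (LINT t|lborel. modulation (- \<xi>) p t)"

lemma fourier_partial_deriv: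
  assumes p: "p \<in> schwartz"
  shows "fourier (partial_deriv j p) \<xi> = 2 * pi * \<i> * (\<xi> $ j) * fourier p \<xi>"
proof -
  note int = schwartz_integrable[OF schwartz_modulation[OF p, of "- \<xi>"]]
    schwartz_integrable[OF schwartz_modulation[OF schwartz_partial_deriv[OF p], of "- \<xi>" j]]
  have "0 = (LINT t|lborel. partial_deriv j (modulation (- \<xi>) p) t)"
    using integral_partial_deriv_eq_0[OF schwartz_modulation[OF p]] by simp
  also have "\<dots> = fourier (partial_deriv j p) \<xi> - 2 * pi * \<i> * (\<xi> $ j) * fourier p \<xi>"
    unfolding partial_deriv_modulation[OF p] fourier_def using int by simp
  finally show ?thesis by simp
qed

lemma fourier_bound: "cmod (fourier p \<xi>) \<le> (LINT t|lborel. cmod (p t))"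
proof -
  have "cmod (fourier p \<xi>) \<le> (LINT t|lborel. cmod (modulation (- \<xi>) p t))"
    unfolding fourier_def by (rule integral_norm_bound)
  then show ?thesis by (simp add: modulation_def norm_mult)
qed

lemma fourier_rapidly_decreasing:
  assumes "p \<in> schwartz" shows "rapidly_decreasing (fourier p)"
proof (rule rapidly_decreasing_by_coordinates[of "fourier ` schwartz"])
  fix f :: "real ^ 'a \<Rightarrow> complex" and j assume "f \<in> fourier ` schwartz"
  then obtain p where p: "p \<in> schwartz" "f = fourier p" by blast
  have "\<bar>x $ j\<bar> * cmod (f x) \<le> cmod (fourier (partial_deriv j p) x) + cmod (fourier (partial_deriv j p) x)" for x
  proof -
    have "1 * (\<bar>x $ j\<bar> * cmod (f x)) \<le> 2 * pi * (\<bar>x $ j\<bar> * cmod (f x))"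
      using pi_ge_two by (intro mult_right_mono) auto
    also have "\<dots> = cmod (fourier (partial_deriv j p) x)"
      by (simp add: fourier_partial_deriv[OF p(1)] norm_mult p(2))
    finally show ?thesis using norm_ge_zero[of "fourier (partial_deriv j p) x"] by linarith
  qed
  then show "\<exists>g\<in>fourier ` schwartz. \<exists>h\<in>fourier ` schwartz. \<forall>x. \<bar>x $ j\<bar> * cmod (f x) \<le> cmod (g x) + cmod (h x)"
    using schwartz_partial_deriv[OF p(1), of j] by blast
qed (use assms fourier_bound in blast)+

lemma fourier_measurable:
  assumes [measurable]: "p \<in> borel_measurable borel" shows "fourier p \<in> borel_measurable borel"
  unfolding fourier_def[abs_def] modulation_def by measurable

lemma fourier_integrable: "p \<in> schwartz \<Longrightarrow> integrable lborel (fourier p)"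
  by (intro rapidly_decreasing_integrable fourier_rapidly_decreasing fourier_measurable schwartz_measurable)

text \<open>Fubini, because the kernel is symmetric in \<open>t\<close> and \<open>\<xi>\<close>.\<close>

lemma fourier_multiplication:
  assumes p: "integrable lborel p" and q: "integrable lborel q"
  shows "(LINT \<xi>|lborel. fourier p \<xi> * q \<xi>) = (LINT t|lborel. p t * fourier q t)"
proof -
  have [measurable]: "p \<in> borel_measurable borel" "q \<in> borel_measurable borel"
    using p q by (auto dest: borel_measurable_integrable)
  have int: "integrable (lborel \<Otimes>\<^sub>M lborel) (\<lambda>(t, \<xi>). cis (2 * pi * (- \<xi> \<bullet> t)) * p t * q \<xi>)"
    by (rule Bochner_Integration.integrable_bound[OF integrable_lborel_product[OF p q]])
       (auto simp: norm_mult)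
  have "(LINT \<xi>|lborel. fourier p \<xi> * q \<xi>) = (LINT \<xi>|lborel. LINT t|lborel. cis (2 * pi * (- \<xi> \<bullet> t)) * p t * q \<xi>)"
    by (simp add: fourier_def modulation_def)
  also have "\<dots> = (LINT t|lborel. LINT \<xi>|lborel. cis (2 * pi * (- \<xi> \<bullet> t)) * p t * q \<xi>)"
    by (rule lborel_pair.Fubini_integral[OF int])
  also have "\<dots> = (LINT t|lborel. LINT \<xi>|lborel. p t * (cis (2 * pi * (- t \<bullet> \<xi>)) * q \<xi>))"
    by (simp add: inner_commute mult_ac)
  also have "\<dots> = (LINT t|lborel. p t * fourier q t)"
    by (simp add: fourier_def modulation_def)
  finally show ?thesis .
qed

lemma lborel_integrable_scale:
  fixes f :: "'a::euclidean_space \<Rightarrow> complex"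
  assumes "c \<noteq> 0" and f: "integrable lborel f"
  shows "integrable lborel (\<lambda>x. f (c *\<^sub>R x))"
proof -
  have [measurable]: "f \<in> borel_measurable borel" using f by (auto dest: borel_measurable_integrable)
  have "integrable (density (distr lborel borel (\<lambda>x. 0 + c *\<^sub>R x)) (\<lambda>_. ennreal (\<bar>c\<bar> ^ DIM('a)))) f"
    using f by (subst (asm) lborel_affine[OF assms(1), of 0]) (simp add: ennreal_power)
  then have "integrable lborel (\<lambda>x. \<bar>c\<bar> ^ DIM('a) *\<^sub>R f (c *\<^sub>R x))"
    by (subst (asm) integrable_density) (auto simp: integrable_distr_eq)
  then have "integrable lborel (\<lambda>x. inverse (\<bar>c\<bar> ^ DIM('a)) *\<^sub>R (\<bar>c\<bar> ^ DIM('a) *\<^sub>R f (c *\<^sub>R x)))"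
    by (rule integrable_scaleR_right)
  then show ?thesis using assms(1) by simp
qed

text \<open>The Fourier transform of \<open>q(\<epsilon> \<cdot>)\<close> is \<open>|\<epsilon>|\<^sup>-\<^sup>d q\<^sup>^(\<cdot> / \<epsilon>)\<close>, and substituting \<open>t = \<epsilon> s\<close> in the multiplication
  formula cancels the factor.\<close>

lemma fourier_dilation_identity:
  fixes p q :: "real ^ 'm::finite \<Rightarrow> complex"
  assumes p: "p \<in> schwartz" and q: "q \<in> schwartz" and "\<epsilon> \<noteq> 0"
  shows "(LINT \<xi>|lborel. fourier p \<xi> * q (\<epsilon> *\<^sub>R \<xi>)) = (LINT s|lborel. p (\<epsilon> *\<^sub>R s) * fourier q s)"
proof -
  let ?q = "\<lambda>\<xi>. q (\<epsilon> *\<^sub>R \<xi>)" and ?c = "\<bar>\<epsilon>\<bar> ^ DIM(real ^ 'm)"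
  note [measurable] = schwartz_measurable[OF p] schwartz_measurable[OF q]
  have [measurable]: "fourier ?q \<in> borel_measurable borel" by (intro fourier_measurable) measurable
  have *: "?c *\<^sub>R fourier ?q (\<epsilon> *\<^sub>R s) = fourier q s" for s
    using lborel_integral_scale[OF \<open>\<epsilon> \<noteq> 0\<close>, of "\<lambda>t. modulation (- s) q t"]
    by (simp add: fourier_def modulation_def inner_scaleR_right)
  have "(LINT \<xi>|lborel. fourier p \<xi> * ?q \<xi>) = (LINT t|lborel. p t * fourier ?q t)"
    by (intro fourier_multiplication schwartz_integrable p lborel_integrable_scale q \<open>\<epsilon> \<noteq> 0\<close>)
  also have "\<dots> = ?c *\<^sub>R (LINT s|lborel. p (\<epsilon> *\<^sub>R s) * fourier ?q (\<epsilon> *\<^sub>R s))"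
    by (rule lborel_integral_scale[OF \<open>\<epsilon> \<noteq> 0\<close>]) measurable
  also have "\<dots> = (LINT s|lborel. p (\<epsilon> *\<^sub>R s) * (?c *\<^sub>R fourier ?q (\<epsilon> *\<^sub>R s)))"
    by (simp add: integral_scaleR_right[symmetric] del: integral_scaleR_right)
  also have "\<dots> = (LINT s|lborel. p (\<epsilon> *\<^sub>R s) * fourier q s)" unfolding * ..
  finally show ?thesis .
qed

lemma dilation_limit:
  fixes p f :: "real ^ 'm::finite \<Rightarrow> complex"
  assumes p: "p \<in> schwartz" and f: "integrable lborel f"
  shows "(\<lambda>n. LINT s|lborel. p (inverse (real (Suc n)) *\<^sub>R s) * f s) \<longlonglongrightarrow> p 0 * integral\<^sup>L lborel f"
proof -
  note [measurable] = schwartz_measurable[OF p]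
  have [measurable]: "f \<in> borel_measurable borel" using f by (auto dest: borel_measurable_integrable)
  obtain B where B: "\<And>x. cmod (p x) \<le> B" using schwartz_bounded[OF p] by blast
  have "(\<lambda>n. LINT s|lborel. p (inverse (real (Suc n)) *\<^sub>R s) * f s) \<longlonglongrightarrow> (LINT s|lborel. p 0 * f s)"
  proof (rule integral_dominated_convergence)
    show "integrable lborel (\<lambda>s. B * cmod (f s))" using f by simp
    show "AE s in lborel. (\<lambda>n. p (inverse (real (Suc n)) *\<^sub>R s) * f s) \<longlonglongrightarrow> p 0 * f s"
    proof (intro AE_I2 tendsto_mult tendsto_const)
      fix s :: "real ^ 'm"
      have "(\<lambda>n. inverse (real (Suc n)) *\<^sub>R s) \<longlonglongrightarrow> 0 *\<^sub>R s"
        by (intro tendsto_scaleR LIMSEQ_inverse_real_of_nat tendsto_const)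
      then show "(\<lambda>n. p (inverse (real (Suc n)) *\<^sub>R s)) \<longlonglongrightarrow> p 0"
        using schwartz_continuous[OF p] by (simp add: continuous_on_eq_continuous_at isCont_tendsto_compose[of 0 p])
    qed
    show "AE s in lborel. norm (p (inverse (real (Suc n)) *\<^sub>R s) * f s) \<le> B * cmod (f s)" for n
      by (auto simp: norm_mult intro!: mult_right_mono B)
  qed measurable
  then show ?thesis by simp
qed

text \<open>The factor \<open>C\<close> in \<open>\<integral> p\<^sup>^ = C p 0\<close>, read off from the Gaussian, whose value at \<open>0\<close> is \<open>1\<close>.\<close>

definition inversion_constant :: "'m::finite itself \<Rightarrow> complex" where
  "inversion_constant _ = integral\<^sup>L lborel (fourier (gaussian :: real ^ 'm \<Rightarrow> complex))"

text \<open>Letting \<open>\<epsilon> \<rightarrow> 0\<close> in the dilation identity shows that the quotient of \<open>\<integral> p\<^sup>^\<close> and \<open>p 0\<close> is the same number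
  for all Schwartz functions \<open>p\<close>.\<close>

lemma integral_fourier:
  assumes p: "p \<in> schwartz"
  shows "integral\<^sup>L lborel (fourier p) = inversion_constant TYPE('m) * p (0 :: real ^ 'm::finite)"
proof -
  let ?e = "\<lambda>n. inverse (real (Suc n))"
  have "(\<lambda>n. LINT \<xi>|lborel. gaussian (?e n *\<^sub>R \<xi>) * fourier p \<xi>) \<longlonglongrightarrow> gaussian (0 :: real ^ 'm) * integral\<^sup>L lborel (fourier p)"
    by (rule dilation_limit[OF gaussian_schwartz fourier_integrable[OF p]])
  moreover have "(\<lambda>n. LINT s|lborel. p (?e n *\<^sub>R s) * fourier gaussian s) \<longlonglongrightarrow> p 0 * inversion_constant TYPE('m)"
    unfolding inversion_constant_def by (rule dilation_limit[OF p fourier_integrable[OF gaussian_schwartz]])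
  moreover have "(LINT \<xi>|lborel. gaussian (?e n *\<^sub>R \<xi>) * fourier p \<xi>) = (LINT s|lborel. p (?e n *\<^sub>R s) * fourier gaussian s)" for n
    using fourier_dilation_identity[OF p gaussian_schwartz, of "?e n"] by (simp add: mult.commute)
  ultimately have "gaussian (0 :: real ^ 'm) * integral\<^sup>L lborel (fourier p) = p 0 * inversion_constant TYPE('m)"
    using LIMSEQ_unique by fastforce
  then show ?thesis by (simp add: gaussian_def mult.commute)
qed

text \<open>This is the previous formula for the translate \<open>p(\<cdot> + t)\<close>.\<close>

lemma fourier_inversion:
  fixes p :: "real ^ 'm::finite \<Rightarrow> complex"
  assumes p: "p \<in> schwartz"
  shows "(LINT \<xi>|lborel. cis (2 * pi * (\<xi> \<bullet> t)) * fourier p \<xi>) = inversion_constant TYPE('m) * p t"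
proof -
  note [measurable] = schwartz_measurable[OF p]
  have "fourier (translation (- t) p) = (\<lambda>\<xi>. cis (2 * pi * (\<xi> \<bullet> t)) * fourier p \<xi>)"
  proof
    fix \<xi>
    have "fourier (translation (- t) p) \<xi> = (LINT s|lborel. cis (2 * pi * (- \<xi> \<bullet> (s - (- t) - t))) * p (s - (- t)))"
      by (simp add: fourier_def modulation_def translation_def)
    also have "\<dots> = (LINT s|lborel. cis (2 * pi * (- \<xi> \<bullet> (s - t))) * p s)"
      by (rule lborel_integral_translate) measurable
    also have "\<dots> = (LINT s|lborel. cis (2 * pi * (\<xi> \<bullet> t)) * (cis (2 * pi * (- \<xi> \<bullet> s)) * p s))"
    proof -
      have "2 * pi * (- \<xi> \<bullet> (s - t)) = 2 * pi * (\<xi> \<bullet> t) + 2 * pi * (- \<xi> \<bullet> s)" for s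
        by (simp add: inner_diff_right right_diff_distrib)
      then show ?thesis by (simp only: cis_mult[symmetric] mult.assoc)
    qed
    also have "\<dots> = cis (2 * pi * (\<xi> \<bullet> t)) * fourier p \<xi>"
      by (simp add: fourier_def modulation_def)
    finally show "fourier (translation (- t) p) \<xi> = cis (2 * pi * (\<xi> \<bullet> t)) * fourier p \<xi>" .
  qed
  then show ?thesis
    using integral_fourier[OF schwartz_translation[OF p, of "- t"]] by (simp only: translation_def) simp
qed

section \<open>The short-time Fourier transform\<close>

lemma stft_fourier: "stft g f (join_parts (x, \<xi>)) = fourier (\<lambda>t. f t * cnj (g (t - x))) \<xi>"
  by (simp add: stft_def L2_inner_def fourier_def tf_shift_def modulation_def translation_def cis_cnj mult_ac)

text \<open>With \<open>z = (x, \<xi>)\<close>, the factor \<open>x\<^sub>j = t\<^sub>j - (t - x)\<^sub>j\<close> is distributed to \<open>f\<close> and \<open>g\<close>, and \<open>2 \<pi> i \<xi>\<^sub>j\<close> becomes a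
  derivative of \<open>f\<close> or \<open>g\<close> through integration by parts.\<close>

lemma stft_rapidly_decreasing:
  assumes "f \<in> schwartz" "g \<in> schwartz" shows "rapidly_decreasing (stft g f)"
proof (rule rapidly_decreasing_by_coordinates[of "{stft g f | f g. f \<in> schwartz \<and> g \<in> schwartz}"])
  let ?X = "{stft g f | f g. f \<in> schwartz \<and> g \<in> (schwartz :: (real ^ 'a \<Rightarrow> complex) set)}"
  show "stft g f \<in> ?X" using assms by blast
  fix v assume "v \<in> ?X"
  then obtain f g where v: "v = stft g f" and f: "f \<in> schwartz" and g: "g \<in> schwartz" by blast
  note int = L2_integrable_inner[OF schwartz_L2 L2_tf_shift[OF schwartz_L2]]
  {
    obtain B where B: "\<And>x. cmod (g x) \<le> B" using schwartz_bounded[OF g] by blast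
    have "cmod (stft g f z) \<le> (LINT t|lborel. B * cmod (f t))" for z
    proof -
      have "cmod (stft g f z) \<le> (LINT t|lborel. cmod (f t * cnj (tf_shift z g t)))"
        unfolding stft_def L2_inner_def by (rule integral_norm_bound)
      also have "\<dots> \<le> (LINT t|lborel. B * cmod (f t))"
      proof (rule integral_mono)
        show "integrable lborel (\<lambda>t. cmod (f t * cnj (tf_shift z g t)))" using int[OF f g] by simp
        show "integrable lborel (\<lambda>t. B * cmod (f t))" using schwartz_integrable[OF f] by simp
        show "cmod (f t * cnj (tf_shift z g t)) \<le> B * cmod (f t)" for t
          using mult_left_mono[OF B[of "t - fst_part z"], of "cmod (f t)"]
          by (simp add: norm_mult tf_shift_def modulation_def translation_def mult.commute)
      qed
      finally show ?thesis .
    qed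
    then show "\<exists>B. \<forall>z. cmod (v z) \<le> B" unfolding v by blast
  next
    fix l :: "'a + 'a"
    show "\<exists>a\<in>?X. \<exists>b\<in>?X. \<forall>z. \<bar>z $ l\<bar> * cmod (v z) \<le> cmod (a z) + cmod (b z)"
    proof (cases l)
      case (Inl j)
      let ?f = "\<lambda>t. of_real (t $ j) * f t" and ?g = "\<lambda>t. of_real (t $ j) * g t"
      note S = schwartz_coordinate[OF f, of j] schwartz_coordinate[OF g, of j]
      have eq: "of_real (z $ l) * stft g f z = stft g ?f z - stft ?g f z" for z
      proof -
        have "of_real (z $ l) * (f t * cnj (tf_shift z g t)) =
            ?f t * cnj (tf_shift z g t) - f t * cnj (tf_shift z ?g t)" for t
          by (simp add: Inl fst_part_def tf_shift_def modulation_def translation_def algebra_simps)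
        then have "of_real (z $ l) * stft g f z =
            (LINT t|lborel. ?f t * cnj (tf_shift z g t) - f t * cnj (tf_shift z ?g t))"
          unfolding stft_def L2_inner_def by (subst integral_mult_right_zero[symmetric]) presburger
        also have "\<dots> = stft g ?f z - stft ?g f z"
          unfolding stft_def L2_inner_def by (intro Bochner_Integration.integral_diff int S f g)
        finally show ?thesis .
      qed
      have "\<bar>z $ l\<bar> * cmod (v z) \<le> cmod (stft g ?f z) + cmod (stft ?g f z)" for z
      proof -
        have "\<bar>z $ l\<bar> * cmod (v z) = cmod (of_real (z $ l) * stft g f z)" by (simp add: v norm_mult)
        also have "\<dots> \<le> cmod (stft g ?f z) + cmod (stft ?g f z)" unfolding eq by (rule norm_triangle_ineq4)
        finally show ?thesis .
      qed
      moreover have "stft g ?f \<in> ?X" "stft ?g f \<in> ?X" using S f g by auto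
      ultimately show ?thesis by (intro bexI[of _ "stft g ?f"] bexI[of _ "stft ?g f"]) auto
    next
      case (Inr j)
      let ?f = "partial_deriv j f" and ?g = "partial_deriv j g"
      note S = schwartz_partial_deriv[OF f, of j] schwartz_partial_deriv[OF g, of j]
      have eq: "2 * pi * \<i> * of_real (z $ l) * stft g f z = stft g ?f z + stft ?g f z" for z
      proof -
        have zl: "snd_part z $ j = z $ l" by (simp add: Inr snd_part_def)
        let ?G = "tf_shift z g"
        have G: "?G \<in> schwartz" by (intro schwartz_tf_shift g)
        let ?u = "\<lambda>t. f t * cnj (?G t)"
        have u: "?u \<in> schwartz" by (intro schwartz_mult schwartz_cnj f G)
        have "partial_deriv j ?u t = f t * cnj (partial_deriv j ?G t) + ?f t * cnj (?G t)" for t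
          using partial_deriv_eqI[OF has_derivative_mult[OF schwartz_differentiable[OF f, unfolded frechet_derivative_works]
              bounded_linear.has_derivative[OF bounded_linear_cnj schwartz_differentiable[OF G, unfolded frechet_derivative_works]]]]
          by (simp add: partial_deriv_def)
        then have du: "partial_deriv j ?u t = f t * cnj (tf_shift z ?g t) + ?f t * cnj (?G t)
             - 2 * pi * \<i> * of_real (z $ l) * (f t * cnj (?G t))" for t
          unfolding partial_deriv_tf_shift[OF g] zl by (simp add: algebra_simps)
        have "0 = (LINT t|lborel. partial_deriv j ?u t)" using integral_partial_deriv_eq_0[OF u] by simp
        also have "\<dots> = stft ?g f z + stft g ?f z - 2 * pi * \<i> * of_real (z $ l) * stft g f z"
          unfolding du stft_def L2_inner_def using int[OF f S(2)] int[OF S(1) g] int[OF f g] by simp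
        finally show ?thesis by (simp add: add.commute)
      qed
      have "\<bar>z $ l\<bar> * cmod (v z) \<le> cmod (stft g ?f z) + cmod (stft ?g f z)" for z
      proof -
        have "1 * (\<bar>z $ l\<bar> * cmod (v z)) \<le> 2 * pi * (\<bar>z $ l\<bar> * cmod (v z))"
          using pi_ge_two by (intro mult_right_mono) auto
        also have "\<dots> = cmod (2 * pi * \<i> * of_real (z $ l) * stft g f z)" by (simp add: v norm_mult)
        also have "\<dots> \<le> cmod (stft g ?f z) + cmod (stft ?g f z)" unfolding eq by (rule norm_triangle_ineq)
        finally show ?thesis by simp
      qed
      moreover have "stft g ?f \<in> ?X" "stft ?g f \<in> ?X" using S f g by auto
      ultimately show ?thesis by (intro bexI[of _ "stft g ?f"] bexI[of _ "stft ?g f"]) auto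
    qed
  }
qed

lemma stft_continuous:
  assumes f: "f \<in> schwartz" and g: "g \<in> schwartz"
  shows "continuous_on UNIV (stft g f)"
  unfolding continuous_on_sequentially
proof (intro allI ballI impI)
  fix Z and z :: "real ^ ('a + 'a)" assume "(\<forall>n. Z n \<in> UNIV) \<and> Z \<longlonglongrightarrow> z"
  then have Z: "Z \<longlonglongrightarrow> z" by blast
  obtain B where B: "\<And>x. cmod (g x) \<le> B" using schwartz_bounded[OF g] by blast
  have "(\<lambda>n. LINT t|lborel. f t * cnj (tf_shift (Z n) g t)) \<longlonglongrightarrow> (LINT t|lborel. f t * cnj (tf_shift z g t))"
  proof (rule integral_dominated_convergence)
    show "integrable lborel (\<lambda>t. B * cmod (f t))" using schwartz_integrable[OF f] by simp
    show "AE t in lborel. norm (f t * cnj (tf_shift (Z n) g t)) \<le> B * cmod (f t)" for n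
      using mult_right_mono[OF B norm_ge_zero] by (auto simp: norm_mult tf_shift_def modulation_def translation_def mult.commute)
    show "AE t in lborel. (\<lambda>n. f t * cnj (tf_shift (Z n) g t)) \<longlonglongrightarrow> f t * cnj (tf_shift z g t)"
    proof (intro AE_I2)
      fix t
      have P: "(\<lambda>n. fst_part (Z n)) \<longlonglongrightarrow> fst_part z" "(\<lambda>n. snd_part (Z n)) \<longlonglongrightarrow> snd_part z"
        by (intro bounded_linear.tendsto[OF bounded_linear_fst_part] bounded_linear.tendsto[OF bounded_linear_snd_part] Z)+
      have "(\<lambda>n. g (t - fst_part (Z n))) \<longlonglongrightarrow> g (t - fst_part z)"
        using schwartz_continuous[OF g] P
        by (intro isCont_tendsto_compose[of _ g]) (auto simp: continuous_on_eq_continuous_at intro!: tendsto_intros)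
      moreover have "(\<lambda>n. cis (2 * pi * (snd_part (Z n) \<bullet> t))) \<longlonglongrightarrow> cis (2 * pi * (snd_part z \<bullet> t))"
        by (intro tendsto_intros) (rule P(2))
      ultimately show "(\<lambda>n. f t * cnj (tf_shift (Z n) g t)) \<longlonglongrightarrow> f t * cnj (tf_shift z g t)"
        unfolding tf_shift_def modulation_def translation_def by (intro tendsto_mult tendsto_const tendsto_cnj)
    qed
  qed (use f g in \<open>auto intro!: schwartz_measurable schwartz_mult schwartz_cnj schwartz_tf_shift\<close>)
  then show "(stft g f \<circ> Z) \<longlonglongrightarrow> stft g f z" by (simp add: o_def stft_def L2_inner_def)
qed

lemma stft_integrable: "f \<in> schwartz \<Longrightarrow> g \<in> schwartz \<Longrightarrow> integrable lborel (stft g f)"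
  by (intro rapidly_decreasing_integrable stft_rapidly_decreasing borel_measurable_continuous_onI stft_continuous)


lemma integral_pair:
  fixes F :: "'a::euclidean_space \<Rightarrow> 'b::euclidean_space \<Rightarrow> complex"
  assumes "integrable (lborel \<Otimes>\<^sub>M lborel) (\<lambda>(x, y). F x y)"
  shows "integral\<^sup>L (lborel \<Otimes>\<^sub>M lborel) (\<lambda>(x, y). F x y) = (LINT x|lborel. LINT y|lborel. F x y)"
  using lborel_pair.integral_fst'[OF assms] by simp

text \<open>The point of this bound is that it is uniform in \<open>z\<close>.\<close>

lemma tf_shift_pairing_bound:
  assumes \<psi>: "\<psi> \<in> L2" and g: "g \<in> L2"
  shows "(LINT t|lborel. cmod (tf_shift z \<psi> t * cnj (g t))) \<le>
    (LINT t|lborel. (cmod (\<psi> t))\<^sup>2) + (LINT t|lborel. (cmod (g t))\<^sup>2)" (is "_ \<le> ?K")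
proof -
  note [measurable] = L2_measurable[OF \<psi>] L2_measurable[OF g]
  have "(LINT t|lborel. cmod (tf_shift z \<psi> t * cnj (g t))) \<le> (LINT t|lborel. (cmod (\<psi> (t - fst_part z)))\<^sup>2 + (cmod (g t))\<^sup>2)"
  proof (rule integral_mono)
    show "integrable lborel (\<lambda>t. cmod (tf_shift z \<psi> t * cnj (g t)))"
      using L2_integrable_inner[OF L2_tf_shift[OF \<psi>] g] by simp
    show "integrable lborel (\<lambda>t. (cmod (\<psi> (t - fst_part z)))\<^sup>2 + (cmod (g t))\<^sup>2)"
      using L2_translation[OF \<psi>, of "fst_part z"] g by (simp add: L2_def translation_def)
    show "cmod (tf_shift z \<psi> t * cnj (g t)) \<le> (cmod (\<psi> (t - fst_part z)))\<^sup>2 + (cmod (g t))\<^sup>2" for t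
      using mult_le_sum_power2[of "cmod (\<psi> (t - fst_part z))" "cmod (g t)"]
      by (simp add: tf_shift_def modulation_def translation_def norm_mult)
  qed
  also have "\<dots> = ?K"
    using L2_translation[OF \<psi>, of "fst_part z"] g
      lborel_integral_translate[of "\<lambda>t. (cmod (\<psi> t))\<^sup>2" "fst_part z"]
    by (simp add: L2_def translation_def)
  finally show ?thesis .
qed

text \<open>The orthogonality relations of the short-time Fourier transform, also known as Moyal's identity.
  For fixed \<open>x\<close>, the integral over \<open>\<xi>\<close> is evaluated by Fourier inversion of the Schwartz function
  \<open>F1 \<cdot> F2(\<cdot> - x)\<^sup>*\<close>, which leaves \<open>\<psi>\<close> and \<open>g\<close> arbitrary in \<open>L\<^sup>2\<close>. This generality matters: in the application
  they are preimages under a unitary operator, about which nothing else is known.\<close>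

lemma stft_orthogonality:
  fixes F1 F2 \<psi> g :: "real ^ 'm::finite \<Rightarrow> complex"
  assumes F1: "F1 \<in> schwartz" and F2: "F2 \<in> schwartz" and \<psi>: "\<psi> \<in> L2" and g: "g \<in> L2"
  shows "(LINT z|lborel. stft F2 F1 z * L2_inner (tf_shift z \<psi>) g) =
    inversion_constant TYPE('m) * (L2_inner \<psi> F2 * L2_inner F1 g)"
proof -
  let ?V = "stft F2 F1" and ?C = "inversion_constant TYPE('m)"
  let ?I = "\<lambda>z. ?V z * L2_inner (tf_shift z \<psi>) g"
  note [measurable] = L2_measurable[OF \<psi>] L2_measurable[OF g] schwartz_measurable[OF F1] schwartz_measurable[OF F2]
  have [measurable]: "?V \<in> borel_measurable borel"
    using stft_continuous[OF F1 F2] by (rule borel_measurable_continuous_onI)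
  have [measurable]: "(\<lambda>z. L2_inner (tf_shift z \<psi>) g) \<in> borel_measurable borel"
    unfolding L2_inner_def tf_shift_def modulation_def translation_def by measurable
  define w where "w x t = \<psi> (t - x) * cnj (g t)" for x t
  define p where "p x t = F1 t * cnj (F2 (t - x))" for x t
  have w_int: "integrable lborel (w x)" for x
    using L2_integrable_inner[OF L2_translation[OF \<psi>] g] by (simp add: w_def[abs_def] translation_def)
  have p_schwartz: "p x \<in> schwartz" for x
    unfolding p_def[abs_def] by (intro schwartz_mult schwartz_cnj schwartz_translate F1 F2)
  have inner_w: "L2_inner (tf_shift (join_parts (x, \<xi>)) \<psi>) g = (LINT t|lborel. cis (2 * pi * (\<xi> \<bullet> t)) * w x t)" for x \<xi>
    by (simp add: L2_inner_def tf_shift_def modulation_def translation_def w_def mult.assoc)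
  have V_p: "?V (join_parts (x, \<xi>)) = fourier (p x) \<xi>" for x \<xi>
    by (simp add: stft_fourier p_def[abs_def])
  have I_int: "integrable lborel ?I"
  proof (rule Bochner_Integration.integrable_bound)
    let ?K = "(LINT t|lborel. (cmod (\<psi> t))\<^sup>2) + (LINT t|lborel. (cmod (g t))\<^sup>2)"
    show "integrable lborel (\<lambda>z. ?K * cmod (?V z))" using stft_integrable[OF F1 F2] by simp
    show "AE z in lborel. norm (?I z) \<le> norm (?K * cmod (?V z))"
    proof (intro AE_I2)
      fix z
      have "cmod (L2_inner (tf_shift z \<psi>) g) \<le> (LINT t|lborel. cmod (tf_shift z \<psi> t * cnj (g t)))"
        unfolding L2_inner_def by (rule integral_norm_bound)
      also have "\<dots> \<le> ?K" by (rule tf_shift_pairing_bound[OF \<psi> g])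
      finally have "cmod (L2_inner (tf_shift z \<psi>) g) \<le> ?K" .
      then have "norm (?I z) \<le> ?K * cmod (?V z)"
        by (simp add: norm_mult mult_left_mono mult.commute)
      then show "norm (?I z) \<le> norm (?K * cmod (?V z))" by simp
    qed
  qed measurable
  have xi: "(LINT \<xi>|lborel. ?I (join_parts (x, \<xi>))) = (LINT t|lborel. ?C * (w x t * p x t))" for x
  proof -
    have [measurable]: "w x \<in> borel_measurable borel" "fourier (p x) \<in> borel_measurable borel"
      using w_int[of x] fourier_integrable[OF p_schwartz] by (auto dest: borel_measurable_integrable)
    have int: "integrable (lborel \<Otimes>\<^sub>M lborel) (\<lambda>(t, \<xi>). w x t * (cis (2 * pi * (\<xi> \<bullet> t)) * fourier (p x) \<xi>))"
      by (rule Bochner_Integration.integrable_bound[OF integrable_lborel_product[OF w_int[of x] fourier_integrable[OF p_schwartz[of x]]]])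
         (auto simp: norm_mult)
    have "(LINT \<xi>|lborel. ?I (join_parts (x, \<xi>))) =
        (LINT \<xi>|lborel. LINT t|lborel. w x t * (cis (2 * pi * (\<xi> \<bullet> t)) * fourier (p x) \<xi>))"
      unfolding V_p inner_w by (simp only: integral_mult_right_zero[symmetric] mult_ac)
    also have "\<dots> = (LINT t|lborel. LINT \<xi>|lborel. w x t * (cis (2 * pi * (\<xi> \<bullet> t)) * fourier (p x) \<xi>))"
      by (rule lborel_pair.Fubini_integral[OF int])
    also have "\<dots> = (LINT t|lborel. ?C * (w x t * p x t))"
    proof -
      have "(LINT \<xi>|lborel. w x t * (cis (2 * pi * (\<xi> \<bullet> t)) * fourier (p x) \<xi>)) = ?C * (w x t * p x t)" for t
        using fourier_inversion[OF p_schwartz[of x], of t] by simp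
      then show ?thesis by (simp only:)
    qed
    finally show ?thesis .
  qed
  let ?a = "\<lambda>s. \<psi> s * cnj (F2 s)" and ?b = "\<lambda>t. F1 t * cnj (g t)"
  have a_int: "integrable lborel ?a" and b_int: "integrable lborel ?b"
    by (intro L2_integrable_inner schwartz_L2 \<psi> g F1 F2)+
  have wp: "w x t * p x t = ?b t * ?a (t - x)" for x t by (simp add: w_def p_def)
  have ab_int: "integrable (lborel \<Otimes>\<^sub>M lborel) (\<lambda>(t, x). ?b t * ?a (t - x))"
  proof (rule lborel_pair.Fubini_integrable)
    show "(\<lambda>(t, x). ?b t * ?a (t - x)) \<in> borel_measurable (lborel \<Otimes>\<^sub>M lborel)" by measurable
    have "(LINT x|lborel. norm (?b t * ?a (t - x))) = norm (?b t) * (LINT x|lborel. norm (?a x))" for t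
      using lborel_integral_reflect[of "\<lambda>x. norm (?a x)" t] by (simp add: norm_mult)
    then show "integrable lborel (\<lambda>t. LINT x|lborel. norm (case (t, x) of (t, x) \<Rightarrow> ?b t * ?a (t - x)))"
      using b_int by simp
    show "AE t in lborel. integrable lborel (\<lambda>x. case (t, x) of (t, x) \<Rightarrow> ?b t * ?a (t - x))"
      using lborel_integrable_reflect[of ?a] a_int by auto
  qed
  have "(LINT z|lborel. ?I z) = (LINT p|(lborel \<Otimes>\<^sub>M lborel). ?I (join_parts p))"
    by (rule integral_join_parts) measurable
  also have "\<dots> = (LINT x|lborel. LINT \<xi>|lborel. ?I (join_parts (x, \<xi>)))"
    using integral_pair[of "\<lambda>x \<xi>. ?I (join_parts (x, \<xi>))"] I_int integrable_join_parts[of ?I] by (simp add: case_prod_beta')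
  also have "\<dots> = (LINT x|lborel. LINT t|lborel. ?C * (?b t * ?a (t - x)))" unfolding xi wp ..
  also have "\<dots> = ?C * (LINT x|lborel. LINT t|lborel. ?b t * ?a (t - x))" by simp
  also have "(LINT x|lborel. LINT t|lborel. ?b t * ?a (t - x)) = (LINT t|lborel. LINT x|lborel. ?b t * ?a (t - x))"
    by (rule lborel_pair.Fubini_integral[OF ab_int])
  also have "\<dots> = (LINT t|lborel. ?b t * L2_inner \<psi> F2)"
    using lborel_integral_reflect[of ?a] by (simp add: L2_inner_def)
  also have "\<dots> = L2_inner \<psi> F2 * L2_inner F1 g" by (simp add: L2_inner_def)
  finally show ?thesis .
qed

text \<open>For the Gaussian \<open>G\<close>, the orthogonality relations give \<open>\<parallel>V\<^sub>G G\<parallel>\<^sup>2 = C \<parallel>G\<parallel>\<^sup>4\<close>, and \<open>V\<^sub>G G\<close> is continuous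
  with \<open>V\<^sub>G G 0 = \<parallel>G\<parallel>\<^sup>2\<close>.\<close>

lemma inversion_constant_nonzero: "inversion_constant TYPE('m::finite) \<noteq> 0"
proof
  assume C: "inversion_constant TYPE('m) = 0"
  let ?G = "gaussian :: real ^ 'm \<Rightarrow> complex"
  let ?V = "stft ?G ?G"
  have G: "?G \<in> schwartz" by (rule gaussian_schwartz)
  have "L2_inner ?V ?V = (LINT z|lborel. ?V z * L2_inner (tf_shift z ?G) ?G)"
    unfolding L2_inner_def[of ?V] stft_def by (metis L2_inner_commute)
  also have "\<dots> = 0" using stft_orthogonality[OF G G schwartz_L2[OF G] schwartz_L2[OF G]] C by simp
  finally have 0: "L2_inner ?V ?V = 0" .
  have cont: "continuous_on UNIV ?V" by (rule stft_continuous[OF G G])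
  have "rapidly_decreasing (\<lambda>z. ?V z * ?V z)"
    by (intro rapidly_decreasing_mult stft_rapidly_decreasing G)
  then have "integrable lborel (\<lambda>z. norm (?V z * ?V z))"
    using cont by (intro integrable_norm rapidly_decreasing_integrable borel_measurable_continuous_onI continuous_intros)
  then have "?V \<in> L2"
    using borel_measurable_continuous_onI[OF cont] by (simp add: L2_def norm_mult power2_eq_square)
  then have "ae_eq ?V (\<lambda>_. 0)" using 0 by (rule L2_inner_self_eq_0)
  then have "?V = (\<lambda>_. 0)" using cont by (intro continuous_ae_eq_imp_eq) auto
  then have "?V 0 = 0" by metis
  moreover have "tf_shift 0 ?G = ?G"
    by (simp add: tf_shift_def modulation_def translation_def fst_part_def snd_part_def zero_vec_def[symmetric])
  ultimately have "L2_inner ?G ?G = 0" by (simp add: stft_def)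
  then have "ae_eq ?G (\<lambda>_. 0)" by (intro L2_inner_self_eq_0 schwartz_L2 G)
  then have "?G = (\<lambda>_. 0)" by (intro continuous_ae_eq_imp_eq schwartz_continuous[OF G]) auto
  then show False using gaussian_nonzero by metis
qed

section \<open>Superpositions of time-frequency shifts\<close>

text \<open>A derivative in \<open>t\<close> falls on \<open>\<phi>\<close> or on the modulation, where it produces a frequency factor that is
  linear in \<open>w\<close> and can be absorbed into \<open>B\<close>. Hence each partial derivative is a sum of two
  superpositions of the same kind.\<close>

lemma superposition_schwartz:
  fixes B :: "'k::euclidean_space \<Rightarrow> complex" and X :: "'k \<Rightarrow> real ^ ('m::finite + 'm)"
  assumes X: "bounded_linear X"
    and B: "rapidly_decreasing B" "B \<in> borel_measurable borel" and \<phi>: "\<phi> \<in> schwartz"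
  shows "(\<lambda>t. LINT w|lborel. B w * tf_shift (X w) \<phi> t) \<in> schwartz"
proof -
  obtain K where K: "\<And>w. norm (X w) \<le> norm w * K" "0 < K" using bounded_linear.pos_bounded[OF X] by blast
  have X_meas[measurable]: "X \<in> borel_measurable borel"
    by (intro borel_measurable_continuous_onI linear_continuous_on X)
  have norm_int: "integrable lborel (\<lambda>w. norm w ^ k * cmod (B w))"
    if B: "rapidly_decreasing B" "B \<in> borel_measurable borel" for B :: "'k \<Rightarrow> complex" and k
  proof -
    have "rapidly_decreasing (\<lambda>w. of_real (norm w ^ k) * B w)"
      by (rule rapidly_decreasing_dominated[OF B(1), of _ 1 k])
         (auto simp: norm_mult norm_power intro!: mult_right_mono power_mono)
    then have "integrable lborel (\<lambda>w. of_real (norm w ^ k) * B w)"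
      using B(2) by (intro rapidly_decreasing_integrable) auto
    from integrable_norm[OF this] show ?thesis by (simp add: norm_mult norm_power)
  qed
  have meas: "(\<lambda>w. B w * tf_shift (X w) \<phi> t) \<in> borel_measurable borel"
    if [measurable]: "B \<in> borel_measurable borel" and \<phi>: "\<phi> \<in> schwartz" for B :: "'k \<Rightarrow> complex" and \<phi> t
  proof -
    note [measurable] = schwartz_measurable[OF \<phi>]
    show ?thesis unfolding tf_shift_def modulation_def translation_def by measurable
  qed
  have int: "integrable lborel (\<lambda>w. B w * tf_shift (X w) \<phi> t)"
    if B: "rapidly_decreasing B" "B \<in> borel_measurable borel" and \<phi>: "\<phi> \<in> schwartz" for B :: "'k \<Rightarrow> complex" and \<phi> t
  proof -
    obtain c where c: "0 \<le> c" "\<And>x. cmod (\<phi> x) \<le> c" using schwartz_bounded[OF \<phi>] by blast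
    show ?thesis
    proof (rule Bochner_Integration.integrable_bound)
      show "integrable lborel (\<lambda>w. c * cmod (B w))" using norm_int[OF B, of 0] by simp
      show "AE w in lborel. norm (B w * tf_shift (X w) \<phi> t) \<le> norm (c * cmod (B w))"
        using c by (auto simp: norm_mult tf_shift_def modulation_def translation_def mult.commute[of c] intro!: mult_left_mono)
    qed (use meas[OF B(2) \<phi>] in simp)
  qed
  let ?H = "\<lambda>B \<phi> t. LINT w|lborel. B w * tf_shift (X w) \<phi> t"
  \<comment> \<open>the weight \<open>|t|\<^sup>k\<close> is split between \<open>|x|\<^sup>k\<close>, controlled by \<open>B\<close>, and \<open>|t - x|\<^sup>k\<close>, controlled by \<open>\<phi>\<close>\<close>
  have rd: "rapidly_decreasing (?H B \<phi>)"
    if B: "rapidly_decreasing B" "B \<in> borel_measurable borel" and \<phi>: "\<phi> \<in> schwartz" for B :: "'k \<Rightarrow> complex" and \<phi>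
    unfolding rapidly_decreasing_def
  proof (intro allI)
    fix k
    obtain c0 where c0: "0 \<le> c0" "\<And>x. cmod (\<phi> x) \<le> c0" using schwartz_bounded[OF \<phi>] by blast
    obtain ck where ck: "\<And>x. norm x ^ k * cmod (\<phi> x) \<le> ck"
      using rapidly_decreasing_bound[OF schwartz_rapidly_decreasing[OF \<phi>]] by blast
    let ?M = "\<lambda>w. 2 ^ k * (K ^ k * c0 * (norm w ^ k * cmod (B w)) + ck * cmod (B w))"
    have M: "integrable lborel ?M" using norm_int[OF B, of k] norm_int[OF B, of 0] by simp
    have "norm t ^ k * cmod (?H B \<phi> t) \<le> integral\<^sup>L lborel ?M" for t
    proof -
      have "norm t ^ k * cmod (?H B \<phi> t) \<le> norm t ^ k * (LINT w|lborel. cmod (B w * tf_shift (X w) \<phi> t))"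
        by (intro mult_left_mono integral_norm_bound) auto
      also have "\<dots> = (LINT w|lborel. norm t ^ k * cmod (B w * tf_shift (X w) \<phi> t))" by simp
      also have "\<dots> \<le> integral\<^sup>L lborel ?M"
      proof (rule integral_mono[OF _ M])
        show "integrable lborel (\<lambda>w. norm t ^ k * cmod (B w * tf_shift (X w) \<phi> t))" using int[OF B \<phi>] by simp
        fix w
        let ?x = "fst_part (X w)"
        have "norm ?x \<le> norm w * K" using norm_fst_part_le K(1) order_trans by blast
        then have x: "norm ?x ^ k \<le> K ^ k * norm w ^ k"
          using power_mono[of "norm ?x" "norm w * K" k] by (simp add: power_mult_distrib mult.commute)
        have "norm t ^ k \<le> (norm ?x + norm (t - ?x)) ^ k"
          by (intro power_mono norm_triangle_sub) auto
        also have "\<dots> \<le> 2 ^ k * (norm ?x ^ k + norm (t - ?x) ^ k)" by (intro power_add_le) auto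
        finally have "norm t ^ k * cmod (\<phi> (t - ?x)) \<le> 2 ^ k * (norm ?x ^ k + norm (t - ?x) ^ k) * cmod (\<phi> (t - ?x))"
          by (intro mult_right_mono) auto
        also have "\<dots> = 2 ^ k * (norm ?x ^ k * cmod (\<phi> (t - ?x)) + norm (t - ?x) ^ k * cmod (\<phi> (t - ?x)))"
          by (simp add: algebra_simps)
        also have "\<dots> \<le> 2 ^ k * ((K ^ k * norm w ^ k) * c0 + ck)"
          using K(2) by (intro mult_left_mono add_mono mult_mono x c0 ck) auto
        finally have "cmod (B w) * (norm t ^ k * cmod (\<phi> (t - ?x))) \<le> cmod (B w) * (2 ^ k * ((K ^ k * norm w ^ k) * c0 + ck))"
          by (intro mult_left_mono) auto
        then show "norm t ^ k * cmod (B w * tf_shift (X w) \<phi> t) \<le> ?M w"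
          by (simp add: norm_mult tf_shift_def modulation_def translation_def algebra_simps)
      qed
      finally show ?thesis .
    qed
    then show "\<exists>C. \<forall>t. norm t ^ k * cmod (?H B \<phi> t) \<le> C" by blast
  qed
  have freq_rd: "rapidly_decreasing (\<lambda>w. B w * (2 * pi * \<i> * (snd_part (X w) $ i)))"
    and freq_meas: "(\<lambda>w. B w * (2 * pi * \<i> * (snd_part (X w) $ i))) \<in> borel_measurable borel"
    if B: "rapidly_decreasing B" "B \<in> borel_measurable borel" for B :: "'k \<Rightarrow> complex" and i
  proof -
    show "rapidly_decreasing (\<lambda>w. B w * (2 * pi * \<i> * (snd_part (X w) $ i)))"
    proof (rule rapidly_decreasing_dominated[OF B(1), of _ "2 * pi * K" 1])
      fix w
      have "\<bar>snd_part (X w) $ i\<bar> \<le> norm w * K"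
        using component_le_norm_cart[of "snd_part (X w)" i] norm_snd_part_le[of "X w"] K(1)[of w] by linarith
      also have "\<dots> \<le> K * (1 + norm w)" using K(2) by (simp add: algebra_simps)
      finally have "cmod (B w) * (2 * pi * \<bar>snd_part (X w) $ i\<bar>) \<le> cmod (B w) * (2 * pi * (K * (1 + norm w)))"
        by (intro mult_left_mono) auto
      then show "cmod (B w * (2 * pi * \<i> * (snd_part (X w) $ i))) \<le> 2 * pi * K * (1 + norm w) ^ 1 * cmod (B w)"
        by (simp add: norm_mult mult_ac)
    qed
    note [measurable] = B(2)
    have [measurable]: "(\<lambda>w. snd_part (X w) $ i) \<in> borel_measurable borel"
      by (intro borel_measurable_continuous_onI linear_continuous_on X
          bounded_linear_compose[OF bounded_linear_vec_nth] bounded_linear_compose[OF bounded_linear_snd_part])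
    show "(\<lambda>w. B w * (2 * pi * \<i> * (snd_part (X w) $ i))) \<in> borel_measurable borel" by measurable
  qed
  have D: "(?H B \<phi> has_derivative (\<lambda>v. LINT w|lborel. (\<Sum>i\<in>UNIV. of_real (v $ i) * (B w * partial_deriv i (tf_shift (X w) \<phi>) t)))) (at t)"
    and P: "partial_deriv i (?H B \<phi>) = (\<lambda>t. ?H B (partial_deriv i \<phi>) t + ?H (\<lambda>w. B w * (2 * pi * \<i> * (snd_part (X w) $ i))) \<phi> t)"
    if B: "rapidly_decreasing B" "B \<in> borel_measurable borel" and \<phi>: "\<phi> \<in> schwartz" for B :: "'k \<Rightarrow> complex" and \<phi> t i
  proof -
    note \<phi>' = schwartz_partial_deriv[OF \<phi>]
    have eq: "B w * partial_deriv i (tf_shift (X w) \<phi>) t = B w * tf_shift (X w) (partial_deriv i \<phi>) t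
         + (B w * (2 * pi * \<i> * (snd_part (X w) $ i))) * tf_shift (X w) \<phi> t" for w i t
      by (simp add: partial_deriv_tf_shift[OF \<phi>] algebra_simps)
    obtain c where c: "0 \<le> c" "\<And>x. cmod (\<phi> x) \<le> c" using schwartz_bounded[OF \<phi>] by blast
    have "\<exists>c. \<forall>x. cmod (partial_deriv i \<phi> x) \<le> c" for i using schwartz_bounded[OF \<phi>'[of i]] by metis
    then obtain c' where c': "\<And>i x. cmod (partial_deriv i \<phi> x) \<le> c' i" by metis
    let ?m = "\<lambda>w. \<Sum>i\<in>UNIV. c' i * cmod (B w) + c * cmod (B w * (2 * pi * \<i> * (snd_part (X w) $ i)))"
    have m_int: "integrable lborel ?m"
      using norm_int[OF B, of 0] norm_int[OF freq_rd[OF B] freq_meas[OF B], of 0]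
      by (intro Bochner_Integration.integrable_sum Bochner_Integration.integrable_add integrable_mult_right) simp_all
    have pm: "(\<lambda>w. B w * partial_deriv i (tf_shift (X w) \<phi>) t) \<in> borel_measurable lborel" for i t
      unfolding eq using meas[OF B(2) \<phi>'] meas[OF freq_meas[OF B] \<phi>] by (intro borel_measurable_add) simp_all
    show D: "(?H B \<phi> has_derivative (\<lambda>v. LINT w|lborel. (\<Sum>i\<in>UNIV. of_real (v $ i) * (B w * partial_deriv i (tf_shift (X w) \<phi>) t)))) (at t)" for t
    proof (rule has_derivative_integral_dominated[where m = ?m])
      fix w t
      have "(tf_shift (X w) \<phi> has_derivative (\<lambda>v. \<Sum>i\<in>UNIV. of_real (v $ i) * partial_deriv i (tf_shift (X w) \<phi>) t)) (at t)"
        by (intro has_derivative_partial_derivs schwartz_differentiable schwartz_tf_shift \<phi>)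
      from has_derivative_mult_right[OF this, of "B w"]
      show "((\<lambda>t. B w * tf_shift (X w) \<phi> t) has_derivative
          (\<lambda>v. \<Sum>i\<in>UNIV. of_real (v $ i) * (B w * partial_deriv i (tf_shift (X w) \<phi>) t))) (at t)"
        by (simp add: sum_distrib_left mult_ac)
      fix v :: "real ^ 'm"
      have "cmod (B w * partial_deriv i (tf_shift (X w) \<phi>) t)
          \<le> c' i * cmod (B w) + c * cmod (B w * (2 * pi * \<i> * (snd_part (X w) $ i)))" for i
      proof -
        have "cmod (B w * tf_shift (X w) (partial_deriv i \<phi>) t) \<le> c' i * cmod (B w)"
          by (simp add: norm_mult tf_shift_def modulation_def translation_def mult.commute[of "c' i"] mult_left_mono c')
        moreover have "cmod ((B w * (2 * pi * \<i> * (snd_part (X w) $ i))) * tf_shift (X w) \<phi> t)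
            \<le> c * cmod (B w * (2 * pi * \<i> * (snd_part (X w) $ i)))"
          unfolding norm_mult[of _ "tf_shift _ _ _"] mult.commute[of c]
          by (intro mult_left_mono) (simp_all add: norm_mult tf_shift_def modulation_def translation_def c)
        ultimately show ?thesis unfolding eq by (rule order_trans[OF norm_triangle_ineq add_mono])
      qed
      then have "cmod (of_real (v $ i) * (B w * partial_deriv i (tf_shift (X w) \<phi>) t))
          \<le> norm v * (c' i * cmod (B w) + c * cmod (B w * (2 * pi * \<i> * (snd_part (X w) $ i))))" for i
        unfolding norm_mult[of "of_real _"] norm_of_real
        by (intro mult_mono component_le_norm_cart) auto
      then have "cmod (\<Sum>i\<in>UNIV. of_real (v $ i) * (B w * partial_deriv i (tf_shift (X w) \<phi>) t))
         \<le> (\<Sum>i\<in>UNIV. norm v * (c' i * cmod (B w) + c * cmod (B w * (2 * pi * \<i> * (snd_part (X w) $ i)))))"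
        by (rule sum_norm_le)
      then show "cmod (\<Sum>i\<in>UNIV. of_real (v $ i) * (B w * partial_deriv i (tf_shift (X w) \<phi>) t)) \<le> ?m w * norm v"
        by (simp only: sum_distrib_left[symmetric] mult.commute)
    qed (use m_int int[OF B \<phi>] pm in \<open>auto intro!: borel_measurable_sum borel_measurable_times\<close>)
    show "partial_deriv i (?H B \<phi>) = (\<lambda>t. ?H B (partial_deriv i \<phi>) t + ?H (\<lambda>w. B w * (2 * pi * \<i> * (snd_part (X w) $ i))) \<phi> t)"
    proof
      fix t
      have "partial_deriv i (?H B \<phi>) t = (LINT w|lborel. (\<Sum>j\<in>UNIV. of_real ((axis i 1 :: real ^ 'm) $ j) * (B w * partial_deriv j (tf_shift (X w) \<phi>) t)))"
        by (rule partial_deriv_eqI[OF D])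
      also have "\<dots> = (LINT w|lborel. B w * partial_deriv i (tf_shift (X w) \<phi>) t)"
        by (simp add: axis_def if_distrib[of of_real] if_distrib[of "\<lambda>x. x * _"] cong: if_cong)
      also have "\<dots> = ?H B (partial_deriv i \<phi>) t + ?H (\<lambda>w. B w * (2 * pi * \<i> * (snd_part (X w) $ i))) \<phi> t"
        unfolding eq by (intro Bochner_Integration.integral_add int B \<phi> \<phi>' freq_rd freq_meas)
      finally show "partial_deriv i (?H B \<phi>) t = \<dots>" .
    qed
  qed
  have "schwartz_order n (?H B \<phi>)" for n
    using B \<phi>
  proof (induction n arbitrary: B \<phi>)
    case (0 B \<phi>)
    have "\<forall>t. ?H B \<phi> differentiable at t" using D[OF 0] by (meson differentiableI)
    with rd[OF 0] show ?case by simp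
  next
    case (Suc n B \<phi>)
    have "\<forall>t. ?H B \<phi> differentiable at t" using D[OF Suc.prems] by (meson differentiableI)
    moreover have "schwartz_order n (partial_deriv i (?H B \<phi>))" for i
      unfolding P[OF Suc.prems]
      by (intro schwartz_order_add Suc.IH Suc.prems freq_rd freq_meas schwartz_partial_deriv)
    ultimately show ?case using rd[OF Suc.prems] by simp
  qed
  then show ?thesis by (simp add: schwartz_iff)
qed

section \<open>Metaplectic operators preserve the Schwartz space\<close>

lemma unitary_L2D:
  assumes "unitary_L2 U"
  shows "f \<in> L2 \<Longrightarrow> U f \<in> L2"
    and "f \<in> L2 \<Longrightarrow> g \<in> L2 \<Longrightarrow> ae_eq f g \<Longrightarrow> ae_eq (U f) (U g)"
    and "f \<in> L2 \<Longrightarrow> g \<in> L2 \<Longrightarrow> L2_inner (U f) (U g) = L2_inner f g"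
    and "g \<in> L2 \<Longrightarrow> \<exists>f\<in>L2. ae_eq (U f) g"
  using assms unfolding unitary_L2_def by blast+

definition rho_phase :: "real ^ ('m::finite + 'm) \<Rightarrow> complex" where
  "rho_phase w = cis (- pi * (snd_part w \<bullet> fst_part w))"

lemma rho_0: "rho w 0 f = (\<lambda>t. rho_phase w * tf_shift w f t)"
  by (simp add: rho_def rho_phase_def fun_eq_iff)

lemma cmod_rho_phase [simp]: "cmod (rho_phase w) = 1"
  by (simp add: rho_phase_def)

lemma cnj_rho_phase_mult [simp]: "cnj (rho_phase w) * rho_phase w = 1"
  by (simp add: rho_phase_def cis_cnj cis_mult)

lemma L2_rho: "f \<in> L2 \<Longrightarrow> rho w 0 f \<in> L2"
  unfolding rho_0 by (intro L2_scale L2_tf_shift)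

lemma schwartz_rho: "f \<in> schwartz \<Longrightarrow> rho w 0 f \<in> schwartz"
  unfolding rho_0 by (intro schwartz_scale schwartz_tf_shift)

lemma ae_eq_tf_shift: "ae_eq f g \<Longrightarrow> ae_eq (tf_shift z f) (tf_shift z g)"
  unfolding tf_shift_def
  by (drule ae_eq_translation[of _ _ "fst_part z"]) (auto simp: ae_eq_def modulation_def elim: eventually_mono)

lemma ae_eq_rho: "ae_eq f g \<Longrightarrow> ae_eq (rho w 0 f) (rho w 0 g)"
  unfolding rho_0 by (drule ae_eq_tf_shift[of _ _ w]) (auto simp: ae_eq_def elim: eventually_mono)

text \<open>If \<open>\<phi> = U \<psi>\<close> and \<open>g' = U g\<close>, then \<open>\<langle>\<rho>(w) \<psi>, g\<rangle> = \<langle>\<rho>(A w) \<phi>, g'\<rangle>\<close> by unitarity and the intertwining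
  relation. The orthogonality relations for \<open>F\<close>, \<open>\<psi>\<close> and \<open>g\<close> therefore state that the superposition
  \<open>h = \<integral> B(w) \<pi>(A w) \<phi> dw\<close> satisfies \<open>\<langle>h, g'\<rangle> = C \<langle>\<phi>, U F\<rangle> \<langle>U F, g'\<rangle>\<close> for every \<open>g'\<close>. Here \<open>F\<close> and \<open>\<phi>\<close> are
  Schwartz functions, so \<open>h\<close> is one, and it is a multiple of \<open>U F\<close>.\<close>

lemma metaplectic_preserves_schwartz:
  fixes A :: "real ^ ('m::finite + 'm) ^ ('m + 'm)"
  assumes "metaplectic A U" and F: "F \<in> schwartz"
  shows "\<exists>h\<in>schwartz. ae_eq h (U F)"
proof -
  have U: "unitary_L2 U" and inter: "\<And>w f. f \<in> L2 \<Longrightarrow> ae_eq (U (rho w 0 f)) (rho (A *v w) 0 (U f))"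
    using assms unfolding metaplectic_def by blast+
  note F2 = schwartz_L2[OF F]
  let ?k = "U F"
  have k: "?k \<in> L2" by (rule unitary_L2D(1)[OF U F2])
  show ?thesis
  proof (cases "\<exists>\<phi>\<in>schwartz. L2_inner \<phi> ?k \<noteq> 0")
    case False
    then have "ae_eq ?k (\<lambda>_. 0)" by (intro schwartz_orthogonal_imp_zero k) auto
    moreover have "(\<lambda>_. 0 :: complex) \<in> (schwartz :: (real ^ 'm \<Rightarrow> complex) set)"
      using schwartz_scale[OF gaussian_schwartz, of 0] by simp
    ultimately show ?thesis using ae_eq_sym by blast
  next
    case True
    then obtain \<phi> where \<phi>: "\<phi> \<in> schwartz" and nz: "L2_inner \<phi> ?k \<noteq> 0" by blast
    note \<phi>2 = schwartz_L2[OF \<phi>]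
    obtain \<psi> where \<psi>: "\<psi> \<in> L2" "ae_eq (U \<psi>) \<phi>" using unitary_L2D(4)[OF U \<phi>2] by blast
    \<comment> \<open>the phases convert between \<open>\<pi>\<close> and \<open>\<rho>\<close> at \<open>w\<close> and at \<open>A w\<close>\<close>
    define B where "B w = stft F F w * (cnj (rho_phase w) * rho_phase (A *v w))" for w
    define h where "h t = (LINT w|lborel. B w * tf_shift (A *v w) \<phi> t)" for t
    have A: "bounded_linear ((*v) A)" by (rule matrix_vector_mul_bounded_linear)
    have [measurable]: "(\<lambda>w. A *v w) \<in> borel_measurable borel"
      by (intro borel_measurable_continuous_onI linear_continuous_on A)
    have B_rd: "rapidly_decreasing B"
      by (rule rapidly_decreasing_dominated[OF stft_rapidly_decreasing[OF F F], of _ 1 0]) (simp add: B_def norm_mult)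
    have [measurable]: "stft F F \<in> borel_measurable borel"
      by (rule borel_measurable_continuous_onI[OF stft_continuous[OF F F]])
    have B_meas[measurable]: "B \<in> borel_measurable borel"
      unfolding B_def[abs_def] rho_phase_def by measurable
    have h: "h \<in> schwartz"
      unfolding h_def[abs_def] by (rule superposition_schwartz[OF A B_rd B_meas \<phi>])
    note [measurable] = schwartz_measurable[OF \<phi>]
    let ?c = "inversion_constant TYPE('m) * L2_inner \<phi> ?k"
    have "L2_inner h g' = L2_inner (\<lambda>t. ?c * ?k t) g'" if g': "g' \<in> L2" for g'
    proof -
      note [measurable] = L2_measurable[OF g']
      obtain g where g: "g \<in> L2" "ae_eq (U g) g'" using unitary_L2D(4)[OF U g'] by blast
      have pairing: "L2_inner (tf_shift w \<psi>) g = cnj (rho_phase w) * rho_phase (A *v w) * L2_inner (tf_shift (A *v w) \<phi>) g'" for w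
      proof -
        have "L2_inner (rho w 0 \<psi>) g = L2_inner (U (rho w 0 \<psi>)) (U g)"
          by (rule unitary_L2D(3)[OF U, symmetric]) (intro L2_rho \<psi> g)+
        also have "\<dots> = L2_inner (rho (A *v w) 0 \<phi>) g'"
        proof (rule L2_inner_cong)
          show "ae_eq (U (rho w 0 \<psi>)) (rho (A *v w) 0 \<phi>)"
            using inter[OF \<psi>(1)] ae_eq_rho[OF \<psi>(2)] by (rule ae_eq_trans)
        qed (intro unitary_L2D(1)[OF U] L2_rho \<psi> g g' \<phi>2)+
        finally have "rho_phase w * L2_inner (tf_shift w \<psi>) g = rho_phase (A *v w) * L2_inner (tf_shift (A *v w) \<phi>) g'"
          by (simp only: rho_0 L2_inner_scale_left)
        then have "cnj (rho_phase w) * (rho_phase w * L2_inner (tf_shift w \<psi>) g) =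
            cnj (rho_phase w) * (rho_phase (A *v w) * L2_inner (tf_shift (A *v w) \<phi>) g')" by simp
        then show ?thesis by (simp add: mult.assoc[symmetric])
      qed
      have int: "integrable (lborel \<Otimes>\<^sub>M lborel) (\<lambda>(w, t). B w * tf_shift (A *v w) \<phi> t * cnj (g' t))"
      proof (rule lborel_pair.Fubini_integrable)
        let ?K = "(LINT t|lborel. (cmod (\<phi> t))\<^sup>2) + (LINT t|lborel. (cmod (g' t))\<^sup>2)"
        have [measurable]: "(\<lambda>(w, t). tf_shift (A *v w) \<phi> t) \<in> borel_measurable (borel \<Otimes>\<^sub>M borel)"
          unfolding tf_shift_def modulation_def translation_def by measurable
        show "(\<lambda>(w, t). B w * tf_shift (A *v w) \<phi> t * cnj (g' t)) \<in> borel_measurable (lborel \<Otimes>\<^sub>M lborel)"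
          by measurable
        have Bint: "integrable lborel B" by (rule rapidly_decreasing_integrable[OF B_rd B_meas])
        have le: "(LINT t|lborel. norm (B w * tf_shift (A *v w) \<phi> t * cnj (g' t))) \<le> ?K * cmod (B w)" for w
          using mult_left_mono[OF tf_shift_pairing_bound[OF \<phi>2 g'], of "cmod (B w)" "A *v w"]
          by (simp add: norm_mult mult.assoc mult.commute[of ?K])
        show "integrable lborel (\<lambda>w. LINT t|lborel. norm (case (w, t) of (w, t) \<Rightarrow> B w * tf_shift (A *v w) \<phi> t * cnj (g' t)))"
        proof (rule Bochner_Integration.integrable_bound)
          show "integrable lborel (\<lambda>w. ?K * cmod (B w))" using Bint by simp
          show "AE w in lborel. norm (LINT t|lborel. norm (case (w, t) of (w, t) \<Rightarrow> B w * tf_shift (A *v w) \<phi> t * cnj (g' t))) \<le> norm (?K * cmod (B w))"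
            using le by (intro AE_I2) (simp add: abs_of_nonneg order_trans[OF _ abs_ge_self])
        qed measurable
        show "AE w in lborel. integrable lborel (\<lambda>t. case (w, t) of (w, t) \<Rightarrow> B w * tf_shift (A *v w) \<phi> t * cnj (g' t))"
          using L2_integrable_inner[OF L2_tf_shift[OF \<phi>2] g'] by (simp add: mult.assoc)
      qed
      have "L2_inner h g' = (LINT t|lborel. LINT w|lborel. B w * tf_shift (A *v w) \<phi> t * cnj (g' t))"
        by (simp add: L2_inner_def h_def)
      also have "\<dots> = (LINT w|lborel. LINT t|lborel. B w * tf_shift (A *v w) \<phi> t * cnj (g' t))"
        by (rule lborel_pair.Fubini_integral[OF int])
      also have "\<dots> = (LINT w|lborel. B w * L2_inner (tf_shift (A *v w) \<phi>) g')"
        by (simp add: L2_inner_def mult.assoc)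
      also have "\<dots> = (LINT w|lborel. stft F F w * L2_inner (tf_shift w \<psi>) g)"
        by (simp add: pairing B_def mult.assoc)
      also have "\<dots> = inversion_constant TYPE('m) * (L2_inner \<psi> F * L2_inner F g)"
        by (rule stft_orthogonality[OF F F \<psi>(1) g(1)])
      also have "L2_inner \<psi> F = L2_inner \<phi> ?k"
        using L2_inner_cong[OF unitary_L2D(1)[OF U \<psi>(1)] \<phi>2 k k \<psi>(2) ae_eq_refl] unitary_L2D(3)[OF U \<psi>(1) F2] by simp
      also have "L2_inner F g = L2_inner ?k g'"
        using L2_inner_cong[OF k k unitary_L2D(1)[OF U g(1)] g' ae_eq_refl g(2)] unitary_L2D(3)[OF U F2 g(1)] by simp
      finally show ?thesis by (simp add: L2_inner_scale_left)
    qed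
    then have "ae_eq h (\<lambda>t. ?c * ?k t)" by (intro L2_eqI schwartz_L2 h L2_scale k)
    moreover have "inverse c * (c * u) = u" if "c \<noteq> 0" for c u :: complex using that by simp
    then have "inverse ?c * h t = ?k t" if "h t = ?c * ?k t" for t
      unfolding that using nz inversion_constant_nonzero by (metis mult_eq_0_iff)
    ultimately have "ae_eq (\<lambda>t. inverse ?c * h t) ?k"
      unfolding ae_eq_def by (elim eventually_mono) blast
    then show ?thesis using schwartz_scale[OF h] by blast
  qed
qed

section \<open>Metaplectic Wigner distributions\<close>

lemma schwartz_rep_eqI:
  assumes "h \<in> schwartz" "ae_eq h F" shows "schwartz_rep F = h"
  unfolding schwartz_rep_def
proof (rule the_equality)
  fix h' assume "h' \<in> schwartz \<and> ae_eq h' F"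
  then show "h' = h"
    using assms by (intro continuous_ae_eq_imp_eq schwartz_continuous) (auto intro: ae_eq_trans ae_eq_sym)
qed (use assms in blast)

lemma metaplectic_wigner_schwartz:
  assumes "metaplectic A U" "f \<in> schwartz" "g \<in> schwartz"
  shows "metaplectic_wigner_schwartz U f g \<in> schwartz"
    and "ae_eq (metaplectic_wigner_schwartz U f g) (U (tensor_cnj f g))"
  using metaplectic_preserves_schwartz[OF assms(1) schwartz_tensor_cnj[OF assms(2,3)]]
  unfolding metaplectic_wigner_schwartz_def metaplectic_wigner_def by (auto simp: schwartz_rep_eqI)

lemma tensor_cnj_join: "tensor_cnj f g (join_parts p) = f (fst p) * cnj (g (snd p))"
  by (simp add: tensor_cnj_def)

lemma L2_tensor_cnj:
  assumes f: "f \<in> L2" and g: "g \<in> L2" shows "tensor_cnj f g \<in> L2"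
proof -
  note [measurable] = L2_measurable[OF f] L2_measurable[OF g]
  have m[measurable]: "tensor_cnj f g \<in> borel_measurable borel" unfolding tensor_cnj_def by measurable
  have "integrable (lborel \<Otimes>\<^sub>M lborel) (\<lambda>(x, y). (f x * cnj (f x)) * (g y * cnj (g y)))"
    by (intro integrable_lborel_product L2_integrable_inner f g)
  from integrable_norm[OF this]
  have "integrable (lborel \<Otimes>\<^sub>M lborel) (\<lambda>p. (cmod (tensor_cnj f g (join_parts p)))\<^sup>2)"
    by (simp add: tensor_cnj_join case_prod_beta' norm_mult power_mult_distrib power2_eq_square mult_ac)
  then have "integrable lborel (\<lambda>z. (cmod (tensor_cnj f g z))\<^sup>2)"
    by (subst integrable_join_parts) auto
  with m show ?thesis by (simp add: L2_def)
qed

lemma L2_inner_tensor_cnj: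
  assumes "f1 \<in> L2" "f2 \<in> L2" "g1 \<in> L2" "g2 \<in> L2"
  shows "L2_inner (tensor_cnj f1 g1) (tensor_cnj f2 g2) = L2_inner f1 f2 * cnj (L2_inner g1 g2)"
proof -
  note [measurable] = assms[THEN L2_measurable]
  let ?F = "\<lambda>x. f1 x * cnj (f2 x)" and ?G = "\<lambda>y. g2 y * cnj (g1 y)"
  have [measurable]: "tensor_cnj f1 g1 \<in> borel_measurable borel" "tensor_cnj f2 g2 \<in> borel_measurable borel"
    using assms L2_tensor_cnj L2_measurable by blast+
  have "L2_inner (tensor_cnj f1 g1) (tensor_cnj f2 g2) =
      (LINT p|(lborel \<Otimes>\<^sub>M lborel). tensor_cnj f1 g1 (join_parts p) * cnj (tensor_cnj f2 g2 (join_parts p)))"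
    unfolding L2_inner_def by (rule integral_join_parts) measurable
  also have "\<dots> = (LINT p|(lborel \<Otimes>\<^sub>M lborel). (\<lambda>(x, y). ?F x * ?G y) p)"
    by (simp add: tensor_cnj_join case_prod_beta' mult_ac)
  also have "\<dots> = (LINT x|lborel. LINT y|lborel. ?F x * ?G y)"
    by (rule integral_pair) (intro integrable_lborel_product L2_integrable_inner assms)
  also have "\<dots> = L2_inner f1 f2 * L2_inner g2 g1"
    by (simp add: L2_inner_def)
  finally show ?thesis by (simp add: L2_inner_commute[of g2 g1])
qed

text \<open>For \<open>z = (x, \<xi>)\<close>, this is the point \<open>((x, x), (\<xi>, - \<xi>))\<close>: shifting \<open>f\<close> and \<open>g\<close> by \<open>z\<close> conjugates the
  modulation of the second factor of \<open>f \<otimes> g\<^sup>*\<close>. The phase of \<open>\<rho>\<close> is \<open>1\<close> there, as \<open>\<xi> \<bullet> x - \<xi> \<bullet> x = 0\<close>.\<close>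

definition diag_shift :: "real ^ ('n::finite + 'n) \<Rightarrow> real ^ (('n + 'n) + ('n + 'n))" where
  "diag_shift z = join_parts (join_parts (fst_part z, fst_part z), join_parts (snd_part z, - snd_part z))"

lemma inner_join_parts: "join_parts (a, b) \<bullet> join_parts (c, d) = a \<bullet> c + b \<bullet> d"
  by (simp add: inner_vec_def sum_UNIV_Plus join_parts_def)

lemma inner_parts: "join_parts (a, b) \<bullet> t = a \<bullet> fst_part t + b \<bullet> snd_part t"
  using inner_join_parts[of a b "fst_part t" "snd_part t"] by simp

lemma tensor_cnj_tf_shift: "tensor_cnj (tf_shift z f) (tf_shift z g) = rho (diag_shift z) 0 (tensor_cnj f g)"
proof
  fix t
  have parts: "fst_part (t - join_parts (a, a)) = fst_part t - a" "snd_part (t - join_parts (a, a)) = snd_part t - a" for a :: "real ^ 'a"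
    by (simp_all add: fst_part_def snd_part_def join_parts_def vec_eq_iff)
  have c: "cis (2 * pi * (snd_part z \<bullet> fst_part t + - snd_part z \<bullet> snd_part t)) =
      cis (2 * pi * (snd_part z \<bullet> fst_part t)) * cnj (cis (2 * pi * (snd_part z \<bullet> snd_part t)))"
    by (simp add: cis_cnj cis_mult algebra_simps)
  show "tensor_cnj (tf_shift z f) (tf_shift z g) t = rho (diag_shift z) 0 (tensor_cnj f g) t"
    unfolding rho_0 rho_phase_def diag_shift_def tf_shift_def modulation_def translation_def
      tensor_cnj_def fst_part_join snd_part_join fst_conv snd_conv inner_join_parts inner_parts parts c
    by simp
qed

text \<open>The left-hand side is \<open>\<langle>g, \<pi>(z) \<phi>2\<rangle> \<langle>f, \<pi>(z) \<phi>1\<rangle>\<^sup>*\<close>, an inner product of tensors, which \<open>U\<close> preserves.\<close>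

lemma stft_product_eq_inner_wigner:
  assumes M: "metaplectic A U" and S: "f \<in> schwartz" "g \<in> schwartz" "\<phi>1 \<in> schwartz" "\<phi>2 \<in> schwartz"
  shows "cnj (stft \<phi>1 f z) * stft \<phi>2 g z =
    L2_inner (metaplectic_wigner_schwartz U g f) (metaplectic_wigner U (tf_shift z \<phi>2) (tf_shift z \<phi>1))"
proof -
  have U: "unitary_L2 U" using M by (simp add: metaplectic_def)
  note T = L2_tensor_cnj[OF schwartz_L2[OF S(2)] schwartz_L2[OF S(1)]]
    L2_tensor_cnj[OF L2_tf_shift[OF schwartz_L2[OF S(4)]] L2_tf_shift[OF schwartz_L2[OF S(3)]]]
  have "cnj (stft \<phi>1 f z) * stft \<phi>2 g z = L2_inner (tensor_cnj g f) (tensor_cnj (tf_shift z \<phi>2) (tf_shift z \<phi>1))"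
    by (subst L2_inner_tensor_cnj) (auto simp: stft_def schwartz_L2 L2_tf_shift S mult.commute)
  also have "\<dots> = L2_inner (U (tensor_cnj g f)) (U (tensor_cnj (tf_shift z \<phi>2) (tf_shift z \<phi>1)))"
    by (rule unitary_L2D(3)[OF U T, symmetric])
  also have "\<dots> = L2_inner (metaplectic_wigner_schwartz U g f) (metaplectic_wigner U (tf_shift z \<phi>2) (tf_shift z \<phi>1))"
    unfolding metaplectic_wigner_def
    by (intro L2_inner_cong unitary_L2D(1)[OF U] T schwartz_L2 metaplectic_wigner_schwartz[OF M]
        ae_eq_sym[OF metaplectic_wigner_schwartz(2)[OF M]] S ae_eq_refl)
  finally show ?thesis .
qed

lemma convolution_reflected: "Defs.convolution (\<lambda>z. cnj (h (- z))) \<phi> z = L2_inner \<phi> (translation z h)"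
  by (simp add: Defs.convolution_def L2_inner_def translation_def mult.commute)

lemma bracket_localization_op:
  "bracket (localization_op \<phi>1 \<phi>2 a f) g = bracket a (\<lambda>z. cnj (stft \<phi>1 f z) * stft \<phi>2 g z)"
  by (simp add: bracket_def localization_op_def distr_of_bracket_def)

lemma bracket_metaplectic_Op_convolution:
  "bracket (metaplectic_Op U (distr_convolution a h) f) g =
   bracket a (\<lambda>z. L2_inner (metaplectic_wigner_schwartz U g f) (translation z h))"
  unfolding convolution_reflected[symmetric]
  by (simp add: bracket_def metaplectic_Op_def distr_convolution_def distr_of_bracket_def)

section \<open>Localization operators and covariance\<close>

lemma localization_op_eq_Op_of_covariant:
  assumes M: "metaplectic A U" and cov: "covariant U"
    and S: "\<phi>1 \<in> schwartz" "\<phi>2 \<in> schwartz"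
  shows "operators_agree (localization_op \<phi>1 \<phi>2 a)
    (metaplectic_Op U (distr_convolution a (metaplectic_wigner_schwartz U \<phi>2 \<phi>1)))"
  unfolding operators_agree_def bracket_localization_op bracket_metaplectic_Op_convolution
proof (intro ballI)
  fix f g :: "real ^ 'a \<Rightarrow> complex" assume fg: "f \<in> schwartz" "g \<in> schwartz"
  have U: "unitary_L2 U" using M by (simp add: metaplectic_def)
  note W = metaplectic_wigner_schwartz[OF M]
  have "cnj (stft \<phi>1 f z) * stft \<phi>2 g z =
      L2_inner (metaplectic_wigner_schwartz U g f) (translation z (metaplectic_wigner_schwartz U \<phi>2 \<phi>1))" for z
    unfolding stft_product_eq_inner_wigner[OF M fg S]
  proof (rule L2_inner_cong)
    have "ae_eq (metaplectic_wigner U (tf_shift z \<phi>2) (tf_shift z \<phi>1)) (translation z (metaplectic_wigner U \<phi>2 \<phi>1))"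
      using cov S unfolding covariant_def by (auto intro: schwartz_L2)
    also have "ae_eq \<dots> (translation z (metaplectic_wigner_schwartz U \<phi>2 \<phi>1))"
      unfolding metaplectic_wigner_def by (intro ae_eq_translation ae_eq_sym[OF W(2)] S)
    finally show "ae_eq (metaplectic_wigner U (tf_shift z \<phi>2) (tf_shift z \<phi>1)) (translation z (metaplectic_wigner_schwartz U \<phi>2 \<phi>1))" .
    show "metaplectic_wigner U (tf_shift z \<phi>2) (tf_shift z \<phi>1) \<in> L2"
      unfolding metaplectic_wigner_def by (intro unitary_L2D(1)[OF U] L2_tensor_cnj L2_tf_shift schwartz_L2 S)
  qed (intro ae_eq_refl schwartz_L2 W schwartz_translation S fg)+
  then show "bracket a (\<lambda>z. cnj (stft \<phi>1 f z) * stft \<phi>2 g z) =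
      bracket a (\<lambda>z. L2_inner (metaplectic_wigner_schwartz U g f) (translation z (metaplectic_wigner_schwartz U \<phi>2 \<phi>1)))"
    by simp
qed

text \<open>Point masses turn an identity of brackets into a pointwise identity of functions.\<close>

lemma evaluation_tempered: "(\<lambda>\<psi>. \<psi> z) \<in> (tempered :: ((real ^ 'm::finite \<Rightarrow> complex) \<Rightarrow> complex) set)"
  unfolding tempered_def
proof (intro CollectI conjI exI ballI allI)
  show "finite {(0 :: nat, [] :: 'm list)}" by simp
  fix \<phi> :: "real ^ 'm \<Rightarrow> complex" assume "\<phi> \<in> schwartz"
  then have "bdd_above (range (\<lambda>x. norm x ^ 0 * cmod (partial_derivs [] \<phi> x)))"
    unfolding schwartz_def mem_Collect_eq by metis
  then have "norm z ^ 0 * cmod (partial_derivs [] \<phi> z) \<le> schwartz_seminorm 0 [] \<phi>"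
    unfolding schwartz_seminorm_def by (rule cSUP_upper[OF UNIV_I])
  then show "cmod (\<phi> z) \<le> 1 * (\<Sum>(k, is)\<in>{(0, [])}. schwartz_seminorm k is \<phi>)" by simp
qed simp_all

text \<open>The case of equality in the Cauchy-Schwarz inequality.\<close>

lemma ae_eq_of_L2_inner_eq:
  assumes u: "u \<in> L2" and v: "v \<in> L2"
    and eq: "L2_inner u v = c" "L2_inner u u = c" "L2_inner v v = c"
  shows "ae_eq u v"
proof -
  let ?d = "\<lambda>x. u x + (- 1) * v x"
  have d: "?d \<in> L2" by (intro L2_add L2_scale u v)
  have c: "cnj c = c" unfolding eq(2)[symmetric] L2_inner_self by simp
  have left: "L2_inner ?d k = L2_inner u k - L2_inner v k" if "k \<in> L2" for k
    using L2_inner_add_left[OF u L2_scale[OF v, of "-1"] that] L2_inner_scale_left[of "-1" v k] by simp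
  have "L2_inner u ?d = cnj (L2_inner ?d u)" "L2_inner v ?d = cnj (L2_inner ?d v)"
    by (rule L2_inner_commute)+
  moreover have "L2_inner v u = c" using L2_inner_commute[of v u] eq(1) c by simp
  ultimately have "L2_inner u ?d = 0" "L2_inner v ?d = 0"
    unfolding left[OF u] left[OF v] using eq by simp_all
  then have "L2_inner ?d ?d = 0" unfolding left[OF d] by simp
  then have "ae_eq ?d (\<lambda>_. 0)" by (rule L2_inner_self_eq_0[OF d])
  then show ?thesis by (auto simp: ae_eq_def elim: eventually_mono)
qed

lemma L2_inner_translation_self:
  assumes "f \<in> L2" shows "L2_inner (translation a f) (translation a f) = L2_inner f f"
proof -
  note [measurable] = L2_measurable[OF assms]
  show ?thesis unfolding L2_inner_def translation_def by (rule lborel_integral_translate[of "\<lambda>x. f x * cnj (f x)"]) measurable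
qed

lemma L2_inner_tf_shift_self:
  assumes "f \<in> L2" shows "L2_inner (tf_shift z f) (tf_shift z f) = L2_inner f f"
proof -
  have "tf_shift z f t * cnj (tf_shift z f t) = translation (fst_part z) f t * cnj (translation (fst_part z) f t)" for t
    unfolding complex_norm_square[symmetric] by (simp add: tf_shift_def modulation_def norm_mult)
  then show ?thesis using L2_inner_translation_self[OF assms, of "fst_part z"] by (simp add: L2_inner_def)
qed

text \<open>Taking absolute values, \<open>|h|\<close> is periodic with period \<open>z - x\<close>, where \<open>x\<close> is the time component of
  \<open>w\<close>; a nonzero decaying function has no period. Then the modulation acts trivially near a point where
  \<open>h\<close> does not vanish, so its frequency is zero.\<close>

lemma translation_eq_rho_imp:
  fixes h :: "real ^ 'm::finite \<Rightarrow> complex"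
  assumes h: "h \<in> schwartz" and nz: "h s0 \<noteq> 0" and eq: "translation z h = rho w 0 h"
  shows "fst_part w = z" and "snd_part w = 0"
proof -
  let ?x = "fst_part w" and ?\<xi> = "snd_part w"
  have eq': "h (t - z) = rho_phase w * (cis (2 * pi * (?\<xi> \<bullet> t)) * h (t - ?x))" for t
    using fun_cong[OF eq, of t] by (simp add: translation_def rho_0 tf_shift_def modulation_def)
  have abs: "cmod (h (s + (z - ?x))) = cmod (h s)" for s
    using arg_cong[OF eq'[of "s + z"], of cmod] by (simp add: norm_mult algebra_simps)
  show x: "?x = z"
  proof (rule ccontr)
    assume "?x \<noteq> z"
    define v where "v = z - ?x"
    have v: "0 < norm v" using \<open>?x \<noteq> z\<close> by (simp add: v_def)
    have per: "cmod (h (s0 + real n *\<^sub>R v)) = cmod (h s0)" for n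
    proof (induction n)
      case (Suc n)
      then show ?case using abs[of "s0 + real n *\<^sub>R v"] by (simp add: v_def scaleR_left_distrib add_ac)
    qed simp
    obtain B where B: "\<And>x. norm x ^ 1 * cmod (h x) \<le> B"
      using rapidly_decreasing_bound[OF schwartz_rapidly_decreasing[OF h], of 1] by blast
    have bound: "real n * norm v \<le> B / cmod (h s0) + norm s0" for n
    proof -
      have "norm (s0 + real n *\<^sub>R v) * cmod (h s0) \<le> B" using B[of "s0 + real n *\<^sub>R v"] per[of n] by simp
      then have "norm (s0 + real n *\<^sub>R v) \<le> B / cmod (h s0)" using nz by (simp add: field_simps)
      moreover have "norm (real n *\<^sub>R v) \<le> norm (s0 + real n *\<^sub>R v) + norm s0"
        using norm_triangle_ineq4[of "s0 + real n *\<^sub>R v" s0] by simp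
      ultimately show ?thesis by simp
    qed
    obtain n where "(B / cmod (h s0) + norm s0) / norm v < real n" using reals_Archimedean2 by blast
    then have "B / cmod (h s0) + norm s0 < real n * norm v" using v by (simp only: pos_divide_less_eq)
    with bound[of n] show False by linarith
  qed
  show "?\<xi> = 0"
  proof (rule ccontr)
    assume "?\<xi> \<noteq> 0"
    have one: "rho_phase w * cis (2 * pi * (?\<xi> \<bullet> t)) = 1" if "h (t - z) \<noteq> 0" for t
      using eq'[of t] that x by simp
    let ?T = "\<lambda>r. s0 + z + r *\<^sub>R ?\<xi>"
    have "continuous_on UNIV (\<lambda>r::real. h (s0 + r *\<^sub>R ?\<xi>))"
      by (intro continuous_on_compose2[OF schwartz_continuous[OF h]] continuous_intros) auto
    then have "isCont (\<lambda>r. h (s0 + r *\<^sub>R ?\<xi>)) 0" by (simp add: continuous_on_eq_continuous_at)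
    then have "eventually (\<lambda>r. h (s0 + r *\<^sub>R ?\<xi>) \<noteq> 0) (at 0)"
      using nz by (intro tendsto_imp_eventually_ne[of _ "h s0"]) (simp add: isCont_def)
    then obtain d where d: "0 < d" "\<And>r. r \<noteq> 0 \<Longrightarrow> \<bar>r\<bar> < d \<Longrightarrow> h (s0 + r *\<^sub>R ?\<xi>) \<noteq> 0"
      unfolding eventually_at by (auto simp: dist_real_def)
    let ?n = "(norm ?\<xi>)\<^sup>2"
    have n: "0 < ?n" using \<open>?\<xi> \<noteq> 0\<close> by simp
    \<comment> \<open>a shift along \<open>\<xi>\<close> by \<open>r\<close> turns the phase by \<open>2 \<pi> r |\<xi>|\<^sup>2 \<in> (0, \<pi>]\<close>\<close>
    define r where "r = min (d / 2) (1 / (2 * ?n))"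
    have r: "0 < r" "r < d" "r * ?n \<le> 1 / 2" using d(1) n by (auto simp: r_def min_def field_simps)
    have "rho_phase w * cis (2 * pi * (?\<xi> \<bullet> ?T 0)) = 1" using nz by (intro one) simp
    moreover have "rho_phase w * cis (2 * pi * (?\<xi> \<bullet> ?T r)) = 1"
      using d(2)[of r] r by (intro one) (simp add: algebra_simps)
    moreover have "2 * pi * (?\<xi> \<bullet> ?T r) = 2 * pi * (?\<xi> \<bullet> ?T 0) + 2 * pi * (r * ?n)"
      by (simp add: inner_add_right power2_norm_eq_inner algebra_simps)
    ultimately have "rho_phase w * (cis (2 * pi * (?\<xi> \<bullet> ?T 0)) * cis (2 * pi * (r * ?n))) = 1"
      "rho_phase w * cis (2 * pi * (?\<xi> \<bullet> ?T 0)) = 1"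
      by (simp_all only: cis_mult)
    then have "cis (2 * pi * (r * ?n)) = 1" by (simp only: mult.assoc[symmetric] mult_1)
    define \<theta> where "\<theta> = 2 * pi * (r * ?n)"
    have "cis \<theta> = 1" unfolding \<theta>_def by fact
    from arg_cong[OF this, of Re] have "cos \<theta> = cos 0" by simp
    moreover have pos: "0 < \<theta>" using r(1) n by (simp add: \<theta>_def)
    moreover have "\<theta> \<le> pi" using r(3) mult_left_mono[of "r * ?n" "1/2" "2 * pi"] by (simp add: \<theta>_def)
    ultimately have "\<theta> = 0" by - (rule cos_inj_pi, auto)
    with pos show False by linarith
  qed
qed

text \<open>For the Gaussian \<open>G\<close>, let \<open>h = W(G, G)\<close> and \<open>k = W(\<pi>(z) G, \<pi>(z) G)\<close>. The hypothesis at the point \<open>z\<close> gives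
  \<open>\<langle>k, T\<^sub>z h\<rangle> = \<parallel>G\<parallel>\<^sup>4\<close>, which is also \<open>\<langle>k, k\<rangle>\<close> and \<open>\<langle>h, h\<rangle>\<close>; hence \<open>k = T\<^sub>z h\<close>. On the other hand \<open>k = \<rho>(w) h\<close> with
  \<open>w\<close> the image of the diagonal shift, so \<open>w\<close> is a pure translation by \<open>z\<close>.\<close>

lemma covariant_of_localization_op_eq_Op:
  assumes M: "metaplectic A U"
    and eq: "\<And>a \<phi>1 \<phi>2. a \<in> tempered \<Longrightarrow> \<phi>1 \<in> schwartz \<Longrightarrow> \<phi>2 \<in> schwartz \<Longrightarrow>
      operators_agree (localization_op \<phi>1 \<phi>2 a)
        (metaplectic_Op U (distr_convolution a (metaplectic_wigner_schwartz U \<phi>2 \<phi>1)))"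
  shows "covariant U"
  unfolding covariant_def
proof (intro ballI allI)
  fix f g :: "real ^ 'a \<Rightarrow> complex" and z assume fg: "f \<in> L2" "g \<in> L2"
  have U: "unitary_L2 U" and inter: "\<And>w f. f \<in> L2 \<Longrightarrow> ae_eq (U (rho w 0 f)) (rho (A *v w) 0 (U f))"
    using M unfolding metaplectic_def by blast+
  let ?G = "gaussian :: real ^ 'a \<Rightarrow> complex" and ?w = "A *v diag_shift z"
  let ?S = "tf_shift z ?G"
  have G: "?G \<in> schwartz" by (rule gaussian_schwartz)
  have S: "?S \<in> schwartz" by (rule schwartz_tf_shift[OF G])
  note W = metaplectic_wigner_schwartz[OF M]
  let ?h = "metaplectic_wigner_schwartz U ?G ?G" and ?k = "metaplectic_wigner_schwartz U ?S ?S"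
  have h: "?h \<in> schwartz" and k: "?k \<in> schwartz" by (intro W G S)+
  let ?c = "L2_inner ?G ?G * cnj (L2_inner ?G ?G)"
  have self: "L2_inner (metaplectic_wigner_schwartz U p p) (metaplectic_wigner_schwartz U p p) =
      L2_inner p p * cnj (L2_inner p p)" if p: "p \<in> schwartz" for p
  proof -
    note T = L2_tensor_cnj[OF schwartz_L2[OF p] schwartz_L2[OF p]]
    note X = unitary_L2D(1)[OF U T] schwartz_L2[OF W(1)[OF p p]]
    show ?thesis
      using L2_inner_cong[OF X(2,1,2,1) W(2)[OF p p] W(2)[OF p p]] unitary_L2D(3)[OF U T T]
        L2_inner_tensor_cnj[OF schwartz_L2[OF p] schwartz_L2[OF p] schwartz_L2[OF p] schwartz_L2[OF p]]
      by simp
  qed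
  have hh: "L2_inner ?h ?h = ?c" by (rule self[OF G])
  have kk: "L2_inner ?k ?k = ?c"
    using self[OF S] L2_inner_tf_shift_self[OF schwartz_L2[OF G], of z] by simp
  have "cnj (cnj (stft ?G ?S z) * stft ?G ?S z) = cnj (L2_inner ?k (translation z ?h))"
    using eq[OF evaluation_tempered[of z] G G] S
    unfolding operators_agree_def bracket_localization_op bracket_metaplectic_Op_convolution by (simp add: bracket_def)
  then have "L2_inner ?k (translation z ?h) = cnj (stft ?G ?S z) * stft ?G ?S z"
    by (metis complex_cnj_cnj)
  also have "\<dots> = ?c"
    using L2_inner_tf_shift_self[OF schwartz_L2[OF G], of z] by (simp add: stft_def mult.commute)
  finally have kh: "L2_inner ?k (translation z ?h) = ?c" .
  have "ae_eq ?k (translation z ?h)"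
    by (rule ae_eq_of_L2_inner_eq[OF schwartz_L2[OF k] schwartz_L2[OF schwartz_translation[OF h]] kh kk])
       (use hh L2_inner_translation_self[OF schwartz_L2[OF h]] in simp)
  moreover have "ae_eq ?k (rho ?w 0 ?h)"
  proof -
    have "ae_eq ?k (U (rho (diag_shift z) 0 (tensor_cnj ?G ?G)))"
      using W(2)[OF S S] by (simp add: tensor_cnj_tf_shift)
    also have "ae_eq \<dots> (rho ?w 0 (U (tensor_cnj ?G ?G)))"
      by (intro inter L2_tensor_cnj schwartz_L2 G)
    also have "ae_eq \<dots> (rho ?w 0 ?h)" by (intro ae_eq_rho ae_eq_sym[OF W(2)] G)
    finally show ?thesis .
  qed
  ultimately have "ae_eq (translation z ?h) (rho ?w 0 ?h)" using ae_eq_sym ae_eq_trans by blast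
  then have shift: "translation z ?h = rho ?w 0 ?h"
    by (intro continuous_ae_eq_imp_eq schwartz_continuous schwartz_translation schwartz_rho h)
  have "?G = (\<lambda>_. 0)" if "?c = 0"
  proof -
    have "L2_inner ?G ?G = 0" using that by simp
    then have "ae_eq ?G (\<lambda>_. 0)" by (intro L2_inner_self_eq_0 schwartz_L2 G)
    then show ?thesis by (intro continuous_ae_eq_imp_eq schwartz_continuous[OF G]) auto
  qed
  then have "?c \<noteq> 0" using gaussian_nonzero by metis
  then obtain s0 where s0: "?h s0 \<noteq> 0"
    using hh unfolding L2_inner_def by fastforce
  have w: "fst_part ?w = z" "snd_part ?w = 0" by (rule translation_eq_rho_imp[OF h s0 shift])+
  have "ae_eq (U (rho (diag_shift z) 0 (tensor_cnj f g))) (rho ?w 0 (U (tensor_cnj f g)))"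
    by (intro inter L2_tensor_cnj fg)
  moreover have "rho ?w 0 (U (tensor_cnj f g)) = translation z (U (tensor_cnj f g))"
    by (simp add: rho_0 rho_phase_def w tf_shift_def modulation_def)
  ultimately show "ae_eq (metaplectic_wigner U (tf_shift z f) (tf_shift z g)) (translation z (metaplectic_wigner U f g))"
    by (simp add: metaplectic_wigner_def tensor_cnj_tf_shift)
qed

theorem theorem1p1:
  fixes A :: "real ^ (('n::finite + 'n) + ('n + 'n)) ^ (('n + 'n) + ('n + 'n))"
    and U :: "(real ^ ('n + 'n) \<Rightarrow> complex) \<Rightarrow> (real ^ ('n + 'n) \<Rightarrow> complex)"
  assumes "A \<in> Sp" and "metaplectic A U"
  shows "(covariant U \<longrightarrow>
            (\<forall>\<phi>1 \<in> schwartz - {\<lambda>_. 0}. \<forall>\<phi>2 \<in> schwartz - {\<lambda>_. 0}. \<forall>a \<in> tempered.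
               operators_agree (localization_op \<phi>1 \<phi>2 a)
                 (metaplectic_Op U (distr_convolution a (metaplectic_wigner_schwartz U \<phi>2 \<phi>1))))) \<and>
         ((\<forall>a \<in> tempered. \<forall>\<phi>1 \<in> schwartz. \<forall>\<phi>2 \<in> schwartz.
               operators_agree (localization_op \<phi>1 \<phi>2 a)
                 (metaplectic_Op U (distr_convolution a (metaplectic_wigner_schwartz U \<phi>2 \<phi>1)))) \<longrightarrow>
            covariant U)"
  using localization_op_eq_Op_of_covariant[OF assms(2)] covariant_of_localization_op_eq_Op[OF assms(2)]
  by blast

end
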